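(* Let $\mathcal R$ be any aperiodic pmp singly-generated equivalence relation on a standard probability space $(X,\mu)$. Then the set $$\{(T,U)\in\mathrm{GEN}(\mathcal R)\times[\mathcal R]:\ \overline{\langle T,U\rangle}=[\mathcal R]\ \text{ and }\ \langle T,U\rangle\simeq\mathbb F_2\}$$ is a dense $G_\delta$ subset of $\mathrm{GEN}(\mathcal R)\times[\mathcal R]$.
   Context: Everything is understood modulo null sets. $(X,\mu)$ is a standard (atomless) probability space; $\mathrm{Aut}(X,\mu)$ is the group of measure-preserving Borel bijections of $X$ up to null sets. A pmp equivalence relation is the orbit equivalence relation of a measure-preserving action of a countable group on $(X,\mu)$; it is aperiodic if almost all its classes are infinite. The full group is $[\mathcal R]=\{T\in\mathrm{Aut}(X,\mu): T(x)\,\mathcal R\,x \text{ for a.e. } x\}$, with the topology of the uniform metric $d_u(T,T')=\mu(\{x:T(x)\neq T'(x)\})$; closures are taken in this topology. $\mathcal R$ is singly-generated if it is (up to a null set) the orbit equivalence relation of a single $T\in\mathrm{Aut}(X,\mu)$; $\mathrm{GEN}(\mathcal R)\subseteq[\mathcal R]$ is the set of all such $T$, with the topology induced by $d_u$. $\mathbb F_2$ is the free group on two generators. *)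

theory Defs
  imports "HOL-Probability.Probability" "HOL-Algebra.Group_Action" "HOL-Algebra.Generated_Groups"
begin

no_notation eq_closure_of (\<open>closure'_of\<index>\<close>)

section \<open>Standard atomless probability spaces\<close>

definition standard_borel :: "'a measure \<Rightarrow> bool" where
  "standard_borel M \<longleftrightarrow>
     (\<exists>S. completely_metrizable_space S \<and> second_countable S \<and> topspace S = space M \<and>
          sets M = sigma_sets (space M) {U. openin S U})"

definition atomless :: "'a measure \<Rightarrow> bool" where
  "atomless M \<longleftrightarrow>
     (\<forall>A\<in>sets M. 0 < measure M A \<longrightarrow>
        (\<exists>B\<in>sets M. B \<subseteq> A \<and> 0 < measure M B \<and> measure M B < measure M A))"

definition standard_prob_space :: "'a measure \<Rightarrow> bool" where
  "standard_prob_space M \<longleftrightarrow> prob_space M \<and> standard_borel M \<and> atomless M"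

section \<open>The automorphism group and the uniform metric\<close>

text \<open>Genuine (pointwise) measure-preserving Borel bijections. As elements of \<^const>\<open>Bij\<close> they are
  extensional, i.e. \<^const>\<open>undefined\<close> outside the space.\<close>

definition mp_bijections :: "'a measure \<Rightarrow> ('a \<Rightarrow> 'a) set" where
  "mp_bijections M =
     {f \<in> Bij (space M). f \<in> measurable M M \<and>
        restrict (inv_into (space M) f) (space M) \<in> measurable M M \<and> distr M M f = M}"

definition mp_group :: "'a measure \<Rightarrow> ('a \<Rightarrow> 'a) monoid" where
  "mp_group M = BijGroup (space M) \<lparr>carrier := mp_bijections M\<rparr>"

definition null_bijections :: "'a measure \<Rightarrow> ('a \<Rightarrow> 'a) set" where
  "null_bijections M = {f \<in> mp_bijections M. AE x in M. f x = x}"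

text \<open>The elements of \<open>Aut M\<close> are the cosets of the normal subgroup of maps that are almost
  everywhere the identity, which are exactly the classes of measure-preserving bijections modulo
  almost everywhere equality; see \<open>carrier_Aut\<close> and \<open>class_iff\<close> below.\<close>

definition Aut :: "'a measure \<Rightarrow> ('a \<Rightarrow> 'a) set monoid" where
  "Aut M = mp_group M Mod null_bijections M"

text \<open>The choice of representatives is immaterial; see \<open>d_u_eq\<close> below.\<close>

definition d_u :: "'a measure \<Rightarrow> ('a \<Rightarrow> 'a) set \<Rightarrow> ('a \<Rightarrow> 'a) set \<Rightarrow> real" where
  "d_u M T U = measure M {x \<in> space M. (SOME f. f \<in> T) x \<noteq> (SOME g. g \<in> U) x}"

section \<open>Measure-preserving equivalence relations and full groups\<close>

text \<open>Every countable group is isomorphic to one whose elements are natural numbers, so it is no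
  restriction to let the acting group have carrier in \<^typ>\<open>nat\<close>.\<close>

definition pmp_equiv_rel :: "'a measure \<Rightarrow> 'a rel \<Rightarrow> bool" where
  "pmp_equiv_rel M R \<longleftrightarrow>
     (\<exists>(G :: nat monoid) \<phi>. group_action G (space M) \<phi> \<and>
        (\<forall>g\<in>carrier G. \<phi> g \<in> mp_bijections M) \<and>
        R = {(x, y). x \<in> space M \<and> y \<in> orbit G \<phi> x})"

definition aperiodic :: "'a measure \<Rightarrow> 'a rel \<Rightarrow> bool" where
  "aperiodic M R \<longleftrightarrow> (AE x in M. infinite (R `` {x}))"

definition rel_eq_mod_null :: "'a measure \<Rightarrow> 'a rel \<Rightarrow> 'a rel \<Rightarrow> bool" where
  "rel_eq_mod_null M R S \<longleftrightarrow>
     (\<exists>N\<in>null_sets M. \<forall>x\<in>space M - N. \<forall>y\<in>space M - N. (x, y) \<in> R \<longleftrightarrow> (x, y) \<in> S)"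

text \<open>For a bijection \<open>f\<close> of \<open>X\<close>, points \<open>x\<close> and \<open>y\<close> are in the same orbit under all integer
  powers of \<open>f\<close> iff one is the image of the other under a nonnegative power.\<close>

definition orbit_rel :: "'a set \<Rightarrow> ('a \<Rightarrow> 'a) \<Rightarrow> 'a rel" where
  "orbit_rel X f = {(x, y). x \<in> X \<and> y \<in> X \<and> (\<exists>n. y = (f ^^ n) x \<or> x = (f ^^ n) y)}"

definition full_group :: "'a measure \<Rightarrow> 'a rel \<Rightarrow> ('a \<Rightarrow> 'a) set set" where
  "full_group M R = {T \<in> carrier (Aut M). \<exists>f\<in>T. AE x in M. (x, f x) \<in> R}"

definition GEN :: "'a measure \<Rightarrow> 'a rel \<Rightarrow> ('a \<Rightarrow> 'a) set set" where
  "GEN M R = {T \<in> carrier (Aut M). \<exists>f\<in>T. rel_eq_mod_null M R (orbit_rel (space M) f)}"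

definition singly_generated :: "'a measure \<Rightarrow> 'a rel \<Rightarrow> bool" where
  "singly_generated M R \<longleftrightarrow> GEN M R \<noteq> {}"

definition full_topology :: "'a measure \<Rightarrow> 'a rel \<Rightarrow> ('a \<Rightarrow> 'a) set topology" where
  "full_topology M R = Metric_space.mtopology (full_group M R) (d_u M)"

definition GEN_topology :: "'a measure \<Rightarrow> 'a rel \<Rightarrow> ('a \<Rightarrow> 'a) set topology" where
  "GEN_topology M R = subtopology (full_topology M R) (GEN M R)"

section \<open>Free groups\<close>

text \<open>The letter \<open>(True, s)\<close> stands for the generator \<open>s\<close> and \<open>(False, s)\<close> for its formal
  inverse. The free group consists of the reduced words, multiplied by concatenation followed by
  cancellation.\<close>

definition inv_letter :: "bool \<times> 's \<Rightarrow> bool \<times> 's" where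
  "inv_letter a = (\<not> fst a, snd a)"

definition reduced :: "(bool \<times> 's) list \<Rightarrow> bool" where
  "reduced w \<longleftrightarrow> successively (\<lambda>a b. b \<noteq> inv_letter a) w"

definition cons_red :: "bool \<times> 's \<Rightarrow> (bool \<times> 's) list \<Rightarrow> (bool \<times> 's) list" where
  "cons_red a w = (if w \<noteq> [] \<and> hd w = inv_letter a then tl w else a # w)"

definition free_group :: "'s set \<Rightarrow> (bool \<times> 's) list monoid" where
  "free_group S =
     \<lparr>carrier = {w. reduced w \<and> snd ` set w \<subseteq> S}, mult = foldr cons_red, one = []\<rparr>"

definition F\<^sub>2 :: "(bool \<times> bool) list monoid" where
  "F\<^sub>2 = free_group UNIV"

section \<open>Well-definedness\<close>

lemma inv_letter_inv_letter [simp]: "inv_letter (inv_letter a) = a"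
  by (simp add: inv_letter_def)

lemma inv_letter_neq [simp]: "inv_letter a \<noteq> a" "a \<noteq> inv_letter a"
  by (cases a; simp add: inv_letter_def)+

lemma snd_inv_letter [simp]: "snd (inv_letter a) = snd a"
  by (simp add: inv_letter_def)

lemma reduced_Nil [simp]: "reduced []"
  by (simp add: reduced_def)

lemma reduced_Cons: "reduced (a # w) \<longleftrightarrow> reduced w \<and> (w = [] \<or> hd w \<noteq> inv_letter a)"
  by (cases w) (auto simp: reduced_def)

lemma reduced_cons_red: "reduced w \<Longrightarrow> reduced (cons_red a w)"
  by (cases w) (auto simp: cons_red_def reduced_Cons)

lemma cons_red_reduced: "reduced (a # w) \<Longrightarrow> cons_red a w = a # w"
  by (auto simp: cons_red_def reduced_Cons)

lemma set_cons_red: "set (cons_red a w) \<subseteq> insert a (set w)"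
  by (cases w) (auto simp: cons_red_def)

lemma cons_red_cancel: "reduced w \<Longrightarrow> cons_red a (cons_red (inv_letter a) w) = w"
  by (cases w; cases "tl w") (auto simp: cons_red_def reduced_Cons)

lemma reduced_foldr: "reduced v \<Longrightarrow> reduced (foldr cons_red u v)"
  by (induction u) (auto intro: reduced_cons_red)

lemma set_foldr: "set (foldr cons_red u v) \<subseteq> set u \<union> set v"
  by (induction u) (use set_cons_red in \<open>fastforce+\<close>)

lemma foldr_cons_red:
  "reduced t \<Longrightarrow> reduced w \<Longrightarrow> foldr cons_red (cons_red a t) w = cons_red a (foldr cons_red t w)"
proof (cases "t \<noteq> [] \<and> hd t = inv_letter a")
  case True
  assume "reduced t" "reduced w"
  with True obtain t' where t: "t = inv_letter a # t'"
    by (cases t) auto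
  have "cons_red a (foldr cons_red t w) = foldr cons_red t' w"
    unfolding t using cons_red_cancel[OF reduced_foldr[OF \<open>reduced w\<close>], of a t'] by simp
  then show ?thesis
    by (simp add: t cons_red_def[of a "inv_letter a # t'"])
qed (auto simp: cons_red_def[of a t])

lemma foldr_assoc:
  assumes "reduced v" "reduced w"
  shows "foldr cons_red (foldr cons_red u v) w = foldr cons_red u (foldr cons_red v w)"
  by (induction u) (simp_all add: foldr_cons_red reduced_foldr assms)

lemma foldr_Nil: "reduced u \<Longrightarrow> foldr cons_red u [] = u"
  by (induction u) (auto simp: reduced_Cons cons_red_def)

lemma reduced_letter [simp]: "reduced [a]"
  by (simp add: reduced_Cons)

lemma foldr_cancel:
  "reduced w \<Longrightarrow> foldr cons_red (rev (map inv_letter u)) (foldr cons_red u w) = w"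
proof (induction u arbitrary: w)
  case (Cons a u)
  have "cons_red (inv_letter a) (cons_red a (foldr cons_red u w)) = foldr cons_red u w"
    using cons_red_cancel[of "foldr cons_red u w" "inv_letter a"] reduced_foldr[OF Cons.prems] by simp
  then show ?case
    using Cons by simp
qed simp

theorem group_free_group: "group (free_group S)"
proof (rule groupI)
  fix u assume u: "u \<in> carrier (free_group S)"
  define v where "v = foldr cons_red (rev (map inv_letter u)) []"
  have "v \<in> carrier (free_group S)"
    using u set_foldr[of "rev (map inv_letter u)" "[]"] unfolding v_def
    by (fastforce simp: free_group_def reduced_foldr)
  moreover have "v \<otimes>\<^bsub>free_group S\<^esub> u = \<one>\<^bsub>free_group S\<^esub>"
    using u foldr_assoc[of "[]" u "rev (map inv_letter u)"] foldr_cancel[of "[]" u] foldr_Nil[of u]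
    by (simp add: free_group_def v_def)
  ultimately show "\<exists>v\<in>carrier (free_group S). v \<otimes>\<^bsub>free_group S\<^esub> u = \<one>\<^bsub>free_group S\<^esub>" by blast
next
  fix u v assume "u \<in> carrier (free_group S)" "v \<in> carrier (free_group S)"
  then show "u \<otimes>\<^bsub>free_group S\<^esub> v \<in> carrier (free_group S)"
    using set_foldr[of u v] by (fastforce simp: free_group_def reduced_foldr)
qed (auto simp: free_group_def foldr_assoc)

lemma free_group_universal:
  assumes "group H" and f: "f \<in> S \<rightarrow> carrier H"
  shows "\<exists>h\<in>hom (free_group S) H. \<forall>s\<in>S. h [(True, s)] = f s"
proof -
  interpret H: group H by fact
  define l where "l a = (if fst a then f (snd a) else inv\<^bsub>H\<^esub> f (snd a))" for a
  define h where "h w = foldr (\<lambda>a x. l a \<otimes>\<^bsub>H\<^esub> x) w \<one>\<^bsub>H\<^esub>" for w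
  have l: "l a \<in> carrier H" if "snd a \<in> S" for a
    using f that by (auto simp: l_def)
  have l_inv: "l (inv_letter a) = inv\<^bsub>H\<^esub> l a" if "snd a \<in> S" for a
  proof -
    have "f (snd a) \<in> carrier H" using f that by blast
    then show ?thesis by (simp add: l_def inv_letter_def)
  qed
  have h: "h w \<in> carrier H" if "snd ` set w \<subseteq> S" for w
    using that by (induction w) (auto simp: h_def l)
  have cons: "h (cons_red a w) = l a \<otimes>\<^bsub>H\<^esub> h w" if "snd a \<in> S" "snd ` set w \<subseteq> S" for a w
  proof (cases "w \<noteq> [] \<and> hd w = inv_letter a")
    case True
    then obtain t where t: "w = inv_letter a # t" by (cases w) auto
    have "l a \<otimes>\<^bsub>H\<^esub> (inv\<^bsub>H\<^esub> l a \<otimes>\<^bsub>H\<^esub> h t) = h t"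
      using that l[of a] h[of t] by (simp add: t flip: H.m_assoc)
    then show ?thesis
      using that by (simp add: t cons_red_def h_def l_inv)
  qed (auto simp: cons_red_def h_def)
  have "h (foldr cons_red u v) = h u \<otimes>\<^bsub>H\<^esub> h v" if "snd ` set u \<subseteq> S" "snd ` set v \<subseteq> S" for u v
    using that(1)
  proof (induction u)
    case Nil
    then show ?case using h[OF that(2)] by (simp add: h_def)
  next
    case (Cons a u)
    have "snd ` set (foldr cons_red u v) \<subseteq> S"
      using Cons.prems that(2) set_foldr[of u v] by fastforce
    then have "h (foldr cons_red (a # u) v) = l a \<otimes>\<^bsub>H\<^esub> (h u \<otimes>\<^bsub>H\<^esub> h v)"
      using Cons cons[of a "foldr cons_red u v"] by simp
    also have "\<dots> = h (a # u) \<otimes>\<^bsub>H\<^esub> h v"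
      using Cons.prems l[of a] h[of u] h[OF that(2)] by (simp add: h_def[of "a # u"] H.m_assoc flip: h_def)
    finally show ?case .
  qed
  then have "h \<in> hom (free_group S) H"
    using h by (auto simp: hom_def free_group_def)
  moreover have "\<forall>s\<in>S. h [(True, s)] = f s"
    using f by (auto simp: h_def l_def Pi_iff)
  ultimately show ?thesis by blast
qed

lemma group_mp_group: "group (mp_group M)"
proof -
  let ?X = "space M" and ?P = "mp_bijections M"
  interpret B: group "BijGroup ?X" by (rule group_BijGroup)
  have comp: "compose ?X f g \<in> ?P" if f: "f \<in> ?P" and g: "g \<in> ?P" for f g
  proof -
    have fb: "f \<in> Bij ?X" "f \<in> measurable M M" "restrict (inv_into ?X f) ?X \<in> measurable M M"
      "distr M M f = M" and gb: "g \<in> Bij ?X" "g \<in> measurable M M"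
      "restrict (inv_into ?X g) ?X \<in> measurable M M" "distr M M g = M"
      using f g by (auto simp: mp_bijections_def)
    have c: "compose ?X f g \<in> Bij ?X" using fb gb by (intro compose_Bij)
    have m: "compose ?X f g \<in> measurable M M"
      using measurable_comp[OF gb(2) fb(2)] by (rule measurable_cong[THEN iffD1, rotated]) (simp add: compose_def)
    have "restrict (inv_into ?X g) ?X \<circ> restrict (inv_into ?X f) ?X \<in> measurable M M"
      using measurable_comp[OF fb(3) gb(3)] .
    then have i: "restrict (inv_into ?X (compose ?X f g)) ?X \<in> measurable M M"
    proof (rule measurable_cong[THEN iffD1, rotated])
      fix x assume x: "x \<in> ?X"
      have bf: "bij_betw f ?X ?X" and bg: "bij_betw g ?X ?X" and bc: "bij_betw (compose ?X f g) ?X ?X"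
        using fb gb c by (auto simp: Bij_def)
      define z where "z = inv_into ?X g (inv_into ?X f x)"
      have y: "inv_into ?X f x \<in> ?X" "f (inv_into ?X f x) = x"
        using bf x by (auto simp: bij_betw_def inv_into_into f_inv_into_f)
      have z: "z \<in> ?X" "g z = inv_into ?X f x"
        using bg y by (auto simp: bij_betw_def inv_into_into f_inv_into_f z_def)
      have "compose ?X f g z = x" using y z by (simp add: compose_def)
      then have "inv_into ?X (compose ?X f g) x = z"
        using bc z(1) by (metis bij_betw_inv_into_left)
      then show "(restrict (inv_into ?X g) ?X \<circ> restrict (inv_into ?X f) ?X) x
          = restrict (inv_into ?X (compose ?X f g)) ?X x"
        using x y by (simp add: z_def)
    qed
    have "distr M M (compose ?X f g) = distr M M (f \<circ> g)"
      by (rule distr_cong) (auto simp: compose_def)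
    also have "\<dots> = M" using distr_distr[OF fb(2) gb(2)] fb gb by simp
    finally show ?thesis using c m i by (simp add: mp_bijections_def)
  qed
  have one: "(\<lambda>x\<in>?X. x) \<in> ?P"
  proof -
    have "(\<lambda>x\<in>?X. x) \<in> measurable M M"
      by (rule measurable_cong[THEN iffD1, OF _ measurable_ident]) simp
    moreover have "restrict (inv_into ?X (\<lambda>x\<in>?X. x)) ?X \<in> measurable M M"
      by (rule measurable_cong[THEN iffD1, OF _ measurable_ident])
        (auto simp: inv_into_def intro!: some_equality[symmetric])
    moreover have "distr M M (\<lambda>x\<in>?X. x) = M"
      using distr_cong[of M M M M "\<lambda>x\<in>?X. x" "\<lambda>x. x"] by (simp add: distr_id)
    ultimately show ?thesis by (simp add: mp_bijections_def id_Bij)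
  qed
  have invP: "restrict (inv_into ?X f) ?X \<in> ?P" if f: "f \<in> ?P" for f
  proof -
    let ?g = "restrict (inv_into ?X f) ?X"
    have fb: "f \<in> Bij ?X" "f \<in> measurable M M" "?g \<in> measurable M M"
      "distr M M f = M" using f by (auto simp: mp_bijections_def)
    have bf: "bij_betw f ?X ?X" using fb by (auto simp: Bij_def)
    have g: "?g \<in> Bij ?X" using fb by (intro restrict_inv_into_Bij)
    have bg: "bij_betw ?g ?X ?X" using g by (auto simp: Bij_def)
    have "restrict (inv_into ?X ?g) ?X \<in> measurable M M"
    proof (rule measurable_cong[THEN iffD1, OF _ fb(2)])
      fix x assume x: "x \<in> ?X"
      then have "f x \<in> ?X" "?g (f x) = x"
        using bf by (auto simp: bij_betw_def)
      then show "f x = restrict (inv_into ?X ?g) ?X x"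
        using bg x by (metis bij_betw_inv_into_left restrict_apply')
    qed
    moreover have "distr M M ?g = M"
    proof -
      have "distr M M ?g = distr (distr M M f) M ?g" using fb by simp
      also have "\<dots> = distr M M (?g \<circ> f)" using fb by (intro distr_distr)
      also have "\<dots> = distr M M (\<lambda>x. x)"
        using bf by (intro distr_cong) (auto simp: bij_betw_def)
      finally show ?thesis by (simp add: distr_id)
    qed
    ultimately show ?thesis using g fb by (simp add: mp_bijections_def)
  qed
  have sub: "?P \<subseteq> Bij ?X" by (auto simp: mp_bijections_def)
  have "subgroup ?P (BijGroup ?X)"
  proof (rule B.subgroupI)
    show "?P \<subseteq> carrier (BijGroup ?X)" using sub by (simp add: BijGroup_def)
    show "?P \<noteq> {}" using one by blast
    fix f assume f: "f \<in> ?P"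
    then have "inv\<^bsub>BijGroup ?X\<^esub> f = restrict (inv_into ?X f) ?X"
      using sub by (intro inv_BijGroup) auto
    then show "inv\<^bsub>BijGroup ?X\<^esub> f \<in> ?P" using invP f by simp
    fix g assume "g \<in> ?P"
    then show "f \<otimes>\<^bsub>BijGroup ?X\<^esub> g \<in> ?P" using comp f sub by (auto simp: BijGroup_def)
  qed
  then show ?thesis unfolding mp_group_def by (rule subgroup.subgroup_is_group) (rule B.group_axioms)
qed

lemma subset_mp_Bij: "mp_bijections M \<subseteq> Bij (space M)"
  by (auto simp: mp_bijections_def)

lemma mp_bijections_simps [simp]:
  assumes "f \<in> mp_bijections M"
  shows "f \<in> measurable M M" "distr M M f = M" "bij_betw f (space M) (space M)"
    "f \<in> extensional (space M)"
  using assms by (auto simp: mp_bijections_def Bij_def)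

lemma AE_comp_mp:
  assumes "f \<in> mp_bijections M" "AE x in M. P x"
  shows "AE x in M. P (f x)"
proof -
  obtain N where N: "N \<in> null_sets M" "{x \<in> space M. \<not> P x} \<subseteq> N"
    using assms(2) by (auto simp: eventually_ae_filter)
  have "AE x in distr M M f. x \<notin> N"
    using N assms(1) by (simp add: AE_not_in)
  then have "AE x in M. f x \<notin> N"
    by (rule AE_distrD[OF mp_bijections_simps(1)[OF assms(1)]])
  then show ?thesis
  proof (rule AE_mp, intro AE_I2 impI)
    fix x assume "x \<in> space M" "f x \<notin> N"
    then show "P (f x)"
      using N(2) measurable_space[OF mp_bijections_simps(1)[OF assms(1)]] by auto
  qed
qed

lemma mult_mp_group:
  "f \<in> mp_bijections M \<Longrightarrow> g \<in> mp_bijections M \<Longrightarrow> f \<otimes>\<^bsub>mp_group M\<^esub> g = compose (space M) f g"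
  using subset_mp_Bij[of M] by (auto simp: mp_group_def BijGroup_def)

lemma carrier_mp_group [simp]: "carrier (mp_group M) = mp_bijections M"
  by (simp add: mp_group_def)

lemma one_mp_group: "\<one>\<^bsub>mp_group M\<^esub> = (\<lambda>x\<in>space M. x)"
  by (simp add: mp_group_def BijGroup_def)

lemma inv_mp_group:
  assumes f: "f \<in> mp_bijections M" and x: "x \<in> space M"
  shows "(inv\<^bsub>mp_group M\<^esub> f) (f x) = x" "f ((inv\<^bsub>mp_group M\<^esub> f) x) = x"
proof -
  interpret group "mp_group M" by (rule group_mp_group)
  have i: "inv\<^bsub>mp_group M\<^esub> f \<in> mp_bijections M"
    using f inv_closed[of f] by simp
  have "compose (space M) (inv\<^bsub>mp_group M\<^esub> f) f = (\<lambda>x\<in>space M. x)"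
       "compose (space M) f (inv\<^bsub>mp_group M\<^esub> f) = (\<lambda>x\<in>space M. x)"
    using l_inv[of f] r_inv[of f] f i by (simp_all add: mult_mp_group one_mp_group)
  then show "(inv\<^bsub>mp_group M\<^esub> f) (f x) = x" "f ((inv\<^bsub>mp_group M\<^esub> f) x) = x"
    using x by (metis compose_eq restrict_apply')+
qed

lemma normal_null_bijections: "null_bijections M \<lhd> mp_group M"
proof -
  interpret group "mp_group M" by (rule group_mp_group)
  let ?N = "null_bijections M"
  have inv_closed': "inv\<^bsub>mp_group M\<^esub> f \<in> mp_bijections M" if "f \<in> mp_bijections M" for f
    using inv_closed[of f] that by simp
  have sub: "subgroup ?N (mp_group M)"
  proof (rule subgroupI)
    show "?N \<subseteq> carrier (mp_group M)" by (auto simp: null_bijections_def)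
    have "\<one>\<^bsub>mp_group M\<^esub> \<in> ?N"
      using one_closed by (simp add: null_bijections_def) (simp add: one_mp_group)
    then show "?N \<noteq> {}" by blast
    fix f assume f: "f \<in> ?N"
    then have f': "f \<in> mp_bijections M" "AE x in M. f x = x" by (auto simp: null_bijections_def)
    have "AE x in M. (inv\<^bsub>mp_group M\<^esub> f) x = x"
      using f'(2) AE_space by eventually_elim (metis f'(1) inv_mp_group(1))
    then show "inv\<^bsub>mp_group M\<^esub> f \<in> ?N"
      using inv_closed'[OF f'(1)] by (simp add: null_bijections_def)
    fix g assume "g \<in> ?N"
    then have g': "g \<in> mp_bijections M" "AE x in M. g x = x" by (auto simp: null_bijections_def)
    have "AE x in M. compose (space M) f g x = x"
      using f'(2) g'(2) AE_space by eventually_elim (simp add: compose_def)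
    then show "f \<otimes>\<^bsub>mp_group M\<^esub> g \<in> ?N"
      using m_closed[of f g] f' g' by (simp add: null_bijections_def mult_mp_group)
  qed
  show ?thesis
  proof (rule normal_invI[OF sub])
    fix f n assume f: "f \<in> carrier (mp_group M)" and n: "n \<in> ?N"
    then have f': "f \<in> mp_bijections M" and n': "n \<in> mp_bijections M" "AE x in M. n x = x"
      by (auto simp: null_bijections_def)
    define h where "h = inv\<^bsub>mp_group M\<^esub> f"
    have h: "h \<in> mp_bijections M" using inv_closed'[OF f'] by (simp add: h_def)
    have fn: "compose (space M) f n \<in> mp_bijections M"
      using m_closed[of f n] f' n' by (simp add: mult_mp_group)
    have "compose (space M) (compose (space M) f n) h \<in> mp_bijections M"
      using m_closed[of "compose (space M) f n" h] fn h by (simp add: mult_mp_group)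
    moreover have "AE x in M. compose (space M) (compose (space M) f n) h x = x"
      using AE_comp_mp[OF h n'(2)] AE_space
    proof eventually_elim
      case (elim x)
      have "h x \<in> space M" using elim(2) measurable_space[OF mp_bijections_simps(1)[OF h]] by blast
      then show ?case using elim inv_mp_group(2)[OF f' elim(2)] by (simp add: compose_def h_def)
    qed
    ultimately show "f \<otimes>\<^bsub>mp_group M\<^esub> n \<otimes>\<^bsub>mp_group M\<^esub> inv\<^bsub>mp_group M\<^esub> f \<in> ?N"
      using f' n' fn h by (simp add: null_bijections_def mult_mp_group flip: h_def)
  qed
qed

theorem group_Aut: "group (Aut M)"
  unfolding Aut_def by (rule normal.factorgroup_is_group[OF normal_null_bijections])

lemma rcoset_null_bijections:
  assumes f: "f \<in> mp_bijections M"
  shows "null_bijections M #>\<^bsub>mp_group M\<^esub> f = {g \<in> mp_bijections M. AE x in M. f x = g x}"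
proof -
  interpret group "mp_group M" by (rule group_mp_group)
  define h where "h = inv\<^bsub>mp_group M\<^esub> f"
  have h: "h \<in> mp_bijections M" using inv_closed[of f] f by (simp add: h_def)
  show ?thesis
  proof (intro equalityI subsetI)
    fix g assume "g \<in> null_bijections M #>\<^bsub>mp_group M\<^esub> f"
    then obtain n where n: "n \<in> mp_bijections M" "AE x in M. n x = x" "g = n \<otimes>\<^bsub>mp_group M\<^esub> f"
      by (auto simp: r_coset_def null_bijections_def)
    have "AE x in M. f x = g x"
      using AE_comp_mp[OF f n(2)] AE_space
      by eventually_elim (simp add: n(3) mult_mp_group n(1) f compose_def)
    moreover have "g \<in> mp_bijections M" using m_closed[of n f] n f by simp
    ultimately show "g \<in> {g \<in> mp_bijections M. AE x in M. f x = g x}" by simp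
  next
    fix g assume "g \<in> {g \<in> mp_bijections M. AE x in M. f x = g x}"
    then have g: "g \<in> mp_bijections M" "AE x in M. f x = g x" by auto
    have "AE x in M. (g \<otimes>\<^bsub>mp_group M\<^esub> h) x = x"
      using AE_comp_mp[OF h g(2)] AE_space
    proof eventually_elim
      case (elim x)
      then show ?case
        using inv_mp_group(2)[OF f elim(2)] by (simp add: mult_mp_group g h compose_def flip: h_def)
    qed
    then have "g \<otimes>\<^bsub>mp_group M\<^esub> h \<in> null_bijections M"
      using m_closed[of g h] g h by (simp add: null_bijections_def)
    moreover have "g = (g \<otimes>\<^bsub>mp_group M\<^esub> h) \<otimes>\<^bsub>mp_group M\<^esub> f"
      using g f h m_assoc[of g h f] l_inv[of f] by (simp add: h_def)
    ultimately show "g \<in> null_bijections M #>\<^bsub>mp_group M\<^esub> f"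
      by (auto simp: r_coset_def)
  qed
qed

theorem carrier_Aut:
  "carrier (Aut M) = (\<lambda>f. {g \<in> mp_bijections M. AE x in M. f x = g x}) ` mp_bijections M"
  using rcoset_null_bijections[of _ M] by (auto simp: Aut_def carrier_FactGroup)

theorem class_iff:
  assumes "T \<in> carrier (Aut M)" "f \<in> T"
  shows "g \<in> T \<longleftrightarrow> g \<in> mp_bijections M \<and> (AE x in M. f x = g x)"
  using assms by (auto simp: carrier_Aut elim!: AE_mp)

theorem mult_Aut:
  assumes "T \<in> carrier (Aut M)" "U \<in> carrier (Aut M)" "f \<in> T" "g \<in> U"
  shows "compose (space M) f g \<in> T \<otimes>\<^bsub>Aut M\<^esub> U"
proof -
  have "f \<in> mp_bijections M" "g \<in> mp_bijections M" using assms by (auto simp: carrier_Aut)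
  then show ?thesis using assms mult_mp_group[of f M g] by (force simp: Aut_def set_mult_def)
qed

lemma sets_neq:
  assumes M: "standard_borel M" and f: "f \<in> measurable M M" and g: "g \<in> measurable M M"
  shows "{x \<in> space M. f x \<noteq> g x} \<in> sets M"
proof -
  obtain S where S: "completely_metrizable_space S" "second_countable S" "topspace S = space M"
    "sets M = sigma_sets (space M) {U. openin S U}"
    using M by (auto simp: standard_borel_def)
  obtain B where B: "countable B" "\<And>V. V \<in> B \<Longrightarrow> openin S V"
    "\<And>U x. openin S U \<Longrightarrow> x \<in> U \<Longrightarrow> \<exists>V\<in>B. x \<in> V \<and> V \<subseteq> U"
    using S(2) by (auto simp: second_countable_def)
  have "Hausdorff_space S"
    using S(1) completely_metrizable_imp_metrizable_space metrizable_imp_Hausdorff_space by blast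
  have BM: "V \<in> sets M" if "V \<in> B" for V
    using B(2)[OF that] by (auto simp: S(4))
  have sp: "f x \<in> space M" "g x \<in> space M" if "x \<in> space M" for x
    using that f g by (auto dest: measurable_space)
  have "\<exists>V\<in>B. \<exists>W\<in>B. V \<inter> W = {} \<and> f x \<in> V \<and> g x \<in> W" if x: "x \<in> space M" "f x \<noteq> g x" for x
  proof -
    obtain U U' where "openin S U" "openin S U'" "f x \<in> U" "g x \<in> U'" "disjnt U U'"
      using \<open>Hausdorff_space S\<close> sp[OF x(1)] x(2)
      unfolding Hausdorff_space_def S(3) by meson
    moreover obtain V where "V \<in> B" "f x \<in> V" "V \<subseteq> U"
      using B(3) \<open>openin S U\<close> \<open>f x \<in> U\<close> by blast
    moreover obtain W where "W \<in> B" "g x \<in> W" "W \<subseteq> U'"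
      using B(3) \<open>openin S U'\<close> \<open>g x \<in> U'\<close> by blast
    ultimately show ?thesis unfolding disjnt_def by blast
  qed
  then have "{x \<in> space M. f x \<noteq> g x} =
      (\<Union>(V, W)\<in>{(V, W) \<in> B \<times> B. V \<inter> W = {}}. (f -` V \<inter> space M) \<inter> (g -` W \<inter> space M))"
    by (auto; blast)
  also have "\<dots> \<in> sets M"
  proof (rule sets.countable_UN')
    show "countable {(V, W) \<in> B \<times> B. V \<inter> W = {}}"
      by (rule countable_subset[OF _ countable_SIGMA[OF B(1), of "\<lambda>_. B"]]) (use B(1) in auto)
  qed (use BM f g in \<open>auto intro!: sets.Int measurable_sets\<close>)
  finally show ?thesis .
qed

theorem d_u_eq:
  assumes M: "standard_prob_space M" and T: "T \<in> carrier (Aut M)" "f \<in> T"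
    and U: "U \<in> carrier (Aut M)" "g \<in> U"
  shows "d_u M T U = measure M {x \<in> space M. f x \<noteq> g x}"
proof -
  interpret prob_space M using M by (simp add: standard_prob_space_def)
  define f' where "f' = (SOME f. f \<in> T)"
  define g' where "g' = (SOME g. g \<in> U)"
  have "f' \<in> T" "g' \<in> U" unfolding f'_def g'_def using T(2) U(2) by (metis someI)+
  then have ae: "AE x in M. f x = f' x" "AE x in M. g x = g' x"
    and mp: "f' \<in> mp_bijections M" "g' \<in> mp_bijections M"
    using class_iff[OF T, of f'] class_iff[OF U, of g'] by auto
  have mp': "f \<in> mp_bijections M" "g \<in> mp_bijections M"
    using T U by (auto simp: carrier_Aut)
  have sb: "standard_borel M" using M by (simp add: standard_prob_space_def)
  have "measure M {x \<in> space M. f' x \<noteq> g' x} = measure M {x \<in> space M. f x \<noteq> g x}"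
  proof (rule measure_eq_AE)
    show "AE x in M. x \<in> {x \<in> space M. f' x \<noteq> g' x} \<longleftrightarrow> x \<in> {x \<in> space M. f x \<noteq> g x}"
      using ae by eventually_elim simp
  qed (use mp mp' sb in \<open>auto intro!: sets_neq\<close>)
  then show ?thesis by (simp add: d_u_def f'_def g'_def)
qed

theorem Metric_space_Aut:
  assumes M: "standard_prob_space M"
  shows "Metric_space (carrier (Aut M)) (d_u M)"
proof
  interpret prob_space M using M by (simp add: standard_prob_space_def)
  have sb: "standard_borel M" using M by (simp add: standard_prob_space_def)
  have ex: "\<exists>f. f \<in> T \<and> f \<in> mp_bijections M" if "T \<in> carrier (Aut M)" for T
    using that by (auto simp: carrier_Aut)
  show "0 \<le> d_u M T U" for T U by (simp add: d_u_def)
  show "d_u M T U = d_u M U T" for T U by (simp add: d_u_def eq_commute)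
  show "d_u M T U = 0 \<longleftrightarrow> T = U" if T: "T \<in> carrier (Aut M)" and U: "U \<in> carrier (Aut M)" for T U
  proof -
    obtain f g where f: "f \<in> T" "f \<in> mp_bijections M" and g: "g \<in> U" "g \<in> mp_bijections M"
      using ex[OF T] ex[OF U] by blast
    have "{x \<in> space M. f x \<noteq> g x} \<in> sets M" using sb f g by (intro sets_neq) auto
    then have "d_u M T U = 0 \<longleftrightarrow> (AE x in M. f x = g x)"
      using d_u_eq[OF M T f(1) U g(1)] prob_eq_0[of "{x \<in> space M. f x \<noteq> g x}"]
      by (simp cong: AE_cong_simp)
    also have "\<dots> \<longleftrightarrow> T = U"
    proof
      assume ae: "AE x in M. f x = g x"
      have "h \<in> T \<longleftrightarrow> h \<in> U" for h
      proof -
        have "(AE x in M. f x = h x) \<longleftrightarrow> (AE x in M. g x = h x)"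
          by (rule iffI; use ae in \<open>auto elim!: AE_mp\<close>)
        then show ?thesis by (simp add: class_iff[OF T f(1)] class_iff[OF U g(1)])
      qed
      then show "T = U" by blast
    next
      assume "T = U"
      then show "AE x in M. f x = g x" using class_iff[OF T f(1), of g] g by simp
    qed
    finally show ?thesis .
  qed
  show "d_u M T V \<le> d_u M T U + d_u M U V"
    if T: "T \<in> carrier (Aut M)" and U: "U \<in> carrier (Aut M)" and V: "V \<in> carrier (Aut M)" for T U V
  proof -
    obtain f g h where f: "f \<in> T" "f \<in> mp_bijections M" and g: "g \<in> U" "g \<in> mp_bijections M"
      and h: "h \<in> V" "h \<in> mp_bijections M"
      using ex[OF T] ex[OF U] ex[OF V] by blast
    let ?D = "\<lambda>f g. {x \<in> space M. f x \<noteq> g x}"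
    have s: "?D f g \<in> sets M" "?D g h \<in> sets M" using sb f g h by (auto intro: sets_neq)
    have "measure M (?D f h) \<le> measure M (?D f g \<union> ?D g h)"
      using s by (intro finite_measure_mono) auto
    also have "\<dots> \<le> measure M (?D f g) + measure M (?D g h)"
      using s by (rule measure_Un_le)
    finally show ?thesis
      using d_u_eq[OF M T f(1) V h(1)] d_u_eq[OF M T f(1) U g(1)] d_u_eq[OF M U g(1) V h(1)] by simp
  qed
qed

theorem Metric_space_full_group:
  assumes "standard_prob_space M"
  shows "Metric_space (full_group M R) (d_u M)"
  using Metric_space.subspace[OF Metric_space_Aut[OF assms]] by (auto simp: full_group_def)

lemma GEN_subset_full_group: "GEN M R \<subseteq> full_group M R"
proof
  fix T assume "T \<in> GEN M R"
  then obtain f N where T: "T \<in> carrier (Aut M)" and f: "f \<in> T" and N: "N \<in> null_sets M"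
    and eq: "\<And>x y. \<lbrakk>x \<in> space M - N; y \<in> space M - N\<rbrakk> \<Longrightarrow> (x, y) \<in> R \<longleftrightarrow> (x, y) \<in> orbit_rel (space M) f"
    by (auto simp: GEN_def rel_eq_mod_null_def)
  have mp: "f \<in> mp_bijections M" using T f by (auto simp: carrier_Aut)
  have "AE x in M. (x, f x) \<in> R"
    using AE_not_in[OF N] AE_comp_mp[OF mp AE_not_in[OF N]] AE_space
  proof eventually_elim
    case (elim x)
    then have "f x \<in> space M" using measurable_space[OF mp_bijections_simps(1)[OF mp]] by blast
    then have "(x, f x) \<in> orbit_rel (space M) f"
      using elim by (auto simp: orbit_rel_def intro!: exI[of _ 1])
    then show ?case using eq[of x "f x"] elim \<open>f x \<in> space M\<close> by blast
  qed
  then show "T \<in> full_group M R" using T f by (auto simp: full_group_def)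
qed

lemma topspace_full_topology:
  "standard_prob_space M \<Longrightarrow> topspace (full_topology M R) = full_group M R"
  unfolding full_topology_def by (rule Metric_space.topspace_mtopology[OF Metric_space_full_group])

lemma topspace_GEN_topology:
  "standard_prob_space M \<Longrightarrow> topspace (GEN_topology M R) = GEN M R"
  using GEN_subset_full_group[of M R] by (auto simp: GEN_topology_def topspace_full_topology)

end

theory Submission
  imports Defs "HOL-Algebra.Sym_Groups" "HOL-Combinatorics.Cycles"
begin

text \<open>The set in question is a countable intersection of open conditions: for each \<open>V\<close> in a countable dense
  subset of the full group and each \<open>n\<close>, some word in \<open>T\<close>, \<open>U\<close> is \<open>1/n\<close>-close to \<open>V\<close>; and for each
  nontrivial reduced word \<open>w\<close>, \<open>w(T, U)\<close> is not the identity. (As \<open>F\<^sub>2\<close> is Hopfian, an abstract isomorphism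
  with \<open>F\<^sub>2\<close> forces \<open>T\<close> and \<open>U\<close> to be free generators.) The full group is complete and its generators
  form a \<open>G\<^sub>\<delta>\<close>, so by Baire it suffices that each condition is dense.

  Density is a perturbation on a tall Rokhlin tower of \<open>T\<close>. On the tower, \<open>U\<close> and \<open>V\<close> are approximated by
  permutations of the levels inside blocks of a fixed length; replacing \<open>T\<close> by a conjugate close to it, one may
  assume that these permutations depend only on one of \<open>r\<close> classes of base points, with \<open>r\<close> independent of
  the height. On a bounded number of bottom levels, \<open>U\<close> is replaced by a cycle depending on the class. Powers of
  \<open>U\<close> isolate this cycle, its commutators with conjugates by powers of \<open>T\<close> are three-cycles on a single class, and
  their conjugates by powers of \<open>T\<close> generate all even permutations of the levels, class by class. For the word
  conditions one makes \<open>U\<close> follow a path spelled by \<open>w\<close> in the bottom levels.\<close>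

section \<open>Finite combinatorics and free groups\<close>

section \<open>Partial injections\<close>

text \<open>The obstacle is a circularity. The cycles that code the classes need a number
  \<open>W\<close> of levels that grows with the number of classes, and these levels must have small
  measure; so the number of classes has to be bounded before the height is chosen. Cutting columns
  into blocks of length \<open>L\<close> and recording only rounded letter counts gives such a
  bound, and the constants are chosen in the order \<open>L\<close>, \<open>J\<close>,
  \<open>r\<close>, \<open>m\<close>, \<open>W\<close>, \<open>B\<close>, with height
  \<open>B * L\<close>. The exponent \<open>m\<close> kills all permutations of a block, while the
  cycles have order dividing \<open>m + 1\<close>; coprimality of these two numbers lets one power
  of \<open>U\<close> forget everything except the cycle. Rearranging blocks by a map
  \<open>S\<close> commutes with \<open>T\<close> except at block ends, so the conjugate of
  \<open>T\<close> is close to \<open>T\<close>; as \<open>S\<close> lies in the full group, the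
  conjugate still generates the relation. This is how \<open>T\<close> gets perturbed for the
  generation condition, and why each density argument is carried out around an arbitrary generator.
  Commutators yield even permutations only, which is paid for by giving up two levels.\<close>

definition partial_inj :: "('a \<times> 'b) set \<Rightarrow> bool" where
  "partial_inj P \<longleftrightarrow> (\<forall>p\<in>P. \<forall>q\<in>P. fst p = fst q \<longleftrightarrow> snd p = snd q)"

text \<open>Inside a finite set the domain and the range of \<open>P\<close> have equally many
  points, hence so have their complements, and any bijection between the complements completes
  \<open>P\<close>.\<close>

lemma partial_inj_extend:
  assumes S: "finite S" and P: "P \<subseteq> S \<times> S" "partial_inj P"
  shows "\<exists>\<sigma>. \<sigma> permutes S \<and> (\<forall>p\<in>P. \<sigma> (fst p) = snd p)"
proof -
  let ?A = "fst ` P" and ?B = "snd ` P"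
  define g where "g a = (SOME b. (a, b) \<in> P)" for a
  have g: "g a = b" if "(a, b) \<in> P" for a b
    using someI[of "\<lambda>b. (a, b) \<in> P" b] that P(2) by (force simp: g_def partial_inj_def)
  have gb: "bij_betw g ?A ?B"
    unfolding bij_betw_def inj_on_def using g P(2) by (force simp: partial_inj_def image_iff)
  have sub: "?A \<subseteq> S" "?B \<subseteq> S" using P(1) by auto
  have "card (S - ?A) = card (S - ?B)"
    using bij_betw_same_card[OF gb] sub S by (simp add: card_Diff_subset finite_subset)
  then obtain h where h: "bij_betw h (S - ?A) (S - ?B)"
    using S finite_same_card_bij[of "S - ?A" "S - ?B"] by auto
  define \<sigma> where "\<sigma> x = (if x \<in> ?A then g x else if x \<in> S then h x else x)" for x
  have "bij_betw \<sigma> ?A ?B" using gb by (rule bij_betw_cong[THEN iffD1, rotated]) (simp add: \<sigma>_def)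
  moreover have "bij_betw \<sigma> (S - ?A) (S - ?B)"
    using h by (rule bij_betw_cong[THEN iffD1, rotated]) (simp add: \<sigma>_def)
  ultimately have "bij_betw \<sigma> (?A \<union> (S - ?A)) (?B \<union> (S - ?B))"
    by (rule bij_betw_combine) auto
  moreover have "?A \<union> (S - ?A) = S" "?B \<union> (S - ?B) = S" using sub by auto
  ultimately have "bij_betw \<sigma> S S" by simp
  then have "\<sigma> permutes S"
    by (rule bij_imp_permutes) (use sub in \<open>auto simp: \<sigma>_def\<close>)
  moreover have "\<sigma> (fst p) = snd p" if "p \<in> P" for p
    using that g[of "fst p" "snd p"] by (auto simp: \<sigma>_def)
  ultimately show ?thesis by blast
qed

section \<open>Evaluation of words\<close>

definition letter_val :: "('g, 'x) monoid_scheme \<Rightarrow> ('s \<Rightarrow> 'g) \<Rightarrow> bool \<times> 's \<Rightarrow> 'g" where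
  "letter_val H f a = (if fst a then f (snd a) else inv\<^bsub>H\<^esub> f (snd a))"

definition word_val :: "('g, 'x) monoid_scheme \<Rightarrow> ('s \<Rightarrow> 'g) \<Rightarrow> (bool \<times> 's) list \<Rightarrow> 'g" where
  "word_val H f w = foldr (\<lambda>a x. letter_val H f a \<otimes>\<^bsub>H\<^esub> x) w \<one>\<^bsub>H\<^esub>"

lemma word_val_simps [simp]:
  "word_val H f [] = \<one>\<^bsub>H\<^esub>"
  "word_val H f (a # w) = letter_val H f a \<otimes>\<^bsub>H\<^esub> word_val H f w"
  by (simp_all add: word_val_def)

lemma free_group_sel:
  "carrier (free_group UNIV) = {w. reduced w}" "\<one>\<^bsub>free_group S\<^esub> = []"
  "u \<otimes>\<^bsub>free_group S\<^esub> v = foldr cons_red u v"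
  by (simp_all add: free_group_def)

locale group_family = group G for G (structure) +
  fixes f :: "'s \<Rightarrow> 'a"
  assumes f: "f s \<in> carrier G"
begin

lemma letter_val_closed [simp]: "letter_val G f a \<in> carrier G"
  using f by (simp add: letter_val_def)

lemma letter_val_inv: "letter_val G f (inv_letter a) = inv letter_val G f a"
  using f by (simp add: letter_val_def inv_letter_def)

lemma word_val_closed [simp]: "word_val G f w \<in> carrier G"
  by (induction w) auto

lemma word_val_append: "word_val G f (u @ v) = word_val G f u \<otimes> word_val G f v"
  by (induction u) (auto simp: m_assoc)

lemma word_val_cons_red: "word_val G f (cons_red a w) = letter_val G f a \<otimes> word_val G f w"
proof (cases "w \<noteq> [] \<and> hd w = inv_letter a")
  case True
  then obtain t where "w = inv_letter a # t" by (cases w) auto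
  then show ?thesis by (simp add: cons_red_def letter_val_inv flip: m_assoc)
qed (auto simp: cons_red_def)

lemma word_val_foldr: "word_val G f (foldr cons_red u v) = word_val G f u \<otimes> word_val G f v"
  by (induction u) (simp_all add: word_val_cons_red m_assoc)

lemma word_val_reduce: "\<exists>v. reduced v \<and> word_val G f v = word_val G f w"
  by (rule exI[of _ "foldr cons_red w []"]) (simp add: reduced_foldr word_val_foldr)

lemma word_val_hom: "word_val G f \<in> hom (free_group UNIV) G"
  by (auto simp: hom_def free_group_sel word_val_foldr)

lemma generate_word_val: "generate G (range f) = range (word_val G f)"
proof (intro equalityI subsetI)
  fix x assume "x \<in> generate G (range f)"
  then show "x \<in> range (word_val G f)"
  proof (induction rule: generate.induct)
    case one
    show ?case by (rule range_eqI[of _ _ "[]"]) simp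
  next
    case (incl h)
    then obtain s where "h = f s" by blast
    then have "h = word_val G f [(True, s)]" using f by (simp add: letter_val_def)
    then show ?case by blast
  next
    case (inv h)
    then obtain s where "h = f s" by blast
    then have "inv h = word_val G f [(False, s)]" using f by (simp add: letter_val_def)
    then show ?case by blast
  next
    case (eng h1 h2)
    then obtain u v where "h1 = word_val G f u" "h2 = word_val G f v" by blast
    then have "h1 \<otimes> h2 = word_val G f (u @ v)" by (simp only: word_val_append)
    then show ?case by blast
  qed
next
  have "letter_val G f a \<in> generate G (range f)" for a
    by (auto simp: letter_val_def intro: generate.incl generate.inv)
  then have "word_val G f w \<in> generate G (range f)" for w
    by (induction w) (auto intro: generate.one generate.eng)
  then show "x \<in> generate G (range f)" if "x \<in> range (word_val G f)" for x
    using that by blast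
qed

text \<open>Words act from the right: the last letter is applied first, so the path is traversed
  from index \<open>length w\<close> down to 0. An inverse letter is handled by asking its generator
  to map forward along the path. The action laws are asked for on \<open>X\<close> only, which suits
  extensional maps on a space as well as permutations of all numbers.\<close>

lemma word_val_path:
  assumes act: "\<And>g h x. \<lbrakk>g \<in> carrier G; h \<in> carrier G; x \<in> X\<rbrakk> \<Longrightarrow> \<phi> (g \<otimes> h) x = \<phi> g (\<phi> h x)"
    "\<And>x. x \<in> X \<Longrightarrow> \<phi> \<one> x = x"
    and v: "\<And>i. i \<le> length w \<Longrightarrow> v i \<in> X"
    and step: "\<And>i s. i < length w \<Longrightarrow> w ! i = (True, s) \<Longrightarrow> \<phi> (f s) (v (Suc i)) = v i"
    "\<And>i s. i < length w \<Longrightarrow> w ! i = (False, s) \<Longrightarrow> \<phi> (f s) (v i) = v (Suc i)"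
  shows "\<phi> (word_val G f w) (v (length w)) = v 0"
  using v step
proof (induction w arbitrary: v)
  case Nil
  then show ?case using act(2) by simp
next
  case (Cons a w)
  have IH: "\<phi> (word_val G f w) (v (length (a # w))) = v 1"
    using Cons.IH[of "\<lambda>i. v (Suc i)"] Cons.prems by fastforce
  have v0: "v 0 \<in> X" "v 1 \<in> X" "v (length (a # w)) \<in> X" using Cons.prems(1) by auto
  have "\<phi> (letter_val G f a) (v 1) = v 0"
  proof (cases "fst a")
    case True
    then show ?thesis using Cons.prems(2)[of 0 "snd a"] by (cases a) (auto simp: letter_val_def)
  next
    case False
    then have "\<phi> (f (snd a)) (v 0) = v 1" using Cons.prems(3)[of 0 "snd a"] by (cases a) auto
    then have "\<phi> (inv f (snd a)) (v 1) = \<phi> (inv f (snd a) \<otimes> f (snd a)) (v 0)"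
      using act(1)[of "inv f (snd a)" "f (snd a)" "v 0"] v0 f by simp
    then show ?thesis using False f act(2) v0 by (simp add: letter_val_def)
  qed
  then show ?case using IH act(1)[of "letter_val G f a" "word_val G f w"] v0 by simp
qed

end

lemma (in group) group_family: "(\<And>s. f s \<in> carrier G) \<Longrightarrow> group_family G f"
  by (simp add: group_family_def group_family_axioms_def is_group)

text \<open>Homomorphisms from a free group can thus be coded by functions on the alphabet, and so
  be counted when the target is finite.\<close>

lemma (in group) hom_eq_word_val:
  assumes h: "h \<in> hom (free_group UNIV) G" and w: "reduced w"
  shows "h w = word_val G (\<lambda>s. h [(True, s)]) w"
proof -
  interpret h: group_hom "free_group UNIV" G h
    using h group_free_group is_group by (simp add: group_hom_def group_hom_axioms_def)
  have l: "h [a] = letter_val G (\<lambda>s. h [(True, s)]) a" for a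
  proof (cases a)
    case (Pair b s)
    have "[(True, s)] \<otimes>\<^bsub>free_group UNIV\<^esub> [(False, s)] = \<one>\<^bsub>free_group UNIV\<^esub>"
      by (simp add: free_group_sel cons_red_def inv_letter_def)
    then have "inv\<^bsub>free_group UNIV\<^esub> [(True, s)] = [(False, s)]"
      by (intro h.G.inv_equality) (auto simp: free_group_sel cons_red_def inv_letter_def)
    then have "h [(False, s)] = inv h [(True, s)]"
      using h.hom_inv[of "[(True, s)]"] by (simp add: free_group_sel)
    then show ?thesis using Pair by (simp add: letter_val_def)
  qed
  show ?thesis using w
  proof (induction w)
    case Nil
    then show ?case using h.hom_one by (simp add: free_group_sel)
  next
    case (Cons a w)
    have red: "reduced w" "cons_red a w = a # w"
      using Cons.prems cons_red_reduced[OF Cons.prems] by (auto simp: reduced_Cons)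
    have "h ([a] \<otimes>\<^bsub>free_group UNIV\<^esub> w) = h [a] \<otimes> h w"
      by (rule h.hom_mult) (use red(1) in \<open>simp_all add: free_group_sel\<close>)
    then show ?case
      using Cons.IH[OF red(1)] l[of a] red(2) by (simp add: free_group_sel)
  qed
qed

section \<open>The free group of rank two is Hopfian\<close>

text \<open>The pairs that a permutation standing for the generator \<open>s\<close> has to contain
  so that \<open>w\<close> carries \<open>v (length w)\<close> to \<open>v 0\<close> along the path
  \<open>v\<close>.\<close>

definition path_edges :: "(bool \<times> 's) list \<Rightarrow> (nat \<Rightarrow> 'v) \<Rightarrow> 's \<Rightarrow> ('v \<times> 'v) set" where
  "path_edges w v s = {(v (Suc i), v i) | i. i < length w \<and> w ! i = (True, s)} \<union>
     {(v i, v (Suc i)) | i. i < length w \<and> w ! i = (False, s)}"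

text \<open>Two distinct edges with the same label share a vertex only if they belong to
  neighbouring letters; reducedness gives these letters the same sign, so the common vertex is the
  source of one edge and the target of the other.\<close>

lemma partial_inj_path_edges:
  assumes w: "reduced w" and v: "inj_on v {..length w}"
  shows "partial_inj (path_edges w v s)"
proof -
  have red: "w ! Suc i \<noteq> inv_letter (w ! i)" if "Suc i < length w" for i
    using w that by (simp add: reduced_def successively_conv_nth)
  have veq: "v i = v j \<longleftrightarrow> i = j" if "i \<le> length w" "j \<le> length w" for i j
    using v that by (auto simp: inj_on_def)
  have edge: "\<exists>i b. i < length w \<and> w ! i = (b, s) \<and> fst p = v (if b then Suc i else i)
      \<and> snd p = v (if b then i else Suc i)" if "p \<in> path_edges w v s" for p
    using that by (fastforce simp: path_edges_def)
  show ?thesis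
    unfolding partial_inj_def
  proof (intro ballI)
    fix p q assume "p \<in> path_edges w v s" "q \<in> path_edges w v s"
    then obtain i b j c where i: "i < length w" "w ! i = (b, s)" "fst p = v (if b then Suc i else i)"
        "snd p = v (if b then i else Suc i)"
      and j: "j < length w" "w ! j = (c, s)" "fst q = v (if c then Suc j else j)"
        "snd q = v (if c then j else Suc j)"
      using edge by meson
    have "b = c" if "j = Suc i \<or> i = Suc j"
      using that red[of i] red[of j] i j by (auto simp: inv_letter_def)
    then show "fst p = fst q \<longleftrightarrow> snd p = snd q"
      using i j by (cases b; cases c) (auto simp: veq)
  qed
qed

lemma path_edges_subset: "path_edges w v s \<subseteq> v ` {..length w} \<times> v ` {..length w}"
  by (auto simp: path_edges_def)

text \<open>The word is laid out as a path through \<open>length w + 1\<close> distinct points, each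
  generator acts by a permutation extending its edges, and the word then moves the end of the path
  to its start.\<close>

lemma free_group_residually_finite:
  fixes w :: "(bool \<times> 's) list"
  assumes w: "reduced w" "w \<noteq> []"
  shows "\<exists>n f. (\<forall>s. f s \<in> carrier (sym_group n)) \<and> word_val (sym_group n) f w \<noteq> \<one>\<^bsub>sym_group n\<^esub>"
proof -
  define n where "n = Suc (length w)"
  \<comment> \<open>The vertices are named by \<open>Suc\<close> because \<open>sym_group n\<close>
    permutes \<open>{1..n}\<close>.\<close>
  have "\<exists>\<sigma>. \<sigma> permutes {1..n} \<and> (\<forall>p\<in>path_edges w Suc s. \<sigma> (fst p) = snd p)" for s
  proof (rule partial_inj_extend)
    show "path_edges w Suc s \<subseteq> {1..n} \<times> {1..n}"
      using path_edges_subset[of w Suc s] by (force simp: n_def)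
    show "partial_inj (path_edges w Suc s)"
      by (rule partial_inj_path_edges[OF w(1)]) auto
  qed simp
  then obtain f where f: "\<And>s. f s permutes {1..n}" "\<And>s p. p \<in> path_edges w Suc s \<Longrightarrow> f s (fst p) = snd p"
    by metis
  interpret S: group_family "sym_group n" f
    by (rule group.group_family[OF sym_group_is_group]) (simp only: sym_group_carrier f(1))
  have "(\<lambda>g. g) (word_val (sym_group n) f w) (Suc (length w)) = Suc 0"
  proof (rule S.word_val_path[where X = UNIV])
    show "f s (Suc (Suc i)) = Suc i" if "i < length w" "w ! i = (True, s)" for i s
      using f(2)[of "(Suc (Suc i), Suc i)" s] that by (auto simp: path_edges_def)
    show "f s (Suc i) = Suc (Suc i)" if "i < length w" "w ! i = (False, s)" for i s
      using f(2)[of "(Suc i, Suc (Suc i))" s] that by (auto simp: path_edges_def)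
  qed (use f(1) in \<open>simp_all add: sym_group_def\<close>)
  then have "word_val (sym_group n) f w \<noteq> id" using w(2) by auto
  then show ?thesis using f(1) by (metis sym_group_carrier sym_group_one)
qed

lemma finite_carrier_sym_group: "finite (carrier (sym_group n))"
  by (simp add: sym_group_def finite_permutations)

text \<open>A finite group receives only finitely many homomorphisms from a free group of finite rank, and
  precomposition with a surjective endomorphism permutes them.\<close>

lemma free_group_Hopfian:
  fixes \<theta> :: "(bool \<times> 's::finite) list \<Rightarrow> (bool \<times> 's) list"
  assumes \<theta>: "\<theta> \<in> hom (free_group UNIV) (free_group UNIV)"
    and surj: "\<theta> ` {w. reduced w} = {w. reduced w}" and k: "reduced k" "\<theta> k = []"
  shows "k = []"
proof (rule ccontr)
  assume "k \<noteq> []"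
  then obtain n and f :: "'s \<Rightarrow> nat \<Rightarrow> nat"
    where f: "\<And>s. f s \<in> carrier (sym_group n)" and neq: "word_val (sym_group n) f k \<noteq> \<one>\<^bsub>sym_group n\<^esub>"
    using free_group_residually_finite[OF k(1)] by blast
  interpret S: group "sym_group n" by (rule sym_group_is_group)
  let ?F = "PiE (UNIV::'s set) (\<lambda>_. carrier (sym_group n))"
  let ?e = "word_val (sym_group n)"
  \<comment> \<open>Homomorphisms to the finite group are coded by their values on the generators;
    \<open>\<Phi>\<close> is the pullback along \<open>\<theta>\<close> in this coding.\<close>
  define \<Phi> where "\<Phi> g = (\<lambda>s. ?e g (\<theta> [(True, s)]))" for g
  have red: "reduced (\<theta> w)" if "reduced w" for w
    using that surj by blast
  have F: "g s \<in> carrier (sym_group n)" if "g \<in> ?F" for g s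
    using that by (auto simp: PiE_iff)
  have comp: "?e (\<Phi> g) w = ?e g (\<theta> w)" if g: "g \<in> ?F" and w: "reduced w" for g w
  proof -
    have "?e g \<circ> \<theta> \<in> hom (free_group UNIV) (sym_group n)"
      using hom_compose[OF \<theta> group_family.word_val_hom[OF S.group_family[OF F[OF g]]]] .
    from S.hom_eq_word_val[OF this w] show ?thesis by (simp add: \<Phi>_def)
  qed
  have "\<Phi> ` ?F \<subseteq> ?F"
    using group_family.word_val_closed[OF S.group_family[OF F]] by (auto simp: \<Phi>_def PiE_iff)
  moreover have "inj_on \<Phi> ?F"
  proof (rule inj_onI)
    fix g h assume g: "g \<in> ?F" "h \<in> ?F" and eq: "\<Phi> g = \<Phi> h"
    have "?e g v = ?e h v" if v: "reduced v" for v
    proof -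
      obtain w where "reduced w" "v = \<theta> w" using v surj by blast
      then show ?thesis using comp[of g w] comp[of h w] g eq by simp
    qed
    from this[of "[(True, _)]"] show "g = h"
      using F g by (intro ext) (simp add: letter_val_def)
  qed
  moreover have "finite ?F" by (intro finite_PiE) (auto simp: finite_carrier_sym_group)
  ultimately have "\<Phi> ` ?F = ?F" by (simp add: endo_inj_surj)
  moreover have "f \<in> ?F" using f by (auto simp: PiE_iff)
  ultimately obtain g where "g \<in> ?F" "f = \<Phi> g" by blast
  \<comment> \<open>The homomorphism coded by \<open>f\<close> is a pullback along
    \<open>\<theta>\<close>, so it sends \<open>k\<close> to the value at
    \<open>\<theta> k = []\<close>, which is the identity.\<close>
  then have "?e f k = ?e g []" using comp k by simp
  then show False using neq by simp
qed

text \<open>Evaluation of words followed by any isomorphism \<open>\<theta>\<close> onto the free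
  group is a surjective endomorphism of the free group. The Hopf property makes it injective, and
  then evaluation itself is injective.\<close>

lemma generate_iso_free_group_iff:
  fixes G (structure) and f :: "'s::finite \<Rightarrow> 'a"
  assumes "group_family G f"
  shows "G\<lparr>carrier := generate G (range f)\<rparr> \<cong> free_group (UNIV :: 's set) \<longleftrightarrow>
    (\<forall>w. reduced w \<and> w \<noteq> [] \<longrightarrow> word_val G f w \<noteq> \<one>)"
proof -
  interpret group_family G f by fact
  let ?K = "G\<lparr>carrier := generate G (range f)\<rparr>"
  let ?F = "free_group (UNIV :: 's set)"
  have F: "group ?F" by (rule group_free_group)
  have sub: "subgroup (generate G (range f)) G"
    by (rule generate_is_subgroup) (use f in blast)
  have K: "group ?K" by (rule subgroup.subgroup_is_group[OF sub is_group])
  have hom: "word_val G f \<in> hom ?F ?K"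
    unfolding hom_def free_group_sel generate_word_val
    by (auto simp: word_val_foldr)
  have onto: "word_val G f ` {w. reduced w} = generate G (range f)"
  proof -
    have "word_val G f w \<in> word_val G f ` {w. reduced w}" for w
      using word_val_reduce[of w] by (metis (mono_tags) image_eqI mem_Collect_eq)
    then show ?thesis unfolding generate_word_val by blast
  qed
  have h: "group_hom ?F ?K (word_val G f)"
    using hom F K by (simp add: group_hom_def group_hom_axioms_def)
  show ?thesis
  proof
    assume "?K \<cong> ?F"
    then obtain \<theta> where \<theta>: "\<theta> \<in> iso ?K ?F" by (auto simp: is_iso_def)
    have "\<theta> \<circ> word_val G f \<in> hom ?F ?F"
      by (rule Group.hom_compose[OF hom]) (use \<theta> in \<open>simp add: iso_def\<close>)
    moreover have "(\<theta> \<circ> word_val G f) ` {w. reduced w} = {w. reduced w}"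
      using \<theta> by (simp only: image_comp[symmetric] onto) (simp add: iso_def bij_betw_def free_group_sel)
    moreover have "\<theta> \<one> = []"
    proof -
      have "\<theta> \<in> hom ?K ?F" using \<theta> by (simp add: iso_def)
      then have "\<theta> \<one>\<^bsub>?K\<^esub> = \<one>\<^bsub>?F\<^esub>"
        by (intro group_hom.hom_one) (simp add: group_hom_def group_hom_axioms_def F K)
      then show ?thesis by (simp add: free_group_sel)
    qed
    ultimately have "w = []" if "reduced w" "word_val G f w = \<one>" for w
      using free_group_Hopfian[of "\<theta> \<circ> word_val G f" w] that by simp
    then show "\<forall>w. reduced w \<and> w \<noteq> [] \<longrightarrow> word_val G f w \<noteq> \<one>" by blast
  next
    assume inj: "\<forall>w. reduced w \<and> w \<noteq> [] \<longrightarrow> word_val G f w \<noteq> \<one>"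
    have "inj_on (word_val G f) (carrier ?F)"
      using inj by (intro group_hom.inj_on_one_iff[OF h, THEN iffD2]) (auto simp: free_group_sel)
    then have "word_val G f \<in> iso ?F ?K"
      using hom onto by (simp add: iso_def bij_betw_def free_group_sel)
    then show "?K \<cong> ?F" using group.iso_sym[OF F] is_isoI by blast
  qed
qed

section \<open>Measure theory: genuine bijections, their classes, separability\<close>

section \<open>Measure-preserving bijections\<close>

lemma mp_space: "f \<in> mp_bijections M \<Longrightarrow> x \<in> space M \<Longrightarrow> f x \<in> space M"
  using mp_bijections_simps(1) by (rule measurable_space)

lemma mp_inj: "f \<in> mp_bijections M \<Longrightarrow> x \<in> space M \<Longrightarrow> y \<in> space M \<Longrightarrow> f x = f y \<longleftrightarrow> x = y"
  using mp_bijections_simps(3)[of f M] by (auto simp: bij_betw_def inj_on_def)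

lemma mp_vimage_sets: "f \<in> mp_bijections M \<Longrightarrow> A \<in> sets M \<Longrightarrow> {x \<in> space M. f x \<in> A} \<in> sets M"
  using measurable_sets[OF mp_bijections_simps(1), of f M A] by (simp add: vimage_def Int_def conj_commute)

lemma mp_image_sets:
  assumes f: "f \<in> mp_bijections M" and A: "A \<in> sets M"
  shows "f ` A \<in> sets M"
proof -
  let ?g = "restrict (inv_into (space M) f) (space M)"
  have b: "bij_betw f (space M) (space M)" using f by simp
  have gm: "?g \<in> measurable M M" using f unfolding mp_bijections_def by blast
  have "f ` A = ?g -` A \<inter> space M"
  proof (intro equalityI subsetI)
    fix y assume y: "y \<in> ?g -` A \<inter> space M"
    then have "f (?g y) = y" using bij_betw_inv_into_right[OF b, of y] by simp
    moreover have "?g y \<in> A" using y by blast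
    ultimately show "y \<in> f ` A" by (metis imageI)
  next
    fix y assume "y \<in> f ` A"
    then obtain x where x: "x \<in> A" "y = f x" by blast
    then have X: "x \<in> space M" using A sets.sets_into_space by blast
    then have "?g y = x" using bij_betw_inv_into_left[OF b, of x] mp_space[OF f X] x(2) by simp
    then show "y \<in> ?g -` A \<inter> space M" using x mp_space[OF f X] by simp
  qed
  then show ?thesis using measurable_sets[OF gm A] by (simp only:)
qed

lemma mp_emeasure_vimage:
  assumes f: "f \<in> mp_bijections M" and A: "A \<in> sets M"
  shows "emeasure M {x \<in> space M. f x \<in> A} = emeasure M A"
proof -
  have "emeasure M A = emeasure (distr M M f) A" using f by simp
  also have "\<dots> = emeasure M (f -` A \<inter> space M)" using f A by (intro emeasure_distr) auto
  also have "f -` A \<inter> space M = {x \<in> space M. f x \<in> A}" by auto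
  finally show ?thesis by simp
qed

lemma mp_emeasure_image:
  assumes f: "f \<in> mp_bijections M" and A: "A \<in> sets M"
  shows "emeasure M (f ` A) = emeasure M A"
proof -
  have "{x \<in> space M. f x \<in> f ` A} = A"
    using sets.sets_into_space[OF A] f by (auto simp: mp_inj subset_iff)
  then show ?thesis using mp_emeasure_vimage[OF f mp_image_sets[OF f A]] by simp
qed

lemma mp_measure:
  assumes f: "f \<in> mp_bijections M" and A: "A \<in> sets M"
  shows "measure M (f ` A) = measure M A" "measure M {x \<in> space M. f x \<in> A} = measure M A"
  using mp_emeasure_image[OF assms] mp_emeasure_vimage[OF assms] by (simp_all add: measure_def)

lemma mp_bijectionsI:
  assumes b: "bij_betw f (space M) (space M)" and e: "f \<in> extensional (space M)"
    and m: "f \<in> measurable M M" and i: "\<And>A. A \<in> sets M \<Longrightarrow> f ` A \<in> sets M"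
    and em: "\<And>A. A \<in> sets M \<Longrightarrow> emeasure M (f ` A) = emeasure M A"
  shows "f \<in> mp_bijections M"
proof -
  have im: "f ` (f -` A \<inter> space M) = A" if "A \<in> sets M" for A
    using b sets.sets_into_space[OF that] by (force simp: bij_betw_def)
  have "restrict (inv_into (space M) f) (space M) \<in> measurable M M"
  proof (rule measurableI)
    fix A assume A: "A \<in> sets M"
    have "restrict (inv_into (space M) f) (space M) -` A \<inter> space M = f ` A"
      (is "?L = _")
    proof (intro equalityI subsetI)
      fix y assume y: "y \<in> ?L"
      then have "f (inv_into (space M) f y) = y" using bij_betw_inv_into_right[OF b, of y] by simp
      moreover have "inv_into (space M) f y \<in> A" using y by auto
      ultimately show "y \<in> f ` A" by (metis imageI)
    next
      fix y assume "y \<in> f ` A"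
      then obtain x where x: "x \<in> A" "y = f x" by blast
      then have "x \<in> space M" using A sets.sets_into_space by blast
      then have "inv_into (space M) f y = x" "y \<in> space M"
        using bij_betw_inv_into_left[OF b, of x] bij_betw_apply[OF b] x(2) by auto
      then show "y \<in> ?L" using x by simp
    qed
    then show "?L \<in> sets M" using i[OF A] by simp
  qed (use b in \<open>auto simp: bij_betw_def intro: inv_into_into\<close>)
  moreover have "distr M M f = M"
  proof (rule measure_eqI)
    fix A assume "A \<in> sets (distr M M f)"
    then have A: "A \<in> sets M" by simp
    have s: "f -` A \<inter> space M \<in> sets M" using m A by (rule measurable_sets)
    have "emeasure (distr M M f) A = emeasure M (f -` A \<inter> space M)" using m A by (rule emeasure_distr)
    also have "\<dots> = emeasure M A" using em[OF s] im[OF A] by simp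
    finally show "emeasure (distr M M f) A = emeasure M A" .
  qed simp
  ultimately show ?thesis using b e m unfolding mp_bijections_def Bij_def by blast
qed

lemma id_mp: "(\<lambda>x\<in>space M. x) \<in> mp_bijections M"
  using monoid.one_closed[OF group.is_monoid[OF group_mp_group[of M]]] by (simp add: one_mp_group)

lemma mp_mult: "f \<in> mp_bijections M \<Longrightarrow> g \<in> mp_bijections M \<Longrightarrow> x \<in> space M \<Longrightarrow>
    (f \<otimes>\<^bsub>mp_group M\<^esub> g) x = f (g x)"
  by (simp add: mult_mp_group compose_def)

lemma mp_closed:
  "f \<in> mp_bijections M \<Longrightarrow> g \<in> mp_bijections M \<Longrightarrow> f \<otimes>\<^bsub>mp_group M\<^esub> g \<in> mp_bijections M"
  "f \<in> mp_bijections M \<Longrightarrow> inv\<^bsub>mp_group M\<^esub> f \<in> mp_bijections M"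
  "\<one>\<^bsub>mp_group M\<^esub> \<in> mp_bijections M"
proof -
  interpret group "mp_group M" by (rule group_mp_group)
  show "f \<in> mp_bijections M \<Longrightarrow> g \<in> mp_bijections M \<Longrightarrow> f \<otimes>\<^bsub>mp_group M\<^esub> g \<in> mp_bijections M"
    "f \<in> mp_bijections M \<Longrightarrow> inv\<^bsub>mp_group M\<^esub> f \<in> mp_bijections M"
    "\<one>\<^bsub>mp_group M\<^esub> \<in> mp_bijections M"
    using m_closed[of f g] inv_closed[of f] one_closed by simp_all
qed

lemma mp_eqI:
  "\<lbrakk>f \<in> mp_bijections M; g \<in> mp_bijections M; \<And>x. x \<in> space M \<Longrightarrow> f x = g x\<rbrakk> \<Longrightarrow> f = g"
  by (rule extensionalityI[of f "space M"]) auto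

text \<open>The cover is made disjoint; on each piece \<open>h\<close> is a measure-preserving map,
  and injectivity of \<open>h\<close> on \<open>B\<close> keeps the images disjoint, so that their
  measures add up.\<close>

lemma piecewise_image:
  fixes \<gamma> :: "nat \<Rightarrow> 'a \<Rightarrow> 'a"
  assumes \<gamma>: "\<And>i. \<gamma> i \<in> mp_bijections M" and A: "\<And>i. A i \<in> sets M"
    and h: "\<And>i. \<forall>x\<in>A i. h x = \<gamma> i x"
    and B: "B \<in> sets M" "B \<subseteq> (\<Union>i. A i)" and inj: "inj_on h B"
  shows "h ` B \<in> sets M" "emeasure M (h ` B) = emeasure M B"
proof -
  define D where "D i = disjointed A i \<inter> B" for i
  have DA: "D i \<subseteq> A i" for i by (auto simp: D_def disjointed_def)
  have Ds: "D i \<in> sets M" for i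
    unfolding D_def using A B(1) sets.range_disjointed_sets[of A M] by blast
  have UD: "(\<Union>i. D i) = B" using B(2) UN_disjointed_eq[of A] by (auto simp: D_def)
  have dis: "disjoint_family D"
    using disjoint_family_disjointed[of A] by (auto simp: disjoint_family_on_def D_def)
  have im: "h ` D i = \<gamma> i ` D i" for i
    by (rule image_cong) (use h DA in blast)+
  have hB: "h ` B = (\<Union>i. \<gamma> i ` D i)" unfolding UD[symmetric] by (simp only: image_UN im)
  have gs: "\<gamma> i ` D i \<in> sets M" for i by (rule mp_image_sets[OF \<gamma> Ds])
  then show "h ` B \<in> sets M" unfolding hB by blast
  have "disjoint_family (\<lambda>i. \<gamma> i ` D i)"
    unfolding disjoint_family_on_def im[symmetric]
  proof (intro ballI impI)
    fix i j :: nat assume "i \<noteq> j"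
    then have "D i \<inter> D j = {}" using dis by (auto simp: disjoint_family_on_def)
    then show "h ` D i \<inter> h ` D j = {}"
      using inj_on_image_Int[OF inj, of "D i" "D j"] UD by auto
  qed
  then have "emeasure M (h ` B) = (\<Sum>i. emeasure M (\<gamma> i ` D i))"
    unfolding hB using gs by (intro suminf_emeasure[symmetric]) auto
  also have "\<dots> = (\<Sum>i. emeasure M (D i))" using mp_emeasure_image[OF \<gamma> Ds] by simp
  also have "\<dots> = emeasure M B" using Ds dis UD by (subst suminf_emeasure) auto
  finally show "emeasure M (h ` B) = emeasure M B" .
qed

lemma piecewise_vimage:
  fixes \<gamma> :: "nat \<Rightarrow> 'a \<Rightarrow> 'a"
  assumes \<gamma>: "\<And>i. \<gamma> i \<in> mp_bijections M" and A: "\<And>i. A i \<in> sets M"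
    and h: "\<And>i. \<forall>x\<in>A i. h x = \<gamma> i x"
    and B: "B \<in> sets M" and X: "X \<in> sets M" "X \<subseteq> (\<Union>i. A i)"
  shows "{x \<in> X. h x \<in> B} \<in> sets M"
proof -
  have "X \<subseteq> space M" using X(1) by (rule sets.sets_into_space)
  then have "{x \<in> X. h x \<in> B} = (\<Union>i. X \<inter> A i \<inter> {x \<in> space M. \<gamma> i x \<in> B})"
    using X(2) h by fastforce
  also have "\<dots> \<in> sets M" using \<gamma> A X B by (intro sets.countable_UN) (auto intro: mp_vimage_sets)
  finally show ?thesis .
qed

lemma mp_piecewise:
  fixes \<gamma> :: "nat \<Rightarrow> 'a \<Rightarrow> 'a"
  assumes \<gamma>: "\<And>i. \<gamma> i \<in> mp_bijections M" and A: "\<And>i. A i \<in> sets M"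
    and h: "\<And>i. \<forall>x\<in>A i. h x = \<gamma> i x" and cov: "space M \<subseteq> (\<Union>i. A i)"
    and b: "bij_betw h (space M) (space M)" and e: "h \<in> extensional (space M)"
  shows "h \<in> mp_bijections M"
proof (rule mp_bijectionsI[OF b e])
  show "h \<in> measurable M M"
  proof (rule measurableI)
    fix B assume "B \<in> sets M"
    from piecewise_vimage[OF \<gamma> A h this sets.top cov]
    show "h -` B \<inter> space M \<in> sets M" by (simp add: vimage_def Int_def conj_commute)
  qed (use b in \<open>auto simp: bij_betw_def\<close>)
  fix B assume B: "B \<in> sets M"
  then have "B \<subseteq> space M" by (rule sets.sets_into_space)
  then have "B \<subseteq> (\<Union>i. A i)" "inj_on h B" using cov b by (auto simp: bij_betw_def intro: inj_on_subset)
  from piecewise_image[OF \<gamma> A h B this] show "h ` B \<in> sets M" "emeasure M (h ` B) = emeasure M B"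
    by auto
qed

lemma mp_piecewise_int:
  fixes \<gamma> :: "int \<Rightarrow> 'a \<Rightarrow> 'a"
  assumes "\<And>i. \<gamma> i \<in> mp_bijections M" "\<And>i. A i \<in> sets M"
    "\<And>i. \<forall>x\<in>A i. h x = \<gamma> i x" "space M \<subseteq> (\<Union>i. A i)"
    "bij_betw h (space M) (space M)" "h \<in> extensional (space M)"
  shows "h \<in> mp_bijections M"
proof (rule mp_piecewise[of "\<gamma> \<circ> int_decode" M "A \<circ> int_decode" h])
  have "(\<Union>i. (A \<circ> int_decode) i) = (\<Union>i. A i)"
    by (simp only: image_comp[symmetric] surj_int_decode)
  then show "space M \<subseteq> (\<Union>i. (A \<circ> int_decode) i)" using assms(4) by simp
qed (use assms in auto)

text \<open>Restricting \<open>h\<close> to the largest set that it maps onto itself makes it a genuine bijection.\<close>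

lemma (in prob_space) mp_piecewise_AE:
  fixes \<gamma> :: "nat \<Rightarrow> 'a \<Rightarrow> 'a"
  assumes \<gamma>: "\<And>i. \<gamma> i \<in> mp_bijections M" and A: "\<And>i. A i \<in> sets M"
    and h: "\<And>i. \<forall>x\<in>A i. h x = \<gamma> i x"
    and X: "X \<in> sets M" "AE x in M. x \<in> X" "X \<subseteq> (\<Union>i. A i)" and inj: "inj_on h X"
  shows "\<exists>g\<in>mp_bijections M. AE x in M. g x = h x"
proof -
  have Xs: "X \<subseteq> space M" using X(1) by (rule sets.sets_into_space)
  have hs: "h x \<in> space M" if "x \<in> X" for x
  proof -
    obtain i where "x \<in> A i" using \<open>x \<in> X\<close> X(3) by blast
    then show ?thesis using h \<open>x \<in> X\<close> Xs mp_space[OF \<gamma>, of x i] by auto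
  qed
  note im = piecewise_image[where \<gamma> = \<gamma> and A = A and h = h, OF \<gamma> A h]
  \<comment> \<open>\<open>Z (Suc n)\<close> keeps the points of \<open>Z n\<close> whose image lies
    in \<open>Z n\<close> and which are themselves images of points of \<open>Z n\<close>; each
    stage loses only a null set.\<close>
  define Z where "Z = rec_nat X (\<lambda>n Z. Z \<inter> h ` Z \<inter> {x \<in> X. h x \<in> Z})"
  have Z0: "Z 0 = X" and ZS: "Z (Suc n) = Z n \<inter> h ` Z n \<inter> {x \<in> X. h x \<in> Z n}" for n
    by (simp_all add: Z_def)
  have Z: "Z n \<in> sets M \<and> Z n \<subseteq> X \<and> (AE x in M. x \<in> Z n)" for n
  proof (induction n)
    case (Suc n)
    then have B: "Z n \<in> sets M" "Z n \<subseteq> (\<Union>i. A i)" "inj_on h (Z n)" "AE x in M. x \<in> Z n"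
      using X inj by (auto intro: inj_on_subset)
    have 1: "h ` Z n \<in> sets M" "emeasure M (h ` Z n) = emeasure M (Z n)"
      using im[OF B(1-3)] .
    have "prob (h ` Z n) = 1"
      using 1(2) B prob_eq_1[of "Z n"] by (simp add: measure_def)
    then have 2: "AE x in M. x \<in> h ` Z n" using prob_eq_1 1(1) by blast
    have 3: "{x \<in> X. h x \<in> Z n} \<in> sets M"
      by (rule piecewise_vimage[OF \<gamma> A h B(1) X(1,3)])
    \<comment> \<open>The points that \<open>h\<close> throws out of \<open>Z n\<close> form a null
      set, because \<open>h\<close> carries them injectively, and with preserved measure, into the
      complement of \<open>Z n\<close>.\<close>
    let ?E = "{x \<in> X. h x \<in> space M - Z n}"
    have E: "?E \<in> sets M"
      by (rule piecewise_vimage[OF \<gamma> A h _ X(1,3)]) (use B(1) in auto)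
    have EX: "?E \<subseteq> (\<Union>i. A i)" "inj_on h ?E" using X(3) inj by (auto intro: inj_on_subset)
    have "prob (h ` ?E) \<le> prob (space M - Z n)"
      using B(1) by (intro finite_measure_mono) auto
    also have "\<dots> = 0" using B prob_eq_1[of "Z n"] prob_compl[of "Z n"] by simp
    finally have "prob ?E = 0" using im(2)[OF E EX] measure_nonneg[of M "h ` ?E"] measure_nonneg[of M ?E]
      by (simp only: measure_def)
    then have "AE x in M. x \<notin> ?E" using E prob_eq_0 by blast
    then have 4: "AE x in M. x \<in> {x \<in> X. h x \<in> Z n}"
      using X(2) by eventually_elim (use hs in auto)
    show ?case
      unfolding ZS using Suc 1 2 3 4 by (auto elim: eventually_elim2)
  qed (use X Z0 in auto)
  define G where "G = (\<Inter>n. Z n)"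
  have Gs: "G \<in> sets M" unfolding G_def using Z by (intro sets.countable_INT) auto
  have GX: "G \<subseteq> X" using Z0 by (auto simp: G_def)
  have GA: "AE x in M. x \<in> G" using Z by (simp add: G_def AE_all_countable)
  have hG: "h ` G = G"
  proof (intro equalityI subsetI)
    fix y assume "y \<in> h ` G"
    then obtain x where x: "x \<in> G" "y = h x" by blast
    have "h x \<in> Z n" for n
    proof -
      have "x \<in> Z (Suc n)" using x(1) by (simp add: G_def)
      then show ?thesis by (simp add: ZS)
    qed
    then show "y \<in> G" using x by (simp add: G_def)
  next
    fix y assume y: "y \<in> G"
    have "y \<in> h ` Z n" for n
    proof -
      have "y \<in> Z (Suc n)" using y by (simp add: G_def)
      then show ?thesis by (simp add: ZS)
    qed
    then have "\<exists>x. x \<in> Z n \<and> y = h x" for n by blast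
    then obtain x where x: "\<And>n. x n \<in> Z n" "\<And>n. y = h (x n)" by metis
    \<comment> \<open>The preimages of \<open>y\<close> found in the various \<open>Z n\<close>
      coincide by injectivity, so the common one lies in all of them.\<close>
    have "x n = x 0" for n
      by (rule inj_onD[OF inj]) (use x Z in \<open>auto simp flip: x(2)\<close>)
    then have "x 0 \<in> G" using x(1) unfolding G_def by (metis INT_I)
    then show "y \<in> h ` G" using x(2) by blast
  qed
  define g where "g = (\<lambda>x\<in>space M. if x \<in> G then h x else x)"
  have Gsp: "G \<subseteq> space M" using Gs by (rule sets.sets_into_space)
  have "bij_betw g G G"
    using hG inj GX Gsp by (auto simp: bij_betw_def g_def inj_on_def subset_iff)
  moreover have "bij_betw g (space M - G) (space M - G)"
    by (auto simp: bij_betw_def g_def inj_on_def)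
  ultimately have "bij_betw g (G \<union> (space M - G)) (G \<union> (space M - G))"
    by (rule bij_betw_combine) auto
  moreover have "G \<union> (space M - G) = space M" using Gsp by auto
  ultimately have b: "bij_betw g (space M) (space M)" by simp
  define \<gamma>' where "\<gamma>' = case_nat (\<lambda>x\<in>space M. x) \<gamma>"
  define A' where "A' = case_nat (space M - G) (\<lambda>i. A i \<inter> G)"
  have "g \<in> mp_bijections M"
  proof (rule mp_piecewise[of \<gamma>' M A'])
    show "\<gamma>' i \<in> mp_bijections M" for i using \<gamma> by (simp add: id_mp \<gamma>'_def split: nat.split)
    show "A' i \<in> sets M" for i using A Gs by (auto simp: A'_def split: nat.split)
    show "\<forall>x\<in>A' i. g x = \<gamma>' i x" for i
      using h Gsp by (cases i) (auto simp: A'_def \<gamma>'_def g_def)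
    show "space M \<subseteq> (\<Union>i. A' i)"
    proof
      fix x assume x: "x \<in> space M"
      show "x \<in> (\<Union>i. A' i)"
      proof (cases "x \<in> G")
        case True
        then obtain i where "x \<in> A i" using GX X(3) by blast
        then have "x \<in> A' (Suc i)" using True by (simp add: A'_def)
        then show ?thesis by blast
      next
        case False
        then have "x \<in> A' 0" using x by (simp add: A'_def)
        then show ?thesis by blast
      qed
    qed
  qed (use b in \<open>auto simp: g_def\<close>)
  moreover have "AE x in M. g x = h x"
    using GA by eventually_elim (use Gsp in \<open>auto simp: g_def\<close>)
  ultimately show ?thesis by blast
qed

section \<open>Classes of measure-preserving bijections\<close>

definition cls :: "'a measure \<Rightarrow> ('a \<Rightarrow> 'a) \<Rightarrow> ('a \<Rightarrow> 'a) set" where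
  "cls M f = {g \<in> mp_bijections M. AE x in M. f x = g x}"

lemma cls_self: "f \<in> mp_bijections M \<Longrightarrow> f \<in> cls M f"
  by (simp add: cls_def)

lemma cls_Aut: "f \<in> mp_bijections M \<Longrightarrow> cls M f \<in> carrier (Aut M)"
  by (auto simp: carrier_Aut cls_def)

lemma Aut_cls: "T \<in> carrier (Aut M) \<Longrightarrow> \<exists>f\<in>mp_bijections M. T = cls M f"
  by (auto simp: carrier_Aut cls_def)

lemma Aut_cls': "T \<in> carrier (Aut M) \<Longrightarrow> f \<in> T \<Longrightarrow> f \<in> mp_bijections M \<and> T = cls M f"
  using class_iff[of T M f] class_iff[of T M f f] by (simp add: cls_def set_eq_iff)

lemma group_hom_cls: "group_hom (mp_group M) (Aut M) (cls M)"
proof -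
  have "(\<lambda>f. null_bijections M #>\<^bsub>mp_group M\<^esub> f) \<in> hom (mp_group M) (Aut M)"
    unfolding Aut_def by (rule normal.r_coset_hom_Mod[OF normal_null_bijections])
  moreover have "null_bijections M #>\<^bsub>mp_group M\<^esub> f = cls M f" if "f \<in> mp_bijections M" for f
    using that by (simp add: cls_def rcoset_null_bijections)
  ultimately have "cls M \<in> hom (mp_group M) (Aut M)"
    by (auto simp: hom_def mp_closed cls_Aut)
  then show ?thesis
    by (simp add: group_hom_def group_hom_axioms_def group_mp_group group_Aut)
qed

lemma cls_mult: "f \<in> mp_bijections M \<Longrightarrow> g \<in> mp_bijections M \<Longrightarrow>
    cls M f \<otimes>\<^bsub>Aut M\<^esub> cls M g = cls M (f \<otimes>\<^bsub>mp_group M\<^esub> g)"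
  using group_hom.hom_mult[OF group_hom_cls, of f M g] by simp

lemma cls_inv: "f \<in> mp_bijections M \<Longrightarrow> inv\<^bsub>Aut M\<^esub> cls M f = cls M (inv\<^bsub>mp_group M\<^esub> f)"
  using group_hom.hom_inv[OF group_hom_cls, of f M] by simp

lemma cls_one: "\<one>\<^bsub>Aut M\<^esub> = cls M \<one>\<^bsub>mp_group M\<^esub>"
  using group_hom.hom_one[OF group_hom_cls, of M] by simp

lemma cls_eq_iff:
  "f \<in> mp_bijections M \<Longrightarrow> g \<in> mp_bijections M \<Longrightarrow> cls M f = cls M g \<longleftrightarrow> (AE x in M. f x = g x)"
  by (auto simp: cls_def elim: eventually_elim2)

lemma cls_word_val:
  assumes "\<And>s. F s \<in> mp_bijections M"
  shows "word_val (Aut M) (\<lambda>s. cls M (F s)) w = cls M (word_val (mp_group M) F w)"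
proof -
  interpret group_family "mp_group M" F
    by (rule group.group_family[OF group_mp_group]) (simp add: assms)
  have l: "letter_val (Aut M) (\<lambda>s. cls M (F s)) a = cls M (letter_val (mp_group M) F a)" for a
    using assms by (simp add: letter_val_def cls_inv)
  show ?thesis
    by (induction w) (use l letter_val_closed word_val_closed in \<open>simp_all add: cls_one cls_mult\<close>)
qed

section \<open>Standard probability spaces\<close>

locale std_prob =
  fixes M :: "'a measure"
  assumes std: "standard_prob_space M"

sublocale std_prob \<subseteq> prob_space M
  using std by (simp add: standard_prob_space_def)

context std_prob
begin

lemma std_borel: "standard_borel M"
  using std by (simp add: standard_prob_space_def)

lemma mp_neq_sets [measurable]: "f \<in> mp_bijections M \<Longrightarrow> g \<in> mp_bijections M \<Longrightarrow> {x \<in> space M. f x \<noteq> g x} \<in> sets M"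
  by (rule sets_neq[OF std_borel]) auto

lemma mp_eq_sets: "f \<in> mp_bijections M \<Longrightarrow> g \<in> mp_bijections M \<Longrightarrow> {x \<in> space M. f x = g x} \<in> sets M"
proof -
  assume "f \<in> mp_bijections M" "g \<in> mp_bijections M"
  from sets.compl_sets[OF mp_neq_sets[OF this]]
  have "space M - {x \<in> space M. f x \<noteq> g x} \<in> sets M" .
  also have "space M - {x \<in> space M. f x \<noteq> g x} = {x \<in> space M. f x = g x}" by auto
  finally show ?thesis .
qed

definition du :: "('a \<Rightarrow> 'a) \<Rightarrow> ('a \<Rightarrow> 'a) \<Rightarrow> real" where
  "du f g = prob {x \<in> space M. f x \<noteq> g x}"

lemma d_u_cls: "f \<in> mp_bijections M \<Longrightarrow> g \<in> mp_bijections M \<Longrightarrow> d_u M (cls M f) (cls M g) = du f g"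
  using d_u_eq[OF std, of "cls M f" f "cls M g" g] by (simp add: cls_Aut cls_self du_def)

lemma du_commute: "du f g = du g f"
  by (simp add: du_def eq_commute)

lemma du_triangle:
  assumes "f \<in> mp_bijections M" "g \<in> mp_bijections M" "h \<in> mp_bijections M"
  shows "du f h \<le> du f g + du g h"
proof -
  have "du f h \<le> prob ({x \<in> space M. f x \<noteq> g x} \<union> {x \<in> space M. g x \<noteq> h x})"
    unfolding du_def using assms by (intro finite_measure_mono) auto
  also have "\<dots> \<le> du f g + du g h"
    unfolding du_def using assms by (intro measure_Un_le) auto
  finally show ?thesis .
qed

lemma du_mult_left:
  assumes "f \<in> mp_bijections M" "g \<in> mp_bijections M" "h \<in> mp_bijections M"
  shows "du (h \<otimes>\<^bsub>mp_group M\<^esub> f) (h \<otimes>\<^bsub>mp_group M\<^esub> g) = du f g"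
proof -
  have "{x \<in> space M. (h \<otimes>\<^bsub>mp_group M\<^esub> f) x \<noteq> (h \<otimes>\<^bsub>mp_group M\<^esub> g) x} = {x \<in> space M. f x \<noteq> g x}"
    using assms by (auto simp: mp_mult mp_inj mp_space)
  then show ?thesis by (simp add: du_def)
qed

lemma du_mult_right:
  assumes "f \<in> mp_bijections M" "g \<in> mp_bijections M" "h \<in> mp_bijections M"
  shows "du (f \<otimes>\<^bsub>mp_group M\<^esub> h) (g \<otimes>\<^bsub>mp_group M\<^esub> h) = du f g"
proof -
  have "{x \<in> space M. (f \<otimes>\<^bsub>mp_group M\<^esub> h) x \<noteq> (g \<otimes>\<^bsub>mp_group M\<^esub> h) x} =
      {x \<in> space M. h x \<in> {x \<in> space M. f x \<noteq> g x}}"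
    using assms by (auto simp: mp_mult mp_space)
  then show ?thesis using mp_measure(2)[OF assms(3) mp_neq_sets[OF assms(1,2)]] by (simp add: du_def)
qed

lemma du_le:
  assumes "\<And>x. x \<in> space M \<Longrightarrow> f x \<noteq> g x \<Longrightarrow> x \<in> B" "B \<in> sets M"
  shows "du f g \<le> prob B"
  unfolding du_def using assms by (intro finite_measure_mono) auto

text \<open>A countable base of the topology generates the sigma-algebra and, the space being
  Hausdorff, separates points. Separation will yield the markers of a tower, generation the
  separability of the full group.\<close>

lemma countable_generator:
  "\<exists>E :: nat \<Rightarrow> 'a set. (\<forall>i. E i \<in> sets M) \<and> sets M = sigma_sets (space M) (range E) \<and>
     (\<forall>x\<in>space M. \<forall>y\<in>space M. x \<noteq> y \<longrightarrow> (\<exists>i. x \<in> E i \<and> y \<notin> E i))"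
proof -
  obtain S where S: "completely_metrizable_space S" "second_countable S" "topspace S = space M"
    "sets M = sigma_sets (space M) {U. openin S U}"
    using std_borel by (auto simp: standard_borel_def)
  obtain B where B: "countable B" "\<And>V. V \<in> B \<Longrightarrow> openin S V"
    "\<And>U x. openin S U \<Longrightarrow> x \<in> U \<Longrightarrow> \<exists>V\<in>B. x \<in> V \<and> V \<subseteq> U"
    using S(2) by (auto simp: second_countable_def)
  have "Hausdorff_space S"
    using S(1) completely_metrizable_imp_metrizable_space metrizable_imp_Hausdorff_space by blast
  \<comment> \<open>Inserting the whole space makes the family nonempty, as its enumeration by all
    numbers requires.\<close>
  define E where "E = from_nat_into (insert (space M) B)"
  have E: "range E = insert (space M) B"
    unfolding E_def using B(1) by (intro range_from_nat_into) auto
  have op: "openin S (E i)" for i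
  proof -
    have "E i \<in> insert (space M) B" using E by blast
    then show ?thesis using B(2) openin_topspace[of S] S(3) by auto
  qed
  have "sigma_sets (space M) {U. openin S U} = sigma_sets (space M) (range E)"
  proof (rule sigma_sets_eqI)
    fix U assume "U \<in> {U. openin S U}"
    then have U: "openin S U" by simp
    have "U = \<Union>{V \<in> B. V \<subseteq> U}" using B(3)[OF U] by blast
    moreover have "\<Union>{V \<in> B. V \<subseteq> U} \<in> sigma_sets (space M) (range E)"
    proof (rule sigma_sets_UNION)
      show "countable {V \<in> B. V \<subseteq> U}" using B(1) by auto
      fix V assume "V \<in> {V \<in> B. V \<subseteq> U}"
      then show "V \<in> sigma_sets (space M) (range E)" using E by (intro sigma_sets.Basic) auto
    qed
    ultimately show "U \<in> sigma_sets (space M) (range E)" by simp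
  next
    fix U assume "U \<in> range E"
    then show "U \<in> sigma_sets (space M) {U. openin S U}"
      using op by (auto intro: sigma_sets.Basic)
  qed
  moreover have "E i \<in> sets M" for i using op by (simp add: S(4))
  moreover have "\<exists>i. x \<in> E i \<and> y \<notin> E i" if xy: "x \<in> space M" "y \<in> space M" "x \<noteq> y" for x y
  proof -
    obtain U U' where U: "openin S U" "x \<in> U" "y \<in> U'" "disjnt U U'"
      using \<open>Hausdorff_space S\<close> xy unfolding Hausdorff_space_def S(3) by meson
    then obtain V where V: "V \<in> B" "x \<in> V" "V \<subseteq> U" using B(3) by blast
    then obtain i where "V = E i" using E by blast
    then show ?thesis using V U by (auto simp: disjnt_def)
  qed
  ultimately show ?thesis using S(4) by metis
qed

text \<open>The sets decided by membership in finitely many of the generators form a countable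
  algebra, and the sets that it approximates form a sigma-algebra.\<close>

lemma countable_dense_algebra:
  "\<exists>\<A>. countable \<A> \<and> \<A> \<subseteq> sets M \<and>
     (\<forall>B\<in>sets M. \<forall>\<epsilon>>0. \<exists>A\<in>\<A>. prob ((A - B) \<union> (B - A)) < \<epsilon>)"
proof -
  obtain E :: "nat \<Rightarrow> 'a set" where "(\<forall>i. E i \<in> sets M) \<and> sets M = sigma_sets (space M) (range E) \<and>
     (\<forall>x\<in>space M. \<forall>y\<in>space M. x \<noteq> y \<longrightarrow> (\<exists>i. x \<in> E i \<and> y \<notin> E i))"
    using countable_generator by (elim exE)
  then have E: "\<And>i. E i \<in> sets M" "sets M = sigma_sets (space M) (range E)" by simp_all
  \<comment> \<open>\<open>F\<close> lists the admissible membership patterns with respect to the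
    first \<open>n\<close> generators.\<close>
  define C where "C n F = {x \<in> space M. {i. i < n \<and> x \<in> E i} \<in> F}" for n :: nat and F
  define \<A> where "\<A> = (\<Union>n. C n ` Pow (Pow {..<n}))"
  have Cs: "C n F \<in> sets M" if "F \<subseteq> Pow {..<n}" for n F
  proof -
    have "{x \<in> space M. \<forall>i\<in>{..<n}. x \<in> E i \<longleftrightarrow> i \<in> J} \<in> sets M" for J
    proof (rule sets.sets_Collect_finite_All)
      fix i
      have "{x \<in> space M. x \<in> E i \<longleftrightarrow> i \<in> J} = (if i \<in> J then E i else space M - E i)"
        using sets.sets_into_space[OF E(1)] by auto
      then show "{x \<in> space M. x \<in> E i \<longleftrightarrow> i \<in> J} \<in> sets M" using E(1) by simp
    qed auto
    moreover have "C n F = (\<Union>J\<in>F. {x \<in> space M. \<forall>i\<in>{..<n}. x \<in> E i \<longleftrightarrow> i \<in> J})"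
    proof -
      have "{i. i < n \<and> x \<in> E i} = J \<longleftrightarrow> (\<forall>i\<in>{..<n}. x \<in> E i \<longleftrightarrow> i \<in> J)" if "J \<in> F" for x J
        using that \<open>F \<subseteq> Pow {..<n}\<close> by auto
      then show ?thesis by (fastforce simp: C_def)
    qed
    moreover have "finite F" using that by (rule finite_subset) simp
    ultimately show ?thesis by auto
  qed
  have CA: "C n F \<in> \<A>" for n F
  proof -
    have "C n F = C n (F \<inter> Pow {..<n})" by (auto simp: C_def)
    then show ?thesis by (auto simp: \<A>_def)
  qed
  have As: "A \<in> sets M" if "A \<in> \<A>" for A using that Cs by (auto simp: \<A>_def)
  have lift: "C n F = C m {J. J \<inter> {..<n} \<in> F}" if "n \<le> m" for n m F
  proof -
    have "{i. i < m \<and> x \<in> E i} \<inter> {..<n} = {i. i < n \<and> x \<in> E i}" for x using that by auto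
    then show ?thesis by (simp add: C_def)
  qed
  have Un: "A \<union> B \<in> \<A>" if A: "A \<in> \<A>" and B: "B \<in> \<A>" for A B
  proof -
    obtain n F m F' where "A = C n F" "B = C m F'" using A B by (auto simp: \<A>_def)
    then have "A \<union> B = C (max n m) {J. J \<inter> {..<n} \<in> F} \<union> C (max n m) {J. J \<inter> {..<m} \<in> F'}"
      using lift[of n "max n m" F] lift[of m "max n m" F'] by simp
    also have "\<dots> = C (max n m) ({J. J \<inter> {..<n} \<in> F} \<union> {J. J \<inter> {..<m} \<in> F'})"
      by (auto simp: C_def)
    finally show ?thesis using CA by simp
  qed
  have empty: "{} \<in> \<A>" using CA[of 0 "{}"] by (simp add: C_def)
  have fin: "(\<Union>i<n. A i) \<in> \<A>" if "\<And>i. A i \<in> \<A>" for A :: "nat \<Rightarrow> 'a set" and n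
    by (induction n) (use that Un empty in \<open>auto simp: lessThan_Suc\<close>)
  let ?\<Delta> = "\<lambda>A B. (A - B) \<union> (B - A) :: 'a set"
  have "\<forall>\<epsilon>>0. \<exists>A\<in>\<A>. prob (?\<Delta> A B) < \<epsilon>" if "B \<in> sets M" for B
    using that unfolding E(2)
  proof (induction rule: sigma_sets.induct)
    case (Basic a)
    then obtain i where a: "a = E i" by blast
    have "a = C (Suc i) {J. i \<in> J}"
      using sets.sets_into_space[OF E(1)] by (auto simp: C_def a)
    then have "a \<in> \<A>" using CA by simp
    then show ?case by (auto intro!: bexI[of _ a])
  next
    case Empty
    show ?case using empty by (auto intro!: bexI[of _ "{}"])
  next
    case (Compl a)
    show ?case
    proof (intro allI impI)
      fix \<epsilon> :: real assume "\<epsilon> > 0"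
      then obtain A where A: "A \<in> \<A>" "prob (?\<Delta> A a) < \<epsilon>" using Compl.IH by blast
      obtain n F where AC: "A = C n F" using A(1) by (auto simp: \<A>_def)
      have "a \<subseteq> space M" using Compl.hyps E(2) sets.sets_into_space by blast
      then have "?\<Delta> (space M - A) (space M - a) = ?\<Delta> A a"
        using sets.sets_into_space[OF As[OF A(1)]] by auto
      moreover have "space M - A = C n (- F)" by (auto simp: AC C_def)
      then have "space M - A \<in> \<A>" using CA by simp
      ultimately show "\<exists>A\<in>\<A>. prob (?\<Delta> A (space M - a)) < \<epsilon>"
        using A(2) by (auto intro!: bexI[of _ "space M - A"])
    qed
  next
    case (Union a)
    have as: "a i \<in> sets M" for i using Union.hyps E(2) by blast
    show ?case
    proof (intro allI impI)
      fix \<epsilon> :: real assume e: "\<epsilon> > 0"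
      have "(\<lambda>n. prob (\<Union>i<n. a i)) \<longlonglongrightarrow> prob (\<Union>n. \<Union>i<n. a i)"
        using as by (intro finite_Lim_measure_incseq) (auto simp: incseq_def intro: less_le_trans)
      moreover have "(\<Union>n. \<Union>i<n. a i) = (\<Union>i. a i)" by auto
      ultimately have "(\<lambda>n. prob (\<Union>i<n. a i)) \<longlonglongrightarrow> prob (\<Union>i. a i)" by simp
      then have "\<forall>\<^sub>F n in sequentially. prob (\<Union>i. a i) - \<epsilon> / 2 < prob (\<Union>i<n. a i)"
        by (rule order_tendstoD) (use e in simp)
      then obtain n where n: "prob (\<Union>i. a i) - \<epsilon> / 2 < prob (\<Union>i<n. a i)"
        by (auto simp: eventually_sequentially)
      have n': "prob ((\<Union>i. a i) - (\<Union>i<n. a i)) < \<epsilon> / 2"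
        using n as by (subst finite_measure_Diff) auto
      \<comment> \<open>Half of \<open>\<epsilon>\<close> pays for cutting the union off at
        \<open>n\<close>, the other half for the \<open>n\<close> approximations.\<close>
      define \<delta> where "\<delta> = \<epsilon> / (2 * (real n + 1))"
      have d: "\<delta> > 0" "real n * \<delta> \<le> \<epsilon> / 2" using e by (auto simp: \<delta>_def field_simps)
      have "\<forall>i. \<exists>A. A \<in> \<A> \<and> prob (?\<Delta> A (a i)) < \<delta>" using Union.IH d(1) by blast
      from choice[OF this] obtain A where A: "\<And>i. A i \<in> \<A>" "\<And>i. prob (?\<Delta> (A i) (a i)) < \<delta>"
        by blast
      have "prob (\<Union>i<n. ?\<Delta> (A i) (a i)) \<le> (\<Sum>i<n. prob (?\<Delta> (A i) (a i)))"
        using A(1) As as by (intro finite_measure_subadditive_finite) auto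
      also have "\<dots> \<le> (\<Sum>i<n. \<delta>)" using A(2) by (intro sum_mono less_imp_le) auto
      finally have 1: "prob (\<Union>i<n. ?\<Delta> (A i) (a i)) \<le> \<epsilon> / 2" using d(2) by simp
      have "prob (?\<Delta> (\<Union>i<n. A i) (\<Union>i. a i)) \<le>
          prob ((\<Union>i<n. ?\<Delta> (A i) (a i)) \<union> ((\<Union>i. a i) - (\<Union>i<n. a i)))"
        using A(1) As as by (intro finite_measure_mono sets.Un sets.finite_UN sets.Diff sets.countable_UN) auto
      also have "\<dots> \<le> prob (\<Union>i<n. ?\<Delta> (A i) (a i)) + prob ((\<Union>i. a i) - (\<Union>i<n. a i))"
        using A(1) As as by (intro measure_Un_le sets.finite_UN sets.Diff sets.Un sets.countable_UN) auto
      also have "\<dots> < \<epsilon>" using 1 n' by simp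
      finally have "prob (?\<Delta> (\<Union>i<n. A i) (\<Union>i. a i)) < \<epsilon>" .
      then show "\<exists>A\<in>\<A>. prob (?\<Delta> A (\<Union>i. a i)) < \<epsilon>"
        by (rule bexI) (rule fin[OF A(1)])
    qed
  qed
  moreover have "countable \<A>"
    unfolding \<A>_def by (rule countable_UN[OF countableI_type], rule countable_finite, rule finite_imageI) simp
  ultimately show ?thesis using As by blast
qed

end

section \<open>Orbit relations of single maps\<close>

section \<open>Full groups of single automorphisms\<close>

text \<open>The full group of the orbit relation of \<open>f\<close> on the level of genuine maps,
  before passing to classes.\<close>

definition full_mp :: "'a measure \<Rightarrow> ('a \<Rightarrow> 'a) \<Rightarrow> ('a \<Rightarrow> 'a) set" where
  "full_mp M f = {g \<in> mp_bijections M. AE x in M. \<exists>k::int. g x = (f [^]\<^bsub>mp_group M\<^esub> k) x}"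

lemma rel_eq_mod_null_sym: "rel_eq_mod_null M R S \<Longrightarrow> rel_eq_mod_null M S R"
  by (auto simp: rel_eq_mod_null_def)

lemma rel_eq_mod_null_trans:
  assumes "rel_eq_mod_null M R S" "rel_eq_mod_null M S S'"
  shows "rel_eq_mod_null M R S'"
proof -
  obtain N N' where "N \<in> null_sets M" "N' \<in> null_sets M"
    "\<forall>x\<in>space M - N. \<forall>y\<in>space M - N. (x, y) \<in> R \<longleftrightarrow> (x, y) \<in> S"
    "\<forall>x\<in>space M - N'. \<forall>y\<in>space M - N'. (x, y) \<in> S \<longleftrightarrow> (x, y) \<in> S'"
    using assms by (auto simp: rel_eq_mod_null_def)
  then show ?thesis unfolding rel_eq_mod_null_def
    by (intro bexI[of _ "N \<union> N'"]) auto
qed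

lemma AE_obtain_null:
  assumes "AE x in M. Q x"
  shows "\<exists>N\<in>null_sets M. \<forall>x\<in>space M - N. Q x"
  using assms unfolding eventually_ae_filter by blast

locale mp_map = std_prob M for M :: "'a measure" +
  fixes f :: "'a \<Rightarrow> 'a"
  assumes f_mp: "f \<in> mp_bijections M"
begin

sublocale G: group "mp_group M" by (rule group_mp_group)

definition P :: "int \<Rightarrow> 'a \<Rightarrow> 'a" where
  "P k = f [^]\<^bsub>mp_group M\<^esub> k"

lemma P_mp [simp]: "P k \<in> mp_bijections M"
  using G.int_pow_closed[of f k] f_mp by (simp add: P_def)

lemma P_space [simp]: "x \<in> space M \<Longrightarrow> P k x \<in> space M"
  using mp_space[OF P_mp] .

lemma P_add: "x \<in> space M \<Longrightarrow> P (i + j) x = P i (P j x)"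
  using G.int_pow_mult[of f i j] f_mp mp_mult[OF P_mp P_mp, of x i j] by (simp add: P_def)

lemma P_0 [simp]: "x \<in> space M \<Longrightarrow> P 0 x = x"
  by (simp add: P_def one_mp_group)

lemma P_1: "P 1 = f"
  using G.int_pow_1[of f] f_mp by (simp add: P_def)

lemma P_minus [simp]: "x \<in> space M \<Longrightarrow> P (- k) (P k x) = x" "x \<in> space M \<Longrightarrow> P k (P (- k) x) = x"
  by (simp_all flip: P_add)

lemma P_inj: "x \<in> space M \<Longrightarrow> y \<in> space M \<Longrightarrow> P k x = P k y \<longleftrightarrow> x = y"
  by (rule mp_inj[OF P_mp])

lemma P_eq_iff: "x \<in> space M \<Longrightarrow> y \<in> space M \<Longrightarrow> P i x = P j y \<longleftrightarrow> P (i - j) x = y"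
  using P_inj[of "P (i - j) x" y j] P_add[of x j "i - j"] by simp

lemma P_funpow: "x \<in> space M \<Longrightarrow> (f ^^ n) x = P (int n) x"
proof (induction n)
  case (Suc n)
  then show ?case using P_add[of x 1 "int n"] P_1 by (simp add: add.commute)
qed simp

lemma orbit_rel_iff: "(x, y) \<in> orbit_rel (space M) f \<longleftrightarrow> x \<in> space M \<and> y \<in> space M \<and> (\<exists>k. y = P k x)"
proof
  assume r: "(x, y) \<in> orbit_rel (space M) f"
  then obtain n where xy: "x \<in> space M" "y \<in> space M" and n: "y = (f ^^ n) x \<or> x = (f ^^ n) y"
    by (auto simp: orbit_rel_def)
  from n have "y = P (int n) x \<or> y = P (- int n) x"
    using xy by (auto simp: P_funpow)
  then show "x \<in> space M \<and> y \<in> space M \<and> (\<exists>k. y = P k x)" using xy by blast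
next
  assume "x \<in> space M \<and> y \<in> space M \<and> (\<exists>k. y = P k x)"
  then obtain k where k: "x \<in> space M" "y \<in> space M" "y = P k x" by blast
  show "(x, y) \<in> orbit_rel (space M) f"
  proof (cases "k \<ge> 0")
    case True
    then have "y = (f ^^ nat k) x" using k P_funpow[of x "nat k"] by simp
    then show ?thesis using k by (auto simp: orbit_rel_def)
  next
    case False
    then have "x = (f ^^ nat (- k)) y" using k P_funpow[of y "nat (- k)"] by simp
    then show ?thesis using k by (auto simp: orbit_rel_def)
  qed
qed

lemma full_mp_iff: "g \<in> full_mp M f \<longleftrightarrow> g \<in> mp_bijections M \<and> (AE x in M. \<exists>k. g x = P k x)"
  by (simp add: full_mp_def P_def)

lemma full_mp_mp: "g \<in> full_mp M f \<Longrightarrow> g \<in> mp_bijections M"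
  by (simp add: full_mp_def)

lemma P_full: "P k \<in> full_mp M f"
  by (auto simp: full_mp_iff)

lemma subgroup_full_mp: "subgroup (full_mp M f) (mp_group M)"
proof (rule G.subgroupI)
  show "full_mp M f \<subseteq> carrier (mp_group M)" by (auto simp: full_mp_def)
  show "full_mp M f \<noteq> {}" using P_full by blast
next
  fix g assume g: "g \<in> full_mp M f"
  then have gm: "g \<in> mp_bijections M" and ae: "AE x in M. \<exists>k. g x = P k x"
    by (auto simp: full_mp_iff)
  let ?i = "inv\<^bsub>mp_group M\<^esub> g"
  have im: "?i \<in> mp_bijections M" using gm by (rule mp_closed)
  have "AE x in M. \<exists>k. ?i x = P k x"
    using AE_comp_mp[OF im ae] AE_space
  proof eventually_elim
    case (elim x)
    then obtain k where "g (?i x) = P k (?i x)" by blast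
    then have "x = P k (?i x)" using inv_mp_group(2)[OF gm elim(2)] by simp
    then have "?i x = P (- k) x" using P_minus(1)[OF mp_space[OF im elim(2)], of k] by simp
    then show ?case by blast
  qed
  then show "?i \<in> full_mp M f" using im by (simp add: full_mp_iff)
next
  fix g h assume g: "g \<in> full_mp M f" and h: "h \<in> full_mp M f"
  then have gm: "g \<in> mp_bijections M" "AE x in M. \<exists>k. g x = P k x"
    and hm: "h \<in> mp_bijections M" "AE x in M. \<exists>k. h x = P k x"
    by (auto simp: full_mp_iff)
  have "AE x in M. \<exists>k. (g \<otimes>\<^bsub>mp_group M\<^esub> h) x = P k x"
    using AE_comp_mp[OF hm(1) gm(2)] hm(2) AE_space
  proof eventually_elim
    case (elim x)
    then obtain k l where "g (h x) = P k (h x)" "h x = P l x" by blast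
    then have "(g \<otimes>\<^bsub>mp_group M\<^esub> h) x = P (k + l) x"
      using elim(3) gm(1) hm(1) by (simp add: mp_mult P_add)
    then show ?case by blast
  qed
  then show "g \<otimes>\<^bsub>mp_group M\<^esub> h \<in> full_mp M f"
    using gm hm by (simp add: full_mp_iff mp_closed)
qed

lemma full_mp_cong:
  assumes "g \<in> full_mp M f" "h \<in> mp_bijections M" "AE x in M. g x = h x"
  shows "h \<in> full_mp M f"
proof -
  have "AE x in M. \<exists>k. g x = P k x" using assms(1) by (simp add: full_mp_iff)
  then have "AE x in M. \<exists>k. h x = P k x" using assms(3) by eventually_elim simp
  then show ?thesis using assms(2) by (simp add: full_mp_iff)
qed

lemma full_group_orbit_rel: "full_group M (orbit_rel (space M) f) = cls M ` full_mp M f"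
proof (intro equalityI subsetI)
  fix T assume "T \<in> full_group M (orbit_rel (space M) f)"
  then obtain g where T: "T \<in> carrier (Aut M)" "g \<in> T" and ae: "AE x in M. (x, g x) \<in> orbit_rel (space M) f"
    by (auto simp: full_group_def)
  have g: "g \<in> mp_bijections M" "T = cls M g" using Aut_cls'[OF T] by auto
  have "AE x in M. \<exists>k. g x = P k x" using ae by eventually_elim (simp add: orbit_rel_iff)
  then show "T \<in> cls M ` full_mp M f" using g by (auto simp: full_mp_iff)
next
  fix T assume "T \<in> cls M ` full_mp M f"
  then obtain g where g: "T = cls M g" "g \<in> mp_bijections M" and ae: "AE x in M. \<exists>k. g x = P k x"
    by (auto simp: full_mp_iff)
  have "AE x in M. (x, g x) \<in> orbit_rel (space M) f"
    using ae AE_space by eventually_elim (auto simp: orbit_rel_iff)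
  then show "T \<in> full_group M (orbit_rel (space M) f)"
    using g cls_self[OF g(2)] cls_Aut[OF g(2)] by (auto simp: full_group_def)
qed

lemma rel_eq_mod_null_full:
  assumes g: "g \<in> mp_bijections M"
    and eq: "rel_eq_mod_null M (orbit_rel (space M) f) (orbit_rel (space M) g)"
  shows "g \<in> full_mp M f"
proof -
  interpret g: mp_map M g by unfold_locales (rule g)
  obtain N where N: "N \<in> null_sets M" "\<And>x y. x \<in> space M - N \<Longrightarrow> y \<in> space M - N \<Longrightarrow>
      (x, y) \<in> orbit_rel (space M) f \<longleftrightarrow> (x, y) \<in> orbit_rel (space M) g"
    using eq by (auto simp: rel_eq_mod_null_def)
  have "AE x in M. \<exists>k. g x = P k x"
    using AE_not_in[OF N(1)] AE_comp_mp[OF g AE_not_in[OF N(1)]] AE_space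
  proof eventually_elim
    case (elim x)
    then have s: "x \<in> space M - N" "g x \<in> space M - N" using mp_space[OF g] by auto
    have "(x, g x) \<in> orbit_rel (space M) g"
      using s g.P_1 by (auto simp: g.orbit_rel_iff intro!: exI[of _ 1])
    then have "(x, g x) \<in> orbit_rel (space M) f" using N(2)[OF s] by simp
    then show ?case by (simp add: orbit_rel_iff)
  qed
  then show ?thesis using g by (simp add: full_mp_iff)
qed

end

context std_prob
begin

lemma mp_mapI: "f \<in> mp_bijections M \<Longrightarrow> mp_map M f"
  using std by unfold_locales

text \<open>All powers of \<open>g\<close> lie in the full group of \<open>f\<close>, and there are
  countably many of them, so one null set serves all exponents.\<close>

lemma full_mp_orbits:
  assumes f: "f \<in> mp_bijections M" and g: "g \<in> full_mp M f"
  shows "AE x in M. \<forall>k. \<exists>l. mp_map.P M g k x = mp_map.P M f l x"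
proof -
  interpret f: mp_map M f by (rule mp_mapI[OF f])
  interpret g: mp_map M g by (rule mp_mapI) (use g in \<open>simp add: full_mp_def\<close>)
  have "g.P k \<in> full_mp M f" for k
    using f.G.subgroup_int_pow_closed[OF f.subgroup_full_mp g] unfolding g.P_def .
  then show ?thesis by (simp add: AE_all_countable f.full_mp_iff)
qed

lemma full_mp_rel_eq_mod_null:
  assumes f: "f \<in> full_mp M g" and g: "g \<in> full_mp M f"
  shows "rel_eq_mod_null M (orbit_rel (space M) f) (orbit_rel (space M) g)"
proof -
  have m: "f \<in> mp_bijections M" "g \<in> mp_bijections M" using f g by (auto simp: full_mp_def)
  interpret f: mp_map M f by (rule mp_mapI[OF m(1)])
  interpret g: mp_map M g by (rule mp_mapI[OF m(2)])
  have "AE x in M. (\<forall>k. \<exists>l. g.P k x = f.P l x) \<and> (\<forall>k. \<exists>l. f.P k x = g.P l x)"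
    using full_mp_orbits[OF m(1) g] full_mp_orbits[OF m(2) f] by eventually_elim blast
  from AE_obtain_null[OF this] obtain N where N: "N \<in> null_sets M" "\<forall>x\<in>space M - N.
      (\<forall>k. \<exists>l. g.P k x = f.P l x) \<and> (\<forall>k. \<exists>l. f.P k x = g.P l x)"
    by blast
  have "(x, y) \<in> orbit_rel (space M) f \<longleftrightarrow> (x, y) \<in> orbit_rel (space M) g" if "x \<in> space M - N" for x y
    using N(2) that unfolding f.orbit_rel_iff g.orbit_rel_iff by metis
  then show ?thesis
    unfolding rel_eq_mod_null_def using N(1) by blast
qed

text \<open>Having the same orbits almost everywhere means that each map lies in the full group of
  the other. In this form generators can be recognised after conjugation and described by countably
  many open conditions.\<close>

lemma GEN_orbit_rel:
  assumes f: "f \<in> mp_bijections M"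
  shows "GEN M (orbit_rel (space M) f) = cls M ` {g \<in> full_mp M f. f \<in> full_mp M g}"
proof (intro equalityI subsetI)
  fix T assume "T \<in> GEN M (orbit_rel (space M) f)"
  then obtain g where T: "T \<in> carrier (Aut M)" "g \<in> T"
    and r: "rel_eq_mod_null M (orbit_rel (space M) f) (orbit_rel (space M) g)"
    by (auto simp: GEN_def)
  have g: "g \<in> mp_bijections M" "T = cls M g" using Aut_cls'[OF T] by auto
  have "g \<in> full_mp M f" by (rule mp_map.rel_eq_mod_null_full[OF mp_mapI[OF f] g(1) r])
  moreover have "f \<in> full_mp M g"
    by (rule mp_map.rel_eq_mod_null_full[OF mp_mapI[OF g(1)] f rel_eq_mod_null_sym[OF r]])
  ultimately show "T \<in> cls M ` {g \<in> full_mp M f. f \<in> full_mp M g}" using g by blast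
next
  fix T assume "T \<in> cls M ` {g \<in> full_mp M f. f \<in> full_mp M g}"
  then obtain g where g: "g \<in> full_mp M f" "f \<in> full_mp M g" "T = cls M g" by blast
  then have "g \<in> mp_bijections M" by (simp add: full_mp_def)
  then show "T \<in> GEN M (orbit_rel (space M) f)"
    using full_mp_rel_eq_mod_null[OF g(2,1)] g cls_self cls_Aut by (auto simp: GEN_def)
qed

lemma GEN_rel_cong:
  assumes "rel_eq_mod_null M R S"
  shows "GEN M R = GEN M S"
proof -
  have "rel_eq_mod_null M R Q \<longleftrightarrow> rel_eq_mod_null M S Q" for Q
    using assms rel_eq_mod_null_trans rel_eq_mod_null_sym by metis
  then show ?thesis by (simp add: GEN_def)
qed

lemma full_group_rel_cong:
  assumes "rel_eq_mod_null M R S"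
  shows "full_group M R = full_group M S"
proof -
  have le: "full_group M R \<subseteq> full_group M S" if r: "rel_eq_mod_null M R S" for R S
  proof
    fix T assume "T \<in> full_group M R"
    then obtain h where T: "T \<in> carrier (Aut M)" "h \<in> T" "AE x in M. (x, h x) \<in> R"
      by (auto simp: full_group_def)
    have h: "h \<in> mp_bijections M" using Aut_cls'[OF T(1,2)] by simp
    obtain N where N: "N \<in> null_sets M" "\<And>x y. x \<in> space M - N \<Longrightarrow> y \<in> space M - N \<Longrightarrow>
      (x, y) \<in> R \<longleftrightarrow> (x, y) \<in> S"
      using r by (auto simp: rel_eq_mod_null_def)
    have "AE x in M. (x, h x) \<in> S"
      using T(3) AE_not_in[OF N(1)] AE_comp_mp[OF h AE_not_in[OF N(1)]] AE_space
    proof eventually_elim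
      case (elim x)
      then show ?case using N(2)[of x "h x"] mp_space[OF h] by auto
    qed
    then show "T \<in> full_group M S" using T by (auto simp: full_group_def)
  qed
  show ?thesis using le[OF assms] le[OF rel_eq_mod_null_sym[OF assms]] by blast
qed

text \<open>A nontrivial period of \<open>x\<close> makes its orbit finite. For almost every
  \<open>x\<close> the whole \<open>R\<close>-class lies in that orbit, which would make the class
  finite.\<close>

lemma aperiodic_orbit_rel:
  assumes f: "f \<in> mp_bijections M" and R: "pmp_equiv_rel M R" "aperiodic M R"
    and eq: "rel_eq_mod_null M R (orbit_rel (space M) f)"
  shows "AE x in M. \<forall>k. k \<noteq> 0 \<longrightarrow> mp_map.P M f k x \<noteq> x"
proof -
  interpret mp_map M f by (rule mp_mapI[OF f])
  obtain G :: "nat monoid" and \<phi> where \<phi>: "\<And>g. g \<in> carrier G \<Longrightarrow> \<phi> g \<in> mp_bijections M"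
    and Rd: "R = {(x, y). x \<in> space M \<and> y \<in> orbit G \<phi> x}"
    using R(1) by (auto simp: pmp_equiv_rel_def)
  obtain N where N: "N \<in> null_sets M" "\<And>x y. x \<in> space M - N \<Longrightarrow> y \<in> space M - N \<Longrightarrow>
      (x, y) \<in> R \<longleftrightarrow> (x, y) \<in> orbit_rel (space M) f"
    using eq by (auto simp: rel_eq_mod_null_def)
  \<comment> \<open>The class of \<open>x\<close> is swept out by countably many measure-preserving
    maps, so for almost every \<open>x\<close> it avoids the null set \<open>N\<close>
    altogether.\<close>
  have "AE x in M. \<forall>g. g \<in> carrier G \<longrightarrow> \<phi> g x \<notin> N"
    unfolding AE_all_countable
    using AE_comp_mp[OF \<phi> AE_not_in[OF N(1)]] by (auto intro: AE_impI)
  moreover have "AE x in M. infinite (R `` {x})" using R(2) by (simp add: aperiodic_def)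
  ultimately show ?thesis using AE_not_in[OF N(1)] AE_space
  proof eventually_elim
    case (elim x)
    have sub: "R `` {x} \<subseteq> range (\<lambda>k. P k x)"
    proof
      fix y assume y: "y \<in> R `` {x}"
      then obtain g where g: "g \<in> carrier G" "y = \<phi> g x" by (auto simp: Rd orbit_def)
      then have "y \<in> space M - N" using elim mp_space[OF \<phi>] by auto
      then have "(x, y) \<in> orbit_rel (space M) f" using N(2)[of x y] elim y by auto
      then show "y \<in> range (\<lambda>k. P k x)" by (auto simp: orbit_rel_iff)
    qed
    show ?case
    proof (intro allI impI notI)
      fix k :: int assume k: "k \<noteq> 0" "P k x = x"
      have mult: "P (int n * \<bar>k\<bar>) x = x" for n
      proof (induction n)
        case (Suc n)
        have "P \<bar>k\<bar> x = x" using k elim(4) P_minus(1)[of x k] by (cases "k \<ge> 0") auto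
        then show ?case using Suc P_add[of x "\<bar>k\<bar>" "int n * \<bar>k\<bar>"] elim(4) by (simp add: algebra_simps)
      qed (use elim in simp)
      have mult': "P (i * \<bar>k\<bar>) x = x" for i
      proof (cases "i \<ge> 0")
        case True
        then show ?thesis using mult[of "nat i"] by simp
      next
        case False
        then have "P (- (i * \<bar>k\<bar>)) x = x" using mult[of "nat (- i)"] by simp
        then show ?thesis using P_minus(2)[OF elim(4), of "i * \<bar>k\<bar>"] by simp
      qed
      have "P j x \<in> (\<lambda>j. P j x) ` {0..<\<bar>k\<bar>}" for j
      proof -
        have "P j x = P (j mod \<bar>k\<bar> + (j div \<bar>k\<bar>) * \<bar>k\<bar>) x" by (simp only: mod_div_mult_eq)
        also have "\<dots> = P (j mod \<bar>k\<bar>) x" unfolding P_add[OF elim(4)] mult' ..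
        finally show ?thesis using k(1) by auto
      qed
      then have "R `` {x} \<subseteq> (\<lambda>j. P j x) ` {0..<\<bar>k\<bar>}" using sub by blast
      then show False using elim(2) finite_subset by blast
    qed
  qed
qed

end

section \<open>Towers: existence, and permutations of their levels\<close>

section \<open>Rokhlin towers\<close>

locale aper_map = mp_map +
  assumes aper: "AE x in M. \<forall>k. k \<noteq> 0 \<longrightarrow> P k x \<noteq> x"

context mp_map
begin

definition lev :: "'a set \<Rightarrow> int \<Rightarrow> 'a set" where
  "lev D k = {x \<in> space M. P (- k) x \<in> D}"

lemma lev_sets: "D \<in> sets M \<Longrightarrow> lev D k \<in> sets M"
  unfolding lev_def by (rule mp_vimage_sets[OF P_mp])

lemma prob_lev: "D \<in> sets M \<Longrightarrow> prob (lev D k) = prob D"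
  unfolding lev_def by (rule mp_measure(2)[OF P_mp])

lemma lev_space: "x \<in> lev D k \<Longrightarrow> x \<in> space M"
  by (simp add: lev_def)

lemma P_lev: "d \<in> D \<Longrightarrow> D \<subseteq> space M \<Longrightarrow> P k d \<in> lev D k"
  by (auto simp: lev_def subset_iff)

lemma lev_E: "x \<in> lev D k \<Longrightarrow> \<exists>d\<in>D. d \<in> space M \<and> x = P k d"
  by (auto simp: lev_def intro!: bexI[of _ "P (- k) x"])

text \<open>Disjointness of the \<open>N\<close> levels, expressed as a return time of at least
  \<open>N\<close>. It is asked of every point of \<open>D\<close>, not of almost every one, so that
  coordinates in the tower are exactly unique.\<close>

definition tower :: "'a set \<Rightarrow> nat \<Rightarrow> bool" where
  "tower D N \<longleftrightarrow> D \<in> sets M \<and> (\<forall>d\<in>D. \<forall>j\<in>{1..<int N}. P j d \<notin> D)"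

definition tower_set :: "'a set \<Rightarrow> nat \<Rightarrow> 'a set" where
  "tower_set D N = (\<Union>k<N. lev D (int k))"

lemma tower_sets: "tower D N \<Longrightarrow> D \<in> sets M"
  by (simp add: tower_def)

lemma tower_space: "tower D N \<Longrightarrow> d \<in> D \<Longrightarrow> d \<in> space M"
  using tower_sets sets.sets_into_space by blast

lemma tower_set_sets: "D \<in> sets M \<Longrightarrow> tower_set D N \<in> sets M"
  unfolding tower_set_def by (intro sets.finite_UN lev_sets) auto

lemma tower_set_iff:
  assumes "tower D N"
  shows "x \<in> tower_set D N \<longleftrightarrow> (\<exists>d\<in>D. \<exists>k<N. x = P (int k) d)"
  unfolding tower_set_def using P_lev[of _ D] lev_E[of x D] tower_space[OF assms]
  by (auto simp: subset_iff) blast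

lemma tower_unique:
  assumes t: "tower D N" and d: "d \<in> D" "d' \<in> D" and k: "k < N" "k' < N"
    and eq: "P (int k) d = P (int k') d'"
  shows "k = k' \<and> d = d'"
proof -
  have s: "d \<in> space M" "d' \<in> space M" using tower_space[OF t] d by auto
  have le: False if "k < k'" "k' < N" "d \<in> D" "d' \<in> D" "P (int k) d = P (int k') d'"
    "d \<in> space M" "d' \<in> space M" for k k' d d'
  proof -
    have "P (int k' - int k) d' = d" using that by (simp add: P_eq_iff[symmetric])
    moreover have "int k' - int k \<in> {1..<int N}" using that by auto
    ultimately show False using t that unfolding tower_def by metis
  qed
  have "k = k'" using le[of k k' d d'] le[of k' k d' d] s d k eq by (cases k k' rule: linorder_cases) auto
  then show ?thesis using eq P_inj s by simp
qed

lemma prob_levels: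
  assumes t: "tower D N" and A: "\<And>k. k < N \<Longrightarrow> A k \<in> sets M" "\<And>k. k < N \<Longrightarrow> A k \<subseteq> D"
  shows "prob (\<Union>k<N. lev (A k) (int k)) = (\<Sum>k<N. prob (A k))"
proof -
  have "prob (\<Union>k\<in>{..<N}. lev (A k) (int k)) = (\<Sum>k\<in>{..<N}. prob (lev (A k) (int k)))"
  proof (rule finite_measure_finite_Union)
    show "disjoint_family_on (\<lambda>k. lev (A k) (int k)) {..<N}"
      unfolding disjoint_family_on_def
    proof (intro ballI impI)
      fix k l assume kl: "k \<in> {..<N}" "l \<in> {..<N}" "k \<noteq> l"
      show "lev (A k) (int k) \<inter> lev (A l) (int l) = {}"
      proof (rule ccontr)
        assume "lev (A k) (int k) \<inter> lev (A l) (int l) \<noteq> {}"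
        then obtain x where "x \<in> lev (A k) (int k)" "x \<in> lev (A l) (int l)" by blast
        then obtain d d' where "d \<in> A k" "x = P (int k) d" "d' \<in> A l" "x = P (int l) d'"
          using lev_E by metis
        then show False using tower_unique[OF t, of d d' k l] A(2) kl by auto
      qed
    qed
  qed (use A(1) lev_sets in auto)
  also have "\<dots> = (\<Sum>k<N. prob (A k))" using A(1) by (intro sum.cong) (auto simp: prob_lev)
  finally show ?thesis .
qed

lemma prob_tower: "tower D N \<Longrightarrow> real N * prob D = prob (tower_set D N)"
  using prob_levels[of D N "\<lambda>_. D"] tower_sets[of D N] by (simp add: tower_set_def)

lemma prob_tower_le: "tower D N \<Longrightarrow> real N * prob D \<le> 1"
  by (simp add: prob_tower)

end

context aper_map
begin

text \<open>A greedy construction. Countably many sets, each disjoint from its next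
  \<open>N - 1\<close> translates, cover almost all points; they are added one by one, leaving out
  what is near an earlier marker. A point of the set under consideration is then selected or was
  already near a marker.\<close>

lemma marker_exists:
  "\<exists>B. tower B N \<and> (AE x in M. \<exists>j. \<bar>j\<bar> < int N \<and> P j x \<in> B)" if "N > 0"
proof -
  obtain E :: "nat \<Rightarrow> 'a set" where "(\<forall>i. E i \<in> sets M) \<and> sets M = sigma_sets (space M) (range E) \<and>
     (\<forall>x\<in>space M. \<forall>y\<in>space M. x \<noteq> y \<longrightarrow> (\<exists>i. x \<in> E i \<and> y \<notin> E i))"
    using countable_generator by (elim exE)
  then have Es: "\<And>i. E i \<in> sets M"
    and sep: "\<And>x y. x \<in> space M \<Longrightarrow> y \<in> space M \<Longrightarrow> x \<noteq> y \<Longrightarrow> \<exists>i. x \<in> E i \<and> y \<notin> E i"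
    by simp_all
  define J where "J = {1..<int N}"
  \<comment> \<open>The list \<open>\<phi>\<close> names for each \<open>j\<close> a generator that
    contains the point but not its \<open>j\<close>-th translate; hence no two points of
    \<open>A \<phi>\<close> are \<open>j\<close> steps apart.\<close>
  define A where "A \<phi> = {x \<in> space M. \<forall>j\<in>J. x \<in> E (\<phi> ! nat j) \<and> P j x \<notin> E (\<phi> ! nat j)}" for \<phi>
  have As: "A \<phi> \<in> sets M" for \<phi>
    unfolding A_def
  proof (rule sets.sets_Collect_finite_All)
    fix j
    let ?E = "E (\<phi> ! nat j)"
    have "{x \<in> space M. x \<in> ?E \<and> P j x \<notin> ?E} = ?E \<inter> {x \<in> space M. P j x \<in> space M - ?E}"
      using sets.sets_into_space[OF Es] by auto
    also have "\<dots> \<in> sets M" using Es by (intro sets.Int mp_vimage_sets[OF P_mp]) auto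
    finally show "{x \<in> space M. x \<in> ?E \<and> P j x \<notin> ?E} \<in> sets M" .
  qed (simp add: J_def)
  define near where "near C = (\<Union>j\<in>{-int N<..<int N}. {x \<in> space M. P j x \<in> C})" for C
  define B where "B = rec_nat {} (\<lambda>k C. C \<union> (A (from_nat k) - near C))"
  have B0: "B 0 = {}" and BS: "B (Suc k) = B k \<union> (A (from_nat k) - near (B k))" for k
    by (simp_all add: B_def)
  have Bs: "B k \<in> sets M" for k
  proof (induction k)
    case (Suc k)
    have "near (B k) \<in> sets M"
      unfolding near_def using Suc by (intro sets.finite_UN mp_vimage_sets[OF P_mp]) auto
    then show ?case using Suc As by (simp add: BS)
  qed (simp add: B0)
  have Bsp: "x \<in> space M" if "x \<in> B k" for x k using that Bs sets.sets_into_space by blast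
  have Bt: "P j x \<notin> B k" if "x \<in> B k" "j \<in> J" for x j k
    using that
  proof (induction k arbitrary: x j)
    case (Suc k)
    have x: "x \<in> space M" using Suc.prems Bsp by blast
    show ?case
    proof
      assume y: "P j x \<in> B (Suc k)"
      consider "x \<in> B k" "P j x \<in> B k" | "x \<in> B k" "P j x \<notin> near (B k)" | "x \<notin> near (B k)" "P j x \<in> B k"
        | "x \<in> A (from_nat k)" "P j x \<in> A (from_nat k)"
        using y Suc.prems by (auto simp: BS)
      then show False
      proof cases
        case 1
        then show ?thesis using Suc.IH Suc.prems by blast
      next
        case 2
        have "P (- j) (P j x) \<in> B k" using 2 x by simp
        moreover have "- j \<in> {- int N<..<int N}" using Suc.prems(2) by (auto simp: J_def)
        ultimately show ?thesis using 2 x P_space[OF x, of j] unfolding near_def by blast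
      next
        case 3
        then show ?thesis using x Suc.prems by (auto simp: near_def J_def)
      next
        case 4
        then show ?thesis using Suc.prems by (auto simp: A_def)
      qed
    qed
  qed (simp add: B0)
  have mono: "B k \<subseteq> B l" if "k \<le> l" for k l
    by (rule lift_Suc_mono_le[OF _ that]) (auto simp: BS)
  have "tower (\<Union>k. B k) N"
    unfolding tower_def
  proof (intro conjI ballI)
    fix d j assume d: "d \<in> (\<Union>k. B k)" and j: "j \<in> {1..<int N}"
    show "P j d \<notin> (\<Union>k. B k)"
    proof
      assume "P j d \<in> (\<Union>k. B k)"
      then obtain k l where "d \<in> B k" "P j d \<in> B l" using d by blast
      then have "d \<in> B (max k l)" "P j d \<in> B (max k l)" using mono by (meson max.cobounded1 max.cobounded2 subsetD)+
      then show False using Bt j by (auto simp: J_def)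
    qed
  qed (use Bs in auto)
  moreover have "AE x in M. \<exists>j. \<bar>j\<bar> < int N \<and> P j x \<in> (\<Union>k. B k)"
    using aper AE_space
  proof eventually_elim
    case (elim x)
    have "\<forall>j. \<exists>i. j \<in> J \<longrightarrow> x \<in> E i \<and> P j x \<notin> E i"
    proof
      fix j
      show "\<exists>i. j \<in> J \<longrightarrow> x \<in> E i \<and> P j x \<notin> E i"
      proof (cases "j \<in> J")
        case True
        then have "P j x \<noteq> x" using elim(1) by (auto simp: J_def)
        then show ?thesis using sep[of x "P j x"] elim(2) by auto
      qed simp
    qed
    from choice[OF this] obtain c where c: "\<And>j. j \<in> J \<Longrightarrow> x \<in> E (c j) \<and> P j x \<notin> E (c j)" by blast
    define \<phi> where "\<phi> = map (\<lambda>j. c (int j)) [0..<N]"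
    have "\<phi> ! nat j = c j" if "j \<in> J" for j using that by (auto simp: \<phi>_def J_def)
    then have xA: "x \<in> A \<phi>" using c elim(2) by (simp add: A_def)
    define k where "k = to_nat \<phi>"
    show ?case
    proof (cases "x \<in> near (B k)")
      case True
      then obtain j where "j \<in> {-int N<..<int N}" "P j x \<in> B k" by (auto simp: near_def)
      then show ?thesis by (intro exI[of _ j]) auto
    next
      case False
      then have "x \<in> B (Suc k)" using xA by (simp add: BS k_def)
      then have "P 0 x \<in> (\<Union>k. B k)" using elim(2) by auto
      then show ?thesis using \<open>N > 0\<close> by (intro exI[of _ 0]) auto
    qed
  qed
  ultimately show ?thesis by blast
qed

text \<open>Cut the intervals between consecutive markers into pieces of length \<open>N\<close>; with widely spaced
  markers the remainders are negligible.\<close>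

lemma Rokhlin:
  assumes N: "N > 0" and e: "\<epsilon> > 0"
  shows "\<exists>D. tower D N \<and> prob (space M - tower_set D N) < \<epsilon>"
proof -
  \<comment> \<open>Markers spaced by \<open>N'\<close> have measure at most \<open>1 / N'\<close>,
    and almost all points missed by the tower lie in fewer than \<open>N\<close> translates of the
    marker set.\<close>
  obtain N' :: nat where N': "real N' > real N / \<epsilon>" using reals_Archimedean2 by blast
  moreover have "real N / \<epsilon> > 0" using N e by simp
  ultimately have N'0: "N' > 0" using of_nat_0_less_iff[of N', where 'a=real] by linarith
  obtain B where B: "tower B N'" and hit: "AE x in M. \<exists>j. \<bar>j\<bar> < int N' \<and> P j x \<in> B"
    using marker_exists[OF N'0] by blast
  have Bs: "B \<in> sets M" using B by (rule tower_sets)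
  \<comment> \<open>The base consists of the points a multiple of \<open>N\<close> steps after the
    last marker that are followed by no marker during the next \<open>N - 1\<close> steps.\<close>
  define D where "D = {x \<in> space M. \<exists>m::nat. P (- int (m * N)) x \<in> B \<and>
    (\<forall>j\<in>{..<m * N}. P (- int j) x \<notin> B) \<and> (\<forall>i\<in>{1..<N}. P (int i) x \<notin> B)}"
  have PB: "{x \<in> space M. P k x \<in> B} \<in> sets M" for k by (rule mp_vimage_sets[OF P_mp Bs])
  have PB': "{x \<in> space M. P k x \<notin> B} \<in> sets M" for k
  proof -
    have "{x \<in> space M. P k x \<notin> B} = space M - {x \<in> space M. P k x \<in> B}" by auto
    then show ?thesis using PB by simp
  qed
  have Ds: "D \<in> sets M"
    unfolding D_def
    by (intro sets.sets_Collect_countable_Ex sets.sets_Collect_conj sets.sets_Collect_finite_All PB PB') auto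
  have "tower D N"
    unfolding tower_def
  proof (intro conjI ballI Ds)
    fix d k' assume d: "d \<in> D" and k': "k' \<in> {1..<int N}"
    define k where "k = nat k'"
    have k: "1 \<le> k" "k < N" "k' = int k" using k' by (auto simp: k_def)
    obtain m where ds: "d \<in> space M" and m: "P (- int (m * N)) d \<in> B"
      "\<forall>j\<in>{..<m * N}. P (- int j) d \<notin> B" "\<forall>i\<in>{1..<N}. P (int i) d \<notin> B"
      using d by (auto simp: D_def)
    show "P k' d \<notin> D"
    proof
      assume "P k' d \<in> D"
      then obtain m' where m': "P (- int (m' * N)) (P (int k) d) \<in> B"
        "\<forall>j\<in>{..<m' * N}. P (- int j) (P (int k) d) \<notin> B"
        using k(3) by (auto simp: D_def)
      have 1: "P (int k - int (m' * N)) d \<in> B"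
        using m'(1) P_add[OF ds, of "- int (m' * N)" "int k"] by simp
      have "P (- int (m * N + k)) (P (int k) d) = P (- int (m * N)) d"
        using P_add[OF ds, of "- int (m * N + k)" "int k"] by simp
      then have "m * N + k \<notin> {..<m' * N}" using m(1) m'(2) by metis
      then have "m' * N \<le> m * N + k" by simp
      then have "m' * N < (m + 1) * N" using k(2) by simp
      then have mm: "m' \<le> m" by (metis add.commute less_Suc_eq_le mult_less_cancel2 plus_1_eq_Suc)
      show False
      proof (cases "m' = 0")
        case True
        then show False using 1 m(3) k by simp
      next
        case False
        then have "N \<le> m' * N" by simp
        then have "m' * N - k < m * N" "int k - int (m' * N) = - int (m' * N - k)"
          using k mm mult_le_mono1[OF mm, of N] N by linarith+
        then show False using 1 m(2) by (metis lessThan_iff)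
      qed
    qed
  qed
  moreover have "prob (space M - tower_set D N) < \<epsilon>"
  proof -
    let ?Z = "\<Union>i\<in>{1..<N}. {x \<in> space M. P (int i) x \<in> B}"
    have Zs: "?Z \<in> sets M" using PB by (intro sets.finite_UN) auto
    \<comment> \<open>A marker is only known to lie within distance \<open>N'\<close> on one side or
      the other; applying this to \<open>P (- int N') x\<close> puts one strictly in the past of
      \<open>x\<close>.\<close>
    have sh: "AE x in M. \<exists>j. \<bar>j\<bar> < int N' \<and> P j (P (- int N') x) \<in> B"
      using AE_comp_mp[OF P_mp hit] .
    have "AE x in M. x \<in> space M - tower_set D N \<longrightarrow> x \<in> ?Z"
      using sh AE_space
    proof eventually_elim
      case (elim x)
      then obtain j where j: "\<bar>j\<bar> < int N'" "P j (P (- int N') x) \<in> B" by blast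
      moreover have "- int (nat (int N' - j)) = j + - int N'" using j(1) by simp
      ultimately have "P (- int (nat (int N' - j))) x \<in> B"
        using P_add[OF elim(2), of j "- int N'"] by metis
      then have ex: "\<exists>b. P (- int b) x \<in> B" by blast
      define b where "b = (LEAST b. P (- int b) x \<in> B)"
      have b: "P (- int b) x \<in> B" unfolding b_def using ex by (rule LeastI_ex)
      have bmin: "P (- int j) x \<notin> B" if "j < b" for j
        using not_less_Least[of j "\<lambda>b. P (- int b) x \<in> B"] that by (simp add: b_def)
      define k m d where "k = b mod N" and "m = b div N" and "d = P (- int k) x"
      have ds: "d \<in> space M" using elim(2) by (simp add: d_def)
      have Pd: "P i d = P (i - int k) x" for i
        using P_add[OF elim(2), of i "- int k"] by (simp add: d_def)
      have bk: "b = m * N + k" "k < N" using N by (simp_all add: k_def m_def)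
      have 1: "P (- int (m * N)) d \<in> B" using b by (simp add: Pd bk)
      have 2: "P (- int j) d \<notin> B" if "j \<in> {..<m * N}" for j
        using bmin[of "j + k"] that by (simp add: Pd bk)
      show ?case
      proof (cases "\<forall>i\<in>{1..<N}. P (int i) d \<notin> B")
        case True
        then have "d \<in> D" unfolding D_def using 1 2 ds by blast
        moreover have "x = P (int k) d" using elim(2) by (simp add: d_def)
        ultimately have "x \<in> tower_set D N"
          using tower_set_iff[OF \<open>tower D N\<close>] bk(2) by blast
        then show ?thesis by simp
      next
        case False
        then obtain i where i: "1 \<le> i" "i < N" "P (int i) d \<in> B" by auto
        have "k < i"
        proof (rule ccontr)
          assume "\<not> k < i"
          then have "P (- int (k - i)) x \<in> B" "k - i < b" using i bk by (auto simp: Pd of_nat_diff)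
          then show False using bmin by blast
        qed
        then have "P (int (i - k)) x \<in> B" "i - k \<in> {1..<N}" using i by (auto simp: Pd of_nat_diff)
        then show ?thesis using elim(2) by blast
      qed
    qed
    then have "prob (space M - tower_set D N) \<le> prob ?Z"
      using Zs tower_set_sets[OF Ds] by (intro finite_measure_mono_AE) auto
    also have "\<dots> \<le> (\<Sum>i\<in>{1..<N}. prob {x \<in> space M. P (int i) x \<in> B})"
      using PB by (intro finite_measure_subadditive_finite) auto
    also have "\<dots> = real (N - 1) * prob B" using mp_measure(2)[OF P_mp Bs] by simp
    also have "\<dots> \<le> real N * prob B" by (intro mult_right_mono) auto
    also have "\<dots> < \<epsilon>"
    proof -
      have "real N' * prob B \<le> 1" using prob_tower_le[OF B] .
      then have "prob B \<le> 1 / real N'" using N'0 by (simp add: field_simps)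
      then have "real N * prob B \<le> real N * (1 / real N')" by (intro mult_left_mono) auto
      also have "\<dots> < \<epsilon>" using N' N'0 e by (simp add: field_simps)
      finally show ?thesis .
    qed
    finally show ?thesis .
  qed
  ultimately show ?thesis by blast
qed

end

section \<open>Permuting the levels of a tower\<close>

text \<open>What conjugation by the \<open>j\<close>-th power of the map does to a permutation of
  the levels.\<close>

definition shift_perm :: "nat \<Rightarrow> (nat \<Rightarrow> nat) \<Rightarrow> nat \<Rightarrow> nat" where
  "shift_perm j \<sigma> k = (if j \<le> k then \<sigma> (k - j) + j else k)"

lemma shift_perm_permutes:
  assumes \<sigma>: "\<sigma> permutes {..<n}"
  shows "shift_perm j \<sigma> permutes {j..<n + j}"
proof (rule bij_imp_permutes)
  have inj: "inj \<sigma>" using \<sigma> by (rule permutes_inj)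
  have lt: "\<sigma> k < n \<longleftrightarrow> k < n" for k using permutes_in_image[OF \<sigma>, of k] by simp
  have "inj_on (shift_perm j \<sigma>) {j..<n + j}"
  proof (rule inj_onI)
    fix x y assume "x \<in> {j..<n + j}" "y \<in> {j..<n + j}" "shift_perm j \<sigma> x = shift_perm j \<sigma> y"
    then have "\<sigma> (x - j) = \<sigma> (y - j)" "j \<le> x" "j \<le> y" by (auto simp: shift_perm_def)
    then show "x = y" using injD[OF inj] by fastforce
  qed
  moreover have "shift_perm j \<sigma> ` {j..<n + j} \<subseteq> {j..<n + j}"
  proof
    fix y assume "y \<in> shift_perm j \<sigma> ` {j..<n + j}"
    then obtain x where x: "j \<le> x" "x < n + j" "y = \<sigma> (x - j) + j" by (auto simp: shift_perm_def)
    then have "\<sigma> (x - j) < n" using lt[of "x - j"] by linarith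
    then show "y \<in> {j..<n + j}" using x(3) by simp
  qed
  ultimately show "bij_betw (shift_perm j \<sigma>) {j..<n + j} {j..<n + j}"
    unfolding bij_betw_def using endo_inj_surj[OF finite_atLeastLessThan] by blast
  fix x assume "x \<notin> {j..<n + j}"
  then have "j \<le> x \<Longrightarrow> \<not> x - j < n" "j \<le> x \<or> x < j" by auto
  then show "shift_perm j \<sigma> x = x"
    using \<sigma> by (auto simp: shift_perm_def permutes_def)
qed

context mp_map
begin

definition tower_fun :: "'a set \<Rightarrow> nat \<Rightarrow> ('a \<Rightarrow> nat \<Rightarrow> nat) \<Rightarrow> bool" where
  "tower_fun D N \<rho> \<longleftrightarrow> (\<forall>d\<in>D. \<rho> d permutes {..<N}) \<and> (\<forall>k<N. \<forall>j. {d \<in> D. \<rho> d k = j} \<in> sets M)"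

text \<open>As the levels of a tower are disjoint, the least \<open>k\<close> is the level of
  \<open>x\<close>; the base point is kept while the level is permuted. Restriction to the space
  makes the map extensional, as membership in \<open>mp_bijections\<close> requires.\<close>

definition act :: "'a set \<Rightarrow> nat \<Rightarrow> ('a \<Rightarrow> nat \<Rightarrow> nat) \<Rightarrow> 'a \<Rightarrow> 'a" where
  "act D N \<rho> = (\<lambda>x\<in>space M. if x \<in> tower_set D N
     then let k = (LEAST k. x \<in> lev D (int k)); d = P (- int k) x in P (int (\<rho> d k)) d else x)"

context
  fixes D N
  assumes t: "tower D N"
begin

lemma act_on:
  assumes d: "d \<in> D" and k: "k < N"
  shows "act D N \<rho> (P (int k) d) = P (int (\<rho> d k)) d"
proof -
  have ds: "d \<in> space M" using tower_space[OF t d] .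
  have "(LEAST k'. P (int k) d \<in> lev D (int k')) = k"
  proof (rule Least_equality)
    show "P (int k) d \<in> lev D (int k)" using d ds by (simp add: lev_def)
    fix k' assume "P (int k) d \<in> lev D (int k')"
    then obtain d' where "d' \<in> D" "P (int k) d = P (int k') d'" using lev_E by blast
    then show "k \<le> k'" using tower_unique[OF t d, of d' k k'] k by fastforce
  qed
  moreover have "P (int k) d \<in> tower_set D N" using tower_set_iff[OF t] d k by blast
  ultimately show ?thesis using ds by (simp add: act_def)
qed

lemma act_off: "x \<in> space M \<Longrightarrow> x \<notin> tower_set D N \<Longrightarrow> act D N \<rho> x = x"
  by (simp add: act_def)

lemma tower_cases:
  assumes "x \<in> space M"
  obtains (off) "x \<notin> tower_set D N" | (on) d k where "d \<in> D" "k < N" "x = P (int k) d"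
  using assms tower_set_iff[OF t] by blast

lemma tower_fun_lt: "tower_fun D N \<rho> \<Longrightarrow> d \<in> D \<Longrightarrow> \<rho> d k < N \<longleftrightarrow> k < N"
  using permutes_in_image[of "\<rho> d" "{..<N}" k] by (auto simp: tower_fun_def)

lemma act_comp:
  assumes \<rho>': "tower_fun D N \<rho>'" and x: "x \<in> space M"
  shows "act D N \<rho> (act D N \<rho>' x) = act D N (\<lambda>d. \<rho> d \<circ> \<rho>' d) x"
using x proof (cases rule: tower_cases)
  case off
  then show ?thesis using act_off x by simp
next
  case (on d k)
  then show ?thesis using act_on[of d] tower_fun_lt[OF \<rho>', of d k] by simp
qed

lemma act_cong:
  assumes "\<And>d k. d \<in> D \<Longrightarrow> k < N \<Longrightarrow> \<rho> d k = \<rho>' d k"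
  shows "act D N \<rho> = act D N \<rho>'"
proof
  fix x
  show "act D N \<rho> x = act D N \<rho>' x"
  proof (cases "x \<in> space M")
    case True
    then show ?thesis
    proof (cases rule: tower_cases)
      case off
      then show ?thesis using True act_off by simp
    next
      case (on d k)
      then show ?thesis using act_on[of d k] assms by simp
    qed
  qed (simp add: act_def)
qed

lemma tower_fun_comp:
  assumes \<rho>: "tower_fun D N \<rho>" and \<rho>': "tower_fun D N \<rho>'"
  shows "tower_fun D N (\<lambda>d. \<rho> d \<circ> \<rho>' d)"
  unfolding tower_fun_def
proof (intro conjI ballI allI impI)
  show "\<rho> d \<circ> \<rho>' d permutes {..<N}" if "d \<in> D" for d
    using that \<rho> \<rho>' by (auto simp: tower_fun_def intro: permutes_compose)
  fix k j assume k: "k < N"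
  have "{d \<in> D. (\<rho> d \<circ> \<rho>' d) k = j} = (\<Union>l<N. {d \<in> D. \<rho>' d k = l} \<inter> {d \<in> D. \<rho> d l = j})"
    using tower_fun_lt[OF \<rho>'] k by auto
  also have "\<dots> \<in> sets M" using \<rho> \<rho>' k by (intro sets.finite_UN sets.Int) (auto simp: tower_fun_def)
  finally show "{d \<in> D. (\<rho> d \<circ> \<rho>' d) k = j} \<in> sets M" .
qed

lemma tower_fun_inv:
  assumes \<rho>: "tower_fun D N \<rho>"
  shows "tower_fun D N (\<lambda>d. inv_into UNIV (\<rho> d))"
  unfolding tower_fun_def
proof (intro conjI ballI allI impI)
  have p: "\<rho> d permutes {..<N}" if "d \<in> D" for d using that \<rho> by (simp add: tower_fun_def)
  show "inv_into UNIV (\<rho> d) permutes {..<N}" if "d \<in> D" for d using permutes_inv[OF p[OF that]] .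
  fix k j assume k: "k < N"
  show "{d \<in> D. inv_into UNIV (\<rho> d) k = j} \<in> sets M"
  proof (cases "j < N")
    case True
    have "{d \<in> D. inv_into UNIV (\<rho> d) k = j} = {d \<in> D. \<rho> d j = k}"
      using permutes_inv_eq[OF p] by blast
    then show ?thesis using \<rho> True by (simp add: tower_fun_def)
  next
    case False
    have "inv_into UNIV (\<rho> d) k \<noteq> j" if "d \<in> D" for d
      using permutes_in_image[OF permutes_inv[OF p[OF that]], of k] k False by auto
    then have "{d \<in> D. inv_into UNIV (\<rho> d) k = j} = {}" by blast
    then show ?thesis by (simp only: sets.empty_sets)
  qed
qed

lemma tower_fun_pattern:
  assumes pat: "\<And>p. {d \<in> D. pat d = p} \<in> sets M" "finite (pat ` D)"
    and perm: "\<And>d. d \<in> D \<Longrightarrow> F (pat d) permutes {..<N}"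
  shows "tower_fun D N (\<lambda>d. F (pat d))"
  unfolding tower_fun_def
proof (intro conjI ballI allI impI perm)
  fix k j
  have "{d \<in> D. F (pat d) k = j} = (\<Union>p\<in>{p \<in> pat ` D. F p k = j}. {d \<in> D. pat d = p})" by auto
  also have "\<dots> \<in> sets M" using pat by (intro sets.finite_UN) auto
  finally show "{d \<in> D. F (pat d) k = j} \<in> sets M" .
qed

lemma tower_fun_id: "tower_fun D N (\<lambda>d. id)"
proof -
  have "{d \<in> D. id k = j} = (if k = j then D else {})" for k j :: nat by auto
  then show ?thesis using tower_sets[OF t] by (auto simp: tower_fun_def permutes_id)
qed

lemma act_id:
  assumes x: "x \<in> space M"
  shows "act D N (\<lambda>d. id) x = x"
  using x
proof (cases rule: tower_cases)
  case off
  then show ?thesis using act_off x by blast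
next
  case (on d k)
  then show ?thesis using act_on[of d k "\<lambda>d. id"] by simp
qed

text \<open>The inverse acts by the inverse permutations, and \<open>act\<close> equals the power
  \<open>i\<close> of \<open>f\<close> on the set \<open>A i\<close> of points raised by
  \<open>i\<close> levels (points outside the tower belong to \<open>A 0\<close>), so the piecewise
  criterion applies.\<close>

lemma act_full:
  assumes \<rho>: "tower_fun D N \<rho>"
  shows "act D N \<rho> \<in> full_mp M f"
proof -
  have p: "\<rho> d permutes {..<N}" if "d \<in> D" for d using that \<rho> by (simp add: tower_fun_def)
  let ?h = "act D N \<rho>"
  have sp: "act D N \<rho>' x \<in> space M" if "x \<in> space M" for \<rho>' x
    using that tower_space[OF t] by (auto simp: act_def Let_def)
  have i1: "act D N (\<lambda>d. inv_into UNIV (\<rho> d)) (?h x) = x" if "x \<in> space M" for x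
    using act_comp[OF \<rho> that, of "\<lambda>d. inv_into UNIV (\<rho> d)"] act_id[OF that]
      act_cong[of "\<lambda>d. inv_into UNIV (\<rho> d) \<circ> \<rho> d" "\<lambda>d. id"] permutes_inv_o(2)[OF p] by simp
  have i2: "?h (act D N (\<lambda>d. inv_into UNIV (\<rho> d)) x) = x" if "x \<in> space M" for x
    using act_comp[OF tower_fun_inv[OF \<rho>] that, of \<rho>] act_id[OF that]
      act_cong[of "\<lambda>d. \<rho> d \<circ> inv_into UNIV (\<rho> d)" "\<lambda>d. id"] permutes_inv_o(1)[OF p] by simp
  have b: "bij_betw ?h (space M) (space M)"
    by (rule bij_betwI[where g = "act D N (\<lambda>d. inv_into UNIV (\<rho> d))"]) (use sp i1 i2 in auto)
  define A where "A i = (\<Union>k<N. \<Union>j<N. if int j - int k = i then lev {d \<in> D. \<rho> d k = j} (int k) else {})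
      \<union> (if i = 0 then space M - tower_set D N else {})" for i :: int
  have As: "A i \<in> sets M" for i
    unfolding A_def using \<rho> tower_set_sets[OF tower_sets[OF t]]
    by (intro sets.Un sets.finite_UN) (auto simp: tower_fun_def intro!: lev_sets)
  have eq: "\<forall>x\<in>A i. ?h x = P i x" for i
  proof
    fix x assume "x \<in> A i"
    then consider k j where "k < N" "int j - int k = i" "x \<in> lev {d \<in> D. \<rho> d k = j} (int k)"
      | "i = 0" "x \<in> space M" "x \<notin> tower_set D N"
      by (auto simp: A_def split: if_splits)
    then show "?h x = P i x"
    proof cases
      case 1
      then obtain d where d: "d \<in> D" "\<rho> d k = j" "x = P (int k) d" "d \<in> space M" using lev_E by blast
      then have "?h x = P (int j) d" using act_on[of d k \<rho>] 1 by simp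
      also have "\<dots> = P i x" using d 1(2) by (auto simp flip: P_add)
      finally show ?thesis .
    next
      case 2
      then show ?thesis using act_off by simp
    qed
  qed
  have cov: "space M \<subseteq> (\<Union>i. A i)"
  proof
    fix x assume x: "x \<in> space M"
    then show "x \<in> (\<Union>i. A i)"
    proof (cases rule: tower_cases)
      case off
      then have "x \<in> A 0" using x by (simp add: A_def)
      then show ?thesis by blast
    next
      case (on d k)
      have "x \<in> lev {d' \<in> D. \<rho> d' k = \<rho> d k} (int k)"
        using on tower_space[OF t on(1)] by (simp add: lev_def)
      moreover have "\<rho> d k < N" using tower_fun_lt[OF \<rho> on(1)] on(2) by simp
      ultimately have "x \<in> A (int (\<rho> d k) - int k)" using on(2) by (auto simp: A_def)
      then show ?thesis by blast
    qed
  qed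
  have "?h \<in> mp_bijections M"
    by (rule mp_piecewise_int[OF P_mp As eq cov b]) (simp add: act_def)
  moreover have "AE x in M. \<exists>k. ?h x = P k x"
    using AE_space by eventually_elim (use cov eq in blast)
  ultimately show ?thesis by (simp add: full_mp_iff)
qed

lemma act_mp: "tower_fun D N \<rho> \<Longrightarrow> act D N \<rho> \<in> mp_bijections M"
  by (rule full_mp_mp[OF act_full])

lemma act_mult:
  assumes \<rho>: "tower_fun D N \<rho>" and \<rho>': "tower_fun D N \<rho>'"
  shows "act D N \<rho> \<otimes>\<^bsub>mp_group M\<^esub> act D N \<rho>' = act D N (\<lambda>d. \<rho> d \<circ> \<rho>' d)"
proof (rule mp_eqI[where M = M])
  have m: "act D N \<rho> \<in> mp_bijections M" "act D N \<rho>' \<in> mp_bijections M"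
    using act_mp assms by auto
  show "act D N \<rho> \<otimes>\<^bsub>mp_group M\<^esub> act D N \<rho>' \<in> mp_bijections M" using m by (rule mp_closed)
  show "act D N (\<lambda>d. \<rho> d \<circ> \<rho>' d) \<in> mp_bijections M"
    by (rule act_mp[OF tower_fun_comp[OF assms]])
  show "(act D N \<rho> \<otimes>\<^bsub>mp_group M\<^esub> act D N \<rho>') x = act D N (\<lambda>d. \<rho> d \<circ> \<rho>' d) x"
    if "x \<in> space M" for x
    using mp_mult[OF m that] act_comp[OF \<rho>' that] by simp
qed

lemma act_one: "act D N (\<lambda>d. id) = \<one>\<^bsub>mp_group M\<^esub>"
  by (rule mp_eqI[OF act_mp[OF tower_fun_id] mp_closed(3)]) (simp add: act_id one_mp_group)

lemma act_inv:
  assumes \<rho>: "tower_fun D N \<rho>"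
  shows "inv\<^bsub>mp_group M\<^esub> (act D N \<rho>) = act D N (\<lambda>d. inv_into UNIV (\<rho> d))"
proof (rule G.inv_equality)
  have p: "\<rho> d permutes {..<N}" if "d \<in> D" for d using that \<rho> by (simp add: tower_fun_def)
  have "act D N (\<lambda>d. inv_into UNIV (\<rho> d)) \<otimes>\<^bsub>mp_group M\<^esub> act D N \<rho> = act D N (\<lambda>d. inv_into UNIV (\<rho> d) \<circ> \<rho> d)"
    by (rule act_mult[OF tower_fun_inv[OF \<rho>] \<rho>])
  also have "\<dots> = act D N (\<lambda>d. id)"
    by (rule act_cong) (simp add: permutes_inverses(2)[OF p])
  finally show "act D N (\<lambda>d. inv_into UNIV (\<rho> d)) \<otimes>\<^bsub>mp_group M\<^esub> act D N \<rho> = \<one>\<^bsub>mp_group M\<^esub>"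
    by (simp only: act_one)
qed (use \<rho> in \<open>simp_all add: act_mp tower_fun_inv\<close>)

text \<open>The room \<open>n + j \<le> N\<close> keeps the moved levels inside the tower. A point
  that leaves or enters the tower under the translation sits at a level that neither side
  moves.\<close>

lemma act_shift:
  assumes \<rho>: "tower_fun D N \<rho>" and supp: "\<And>d. d \<in> D \<Longrightarrow> \<rho> d permutes {..<n}" and n: "n + j \<le> N"
  shows "tower_fun D N (\<lambda>d. shift_perm j (\<rho> d))"
    "P (int j) \<otimes>\<^bsub>mp_group M\<^esub> act D N \<rho> \<otimes>\<^bsub>mp_group M\<^esub> P (- int j) = act D N (\<lambda>d. shift_perm j (\<rho> d))"
proof -
  have "{d \<in> D. shift_perm j (\<rho> d) k = i} \<in> sets M" if "k < N" for k i
  proof -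
    have "{d \<in> D. shift_perm j (\<rho> d) k = i} =
        (if j \<le> k then if j \<le> i then {d \<in> D. \<rho> d (k - j) = i - j} else {} else if i = k then D else {})"
      by (auto simp: shift_perm_def)
    then show ?thesis using \<rho> that tower_sets[OF t] by (auto simp: tower_fun_def)
  qed
  moreover have "shift_perm j (\<rho> d) permutes {..<N}" if "d \<in> D" for d
    by (rule permutes_subset[OF shift_perm_permutes[OF supp[OF that]]]) (use n in auto)
  ultimately show tf: "tower_fun D N (\<lambda>d. shift_perm j (\<rho> d))" by (simp add: tower_fun_def)
  have fix_ge: "\<rho> d k = k" if "d \<in> D" "k \<ge> n" for d k
    using supp[OF that(1)] that(2) by (auto simp: permutes_def)
  show "P (int j) \<otimes>\<^bsub>mp_group M\<^esub> act D N \<rho> \<otimes>\<^bsub>mp_group M\<^esub> P (- int j) = act D N (\<lambda>d. shift_perm j (\<rho> d))"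
  proof (rule mp_eqI[where M = M])
    fix x assume x: "x \<in> space M"
    let ?y = "P (- int j) x"
    have y: "?y \<in> space M" "P (int j) ?y = x" using x by auto
    have lhs: "(P (int j) \<otimes>\<^bsub>mp_group M\<^esub> act D N \<rho> \<otimes>\<^bsub>mp_group M\<^esub> P (- int j)) x = P (int j) (act D N \<rho> ?y)"
      using x y act_mp[OF \<rho>] by (simp add: mp_mult mp_closed)
    show "(P (int j) \<otimes>\<^bsub>mp_group M\<^esub> act D N \<rho> \<otimes>\<^bsub>mp_group M\<^esub> P (- int j)) x = act D N (\<lambda>d. shift_perm j (\<rho> d)) x"
      unfolding lhs using y(1)
    proof (cases rule: tower_cases)
      case (on d k)
      have ds: "d \<in> space M" using tower_space[OF t on(1)] .
      have xk: "x = P (int (k + j)) d" using y(2) on(3) P_add[OF ds, of "int j" "int k"] by (simp add: add.commute)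
      have l: "P (int j) (act D N \<rho> ?y) = P (int (\<rho> d k + j)) d"
        using act_on[OF on(1,2)] on(3) P_add[OF ds, of "int j" "int (\<rho> d k)"] by (simp add: add.commute)
      show "P (int j) (act D N \<rho> ?y) = act D N (\<lambda>d. shift_perm j (\<rho> d)) x"
      proof (cases "k + j < N")
        case True
        then show ?thesis using l act_on[OF on(1) True] xk by (simp add: shift_perm_def)
      next
        case False
        then have "\<rho> d k = k" using fix_ge[OF on(1)] n by simp
        then have l': "P (int j) (act D N \<rho> ?y) = x" using l xk by simp
        have "act D N (\<lambda>d. shift_perm j (\<rho> d)) x = x"
        using x proof (cases rule: tower_cases)
          case off
          then show ?thesis using act_off x by blast
        next
          case (on d' k')
          \<comment> \<open>A level \<open>k' \<ge> j\<close> would give the translated point a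
            second pair of coordinates.\<close>
          have "k' < j"
          proof (rule ccontr)
            assume "\<not> k' < j"
            then have "?y = P (int (k' - j)) d'"
              using P_add[of d' "- int j" "int k'"] on tower_space[OF t on(1)] by (simp add: of_nat_diff)
            then have "k = k' - j"
              using tower_unique[OF t \<open>d \<in> D\<close> on(1), of k "k' - j"] \<open>k < N\<close> on(2) \<open>?y = P (int k) d\<close> by simp
            then show False using False on(2) \<open>\<not> k' < j\<close> by simp
          qed
          then show ?thesis using act_on[OF on(1,2)] on(3) by (simp add: shift_perm_def)
        qed
        then show ?thesis using l' by simp
      qed
    next
      case off
      have l: "P (int j) (act D N \<rho> ?y) = x" using act_off[OF y(1) off] y(2) by simp
      have "act D N (\<lambda>d. shift_perm j (\<rho> d)) x = x"
      using x proof (cases rule: tower_cases)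
        case off
        then show ?thesis using act_off x by blast
      next
        case (on d' k')
        have "k' < j"
        proof (rule ccontr)
          assume "\<not> k' < j"
          then have "?y = P (int (k' - j)) d'"
            using P_add[of d' "- int j" "int k'"] on tower_space[OF t on(1)] by (simp add: of_nat_diff)
          then have "?y \<in> tower_set D N" using tower_set_iff[OF t] on(1,2) less_imp_diff_less by blast
          then show False using off by simp
        qed
        then show ?thesis using act_on[OF on(1,2)] on(3) by (simp add: shift_perm_def)
      qed
      then show "P (int j) (act D N \<rho> ?y) = act D N (\<lambda>d. shift_perm j (\<rho> d)) x" using l by simp
    qed
  qed (use tf act_mp \<rho> in \<open>auto simp: mp_closed\<close>)
qed

text \<open>Fubini for the counting measure on levels: a bound on the number of bad levels over each
  base point, integrated over \<open>D\<close>, bounds the measure of the bad set.\<close>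

lemma prob_tower_count:
  assumes Q: "\<And>k. k < N \<Longrightarrow> {d \<in> D. Q d k} \<in> sets M"
    and c: "\<And>d. d \<in> D \<Longrightarrow> real (card {k \<in> {..<N}. Q d k}) \<le> c"
  shows "(\<Union>k<N. lev {d \<in> D. Q d k} (int k)) \<in> sets M"
    "prob (\<Union>k<N. lev {d \<in> D. Q d k} (int k)) \<le> c * prob D"
proof -
  let ?A = "\<lambda>k. {d \<in> D. Q d k}"
  show "(\<Union>k<N. lev (?A k) (int k)) \<in> sets M"
    using Q lev_sets by (intro sets.finite_UN) auto
  have Ds: "D \<in> sets M" by (rule tower_sets[OF t])
  have "prob (\<Union>k<N. lev (?A k) (int k)) = (\<Sum>k<N. prob (?A k))"
    by (rule prob_levels[OF t]) (use Q in auto)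
  also have "\<dots> = (\<Sum>k<N. integral\<^sup>L M (indicator (?A k)))"
    using Q by (intro sum.cong) (auto simp: integral_indicator)
  also have "\<dots> = integral\<^sup>L M (\<lambda>x. \<Sum>k<N. indicator (?A k) x)"
    using Q by (intro Bochner_Integration.integral_sum[symmetric] integrable_real_indicator) (auto simp: emeasure_eq_measure)
  also have "\<dots> \<le> integral\<^sup>L M (\<lambda>x. c * indicator D x)"
  proof (rule integral_mono)
    show "integrable M (\<lambda>x. \<Sum>k<N. indicator (?A k) x :: real)"
      using Q by (intro Bochner_Integration.integrable_sum integrable_real_indicator) (auto simp: emeasure_eq_measure)
    show "integrable M (\<lambda>x. c * indicator D x)"
      using Ds by (intro integrable_mult_right integrable_real_indicator) (auto simp: emeasure_eq_measure)
    fix x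
    have "(\<Sum>k<N. indicator (?A k) x :: real) = real (card {k \<in> {..<N}. Q x k})" if "x \<in> D"
    proof -
      have "(\<Sum>k<N. indicator (?A k) x :: real) = (\<Sum>k<N. if Q x k then 1 else 0)"
        using that by (intro sum.cong) (auto simp: indicator_def)
      also have "\<dots> = real (card ({..<N} \<inter> {k. Q x k}))" by (simp add: sum.If_cases)
      also have "{..<N} \<inter> {k. Q x k} = {k \<in> {..<N}. Q x k}" by auto
      finally show ?thesis .
    qed
    then show "(\<Sum>k<N. indicator (?A k) x) \<le> c * indicator D x"
      using c[of x] by (cases "x \<in> D") auto
  qed
  also have "\<dots> = c * prob D" using Ds by (simp add: integral_indicator)
  finally show "prob (\<Union>k<N. lev (?A k) (int k)) \<le> c * prob D" .
qed

end

end

section \<open>Finite permutations: even permutations, blocks, rearrangement, coding, word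
  paths\<close>

section \<open>Consecutive three-cycles\<close>

text \<open>The direction, from \<open>j + 1\<close> to \<open>j\<close> to \<open>j + 2\<close> and
  back, is the one in which the commutators of the coding cycles come out.\<close>

definition three_cyc :: "nat \<Rightarrow> nat \<Rightarrow> nat" where
  "three_cyc j k = (if k = j then j + 2 else if k = j + 2 then j + 1 else if k = j + 1 then j else k)"

text \<open>The even permutations of \<open>{..<n}\<close>, built up from three-cycles of
  neighbouring points one factor at a time, so that closure arguments go by induction.\<close>

inductive_set consec :: "nat \<Rightarrow> (nat \<Rightarrow> nat) set" for n where
  id: "id \<in> consec n"
| step: "\<lbrakk>h \<in> consec n; j + 2 < n\<rbrakk> \<Longrightarrow> three_cyc j \<circ> h \<in> consec n"

lemma three_cyc_permutes: "three_cyc j permutes {j..<j + 3}"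
proof (rule bij_imp_permutes)
  show "bij_betw (three_cyc j) {j..<j + 3} {j..<j + 3}"
    by (rule bij_betwI[where g = "three_cyc j \<circ> three_cyc j"]) (auto simp: three_cyc_def)
qed (auto simp: three_cyc_def)

lemma consec_comp: "g \<in> consec n \<Longrightarrow> h \<in> consec n \<Longrightarrow> g \<circ> h \<in> consec n"
  by (induction rule: consec.induct) (auto simp: o_assoc[symmetric] intro: consec.intros)

lemma consec_permutes: "h \<in> consec n \<Longrightarrow> h permutes {..<n}"
proof (induction rule: consec.induct)
  case (step h j)
  have "three_cyc j permutes {..<n}"
    by (rule permutes_subset[OF three_cyc_permutes]) (use step in auto)
  with step.IH show ?case by (rule permutes_compose)
qed (rule permutes_id)

lemma consec_mono: "h \<in> consec m \<Longrightarrow> m \<le> n \<Longrightarrow> h \<in> consec n"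
  by (induction rule: consec.induct) (auto intro: consec.intros)

lemma consec_move:
  assumes "2 \<le> m" "i \<le> m"
  shows "\<exists>h\<in>consec (Suc m). h m = i"
proof -
  have "\<exists>h\<in>consec (Suc m). h m = m - d" if "d \<le> m" for d
    using that
  proof (induction d)
    case 0
    then show ?case using consec.id by (intro bexI[of _ id]) auto
  next
    case (Suc d)
    then obtain h where h: "h \<in> consec (Suc m)" "h m = m - d" by auto
    \<comment> \<open>In general \<open>m - d\<close> is the top point \<open>j + 2\<close> of the
      cycle. Truncated subtraction covers the last move: from the point 1 the cycle at
      \<open>j = 0\<close> leads to 0.\<close>
    define j where "j = m - d - 2"
    have "j + 2 < Suc m" "three_cyc j (m - d) = m - Suc d"
      using Suc.prems assms(1) by (auto simp: j_def three_cyc_def)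
    then show ?case using consec.step[OF h(1), of j] h(2) by (intro bexI[of _ "three_cyc j \<circ> h"]) auto
  qed
  from this[of "m - i"] show ?thesis using assms(2) by simp
qed

text \<open>Commutators give no odd permutations, hence the two exceptional points.\<close>

lemma consec_approx:
  assumes \<sigma>: "\<sigma> permutes {..<n}"
  shows "\<exists>h\<in>consec n. \<forall>k\<ge>2. h k = \<sigma> k"
proof -
  have "\<exists>h\<in>consec n. \<exists>\<tau>. \<tau> permutes {..<2} \<and> \<sigma> = h \<circ> \<tau>"
    using \<sigma>
  proof (induction n arbitrary: \<sigma>)
    case 0
    then have "\<sigma> permutes {..<2}" by (rule permutes_subset) auto
    then show ?case using consec.id by (intro bexI[of _ id]) auto
  next
    case (Suc m)
    show ?case
    proof (cases "2 \<le> m")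
      case False
      then have "\<sigma> permutes {..<2}" using Suc.prems by (elim permutes_subset) auto
      then show ?thesis using consec.id by (intro bexI[of _ id]) auto
    next
      case True
      have "\<sigma> m \<le> m" using permutes_in_image[OF Suc.prems, of m] by simp
      then obtain h where h: "h \<in> consec (Suc m)" "h m = \<sigma> m" using consec_move True by blast
      have hp: "h permutes {..<Suc m}" using consec_permutes[OF h(1)] .
      \<comment> \<open>\<open>h\<close> brings the top point to its place, so the remaining factor
        fixes \<open>m\<close> and permutes one point less.\<close>
      let ?\<tau> = "inv_into UNIV h \<circ> \<sigma>"
      have "?\<tau> permutes {..<Suc m}" using permutes_compose[OF Suc.prems permutes_inv[OF hp]] .
      moreover have "?\<tau> x = x" if "x \<in> {..<Suc m} - {..<m}" for x
      proof -
        have "x = m" using that by auto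
        then show ?thesis using h(2) permutes_inverses(2)[OF hp, of m] by simp
      qed
      ultimately have "?\<tau> permutes {..<m}" by (rule permutes_superset)
      from Suc.IH[OF this] obtain h' \<tau>' where h': "h' \<in> consec m" "\<tau>' permutes {..<2}" "?\<tau> = h' \<circ> \<tau>'"
        by blast
      have "\<sigma> = h \<circ> ?\<tau>" using permutes_inverses(1)[OF hp] by (auto simp: fun_eq_iff)
      then have "\<sigma> = (h \<circ> h') \<circ> \<tau>'" using h'(3) by (simp add: o_assoc)
      moreover have "h \<circ> h' \<in> consec (Suc m)"
        using h(1) h'(1) by (intro consec_comp) (auto intro: consec_mono)
      ultimately show ?thesis using h'(2) by blast
    qed
  qed
  then obtain h \<tau> where h: "h \<in> consec n" "\<tau> permutes {..<2}" "\<sigma> = h \<circ> \<tau>" by blast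
  have "h k = \<sigma> k" if "k \<ge> 2" for k
    using h(2,3) that by (simp add: permutes_def)
  then show ?thesis using h(1) by blast
qed

section \<open>Block permutations\<close>

definition block_perm :: "nat \<Rightarrow> (nat \<Rightarrow> nat) \<Rightarrow> nat \<Rightarrow> nat" where
  "block_perm L \<pi> k = \<pi> (k div L) * L + k mod L"

definition block_diag :: "nat \<Rightarrow> (nat \<Rightarrow> nat \<Rightarrow> nat) \<Rightarrow> nat \<Rightarrow> nat" where
  "block_diag L c k = k div L * L + c (k div L) (k mod L)"

lemma block_lt: "L > 0 \<Longrightarrow> k < M * L \<longleftrightarrow> k div L < (M :: nat)"
  by (simp add: div_less_iff_less_mult)

lemma block_perm_permutes:
  assumes L: "L > 0" and \<pi>: "\<pi> permutes {..<M}"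
  shows "block_perm L \<pi> permutes {..<M * L}"
proof (rule bij_imp_permutes)
  have lt: "\<pi> j < M \<longleftrightarrow> j < M" for j using permutes_in_image[OF \<pi>, of j] by simp
  have lt': "inv_into UNIV \<pi> j < M \<longleftrightarrow> j < M" for j
    using permutes_in_image[OF permutes_inv[OF \<pi>], of j] by simp
  show "bij_betw (block_perm L \<pi>) {..<M * L} {..<M * L}"
    by (rule bij_betwI[where g = "block_perm L (inv_into UNIV \<pi>)"])
      (use L lt lt' permutes_inverses[OF \<pi>] in \<open>auto simp: block_perm_def block_lt\<close>)
  fix k assume "k \<notin> {..<M * L}"
  then have "\<pi> (k div L) = k div L" using \<pi> L by (auto simp: permutes_def block_lt)
  then show "block_perm L \<pi> k = k" by (simp add: block_perm_def)
qed

lemma block_diag_permutes: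
  assumes L: "L > 0" and c: "\<And>j. c j permutes {..<L}" and M: "\<And>j. j \<ge> M \<Longrightarrow> c j = id"
  shows "block_diag L c permutes {..<M * L}"
proof (rule bij_imp_permutes)
  have lt: "c j a < L \<longleftrightarrow> a < L" for j a using permutes_in_image[OF c, of j a] by simp
  have lt': "inv_into UNIV (c j) a < L \<longleftrightarrow> a < L" for j a
    using permutes_in_image[OF permutes_inv[OF c], of j a] by simp
  show "bij_betw (block_diag L c) {..<M * L} {..<M * L}"
    by (rule bij_betwI[where g = "block_diag L (\<lambda>j. inv_into UNIV (c j))"])
      (use L lt lt' permutes_inverses[OF c] in \<open>auto simp: block_diag_def block_lt\<close>)
  fix k assume "k \<notin> {..<M * L}"
  then have "c (k div L) = id" using M L by (auto simp: block_lt)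
  then show "block_diag L c k = k" by (simp add: block_diag_def)
qed

lemma block_diag_pow:
  assumes L: "L > 0" and c: "\<And>j. c j permutes {..<L}"
  shows "block_diag L c ^^ n = block_diag L (\<lambda>j. c j ^^ n)"
proof (induction n)
  case (Suc n)
  have "(c j ^^ n) a < L" if "a < L" for j a
    using that permutes_in_image[OF c, of j] by (induction n) auto
  then show ?case using Suc L by (auto simp: fun_eq_iff block_diag_def)
qed (auto simp: fun_eq_iff block_diag_def)

lemma funpow_id: "(id :: 'a \<Rightarrow> 'a) ^^ n = id"
  by (induction n) auto

lemma common_exponent: "\<exists>m\<ge>3. \<forall>\<sigma>. \<sigma> permutes {..<L :: nat} \<longrightarrow> \<sigma> ^^ m = id"
proof -
  let ?S = "{\<sigma>. \<sigma> permutes {..<L}}"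
  have "\<forall>\<sigma>\<in>?S. \<exists>n. \<sigma> ^^ n = id \<and> n > 0"
    using permutation_is_nilpotent permutation_permutes by blast
  from bchoice[OF this] obtain n where n: "\<And>\<sigma>. \<sigma> \<in> ?S \<Longrightarrow> \<sigma> ^^ n \<sigma> = id \<and> n \<sigma> > 0" by blast
  have fin: "finite ?S" by (rule finite_permutations) simp
  \<comment> \<open>The product of the orders is an exponent. The factor 3 makes room for four
    distinguished points in a cycle of length \<open>m + 1\<close>.\<close>
  define m where "m = 3 * (\<Prod>\<sigma>\<in>?S. n \<sigma>)"
  have "(\<Prod>\<sigma>\<in>?S. n \<sigma>) > 0" by (rule prod_pos) (use n in auto)
  then have "m \<ge> 3" by (simp add: m_def)
  moreover have "\<sigma> ^^ m = id" if \<sigma>: "\<sigma> permutes {..<L}" for \<sigma>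
  proof -
    have "n \<sigma> dvd m" unfolding m_def using fin \<sigma> by (intro dvd_mult dvd_prodI) auto
    then obtain l where "m = n \<sigma> * l" by blast
    then show ?thesis using n[of \<sigma>] \<sigma> by (simp add: funpow_mult[symmetric] funpow_id)
  qed
  ultimately show ?thesis by blast
qed

section \<open>Rearranging words\<close>

text \<open>For each letter all but at most \<open>q\<close> of its positions in
  \<open>\<omega>'\<close> are matched injectively with positions of the same letter in
  \<open>\<omega>\<close>. Matchings of different letters cannot collide, and their union extends to
  a permutation.\<close>

lemma rearrange:
  fixes \<omega> \<omega>' :: "nat \<Rightarrow> 't"
  assumes \<Theta>: "finite \<Theta>" and w: "\<And>j. j < M \<Longrightarrow> \<omega>' j \<in> \<Theta>"
    and q: "\<And>\<tau>. \<tau> \<in> \<Theta> \<Longrightarrow> card {j \<in> {..<M}. \<omega>' j = \<tau>} \<le> card {j \<in> {..<M}. \<omega> j = \<tau>} + q"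
  shows "\<exists>\<pi>. \<pi> permutes {..<M} \<and> card {j \<in> {..<M}. \<omega> (\<pi> j) \<noteq> \<omega>' j} \<le> card \<Theta> * q"
proof -
  let ?A = "\<lambda>\<tau>. {j \<in> {..<M}. \<omega>' j = \<tau>}" and ?B = "\<lambda>\<tau>. {j \<in> {..<M}. \<omega> j = \<tau>}"
  have "\<exists>A' g. A' \<subseteq> ?A \<tau> \<and> inj_on g A' \<and> g ` A' \<subseteq> ?B \<tau> \<and> card (?A \<tau> - A') \<le> q" if "\<tau> \<in> \<Theta>" for \<tau>
  proof -
    obtain A' where A': "A' \<subseteq> ?A \<tau>" "card A' = min (card (?A \<tau>)) (card (?B \<tau>))"
      using obtain_subset_with_card_n[of "min (card (?A \<tau>)) (card (?B \<tau>))" "?A \<tau>"] by auto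
    have fin: "finite A'" using A'(1) by (rule finite_subset) simp
    have "card A' \<le> card (?B \<tau>)" using A'(2) by simp
    then obtain g where "g ` A' \<subseteq> ?B \<tau>" "inj_on g A'"
      using card_le_inj[OF fin, of "?B \<tau>"] by auto
    moreover have "card (?A \<tau> - A') \<le> q"
      using A' q[OF that] fin by (simp add: card_Diff_subset)
    ultimately show ?thesis using A'(1) by blast
  qed
  then have "\<forall>\<tau>\<in>\<Theta>. \<exists>p. fst p \<subseteq> ?A \<tau> \<and> inj_on (snd p) (fst p) \<and> snd p ` fst p \<subseteq> ?B \<tau> \<and> card (?A \<tau> - fst p) \<le> q"
    by fastforce
  from bchoice[OF this] obtain p where p: "\<And>\<tau>. \<tau> \<in> \<Theta> \<Longrightarrow> fst (p \<tau>) \<subseteq> ?A \<tau> \<and> inj_on (snd (p \<tau>)) (fst (p \<tau>)) \<and>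
      snd (p \<tau>) ` fst (p \<tau>) \<subseteq> ?B \<tau> \<and> card (?A \<tau> - fst (p \<tau>)) \<le> q"
    by blast
  define E where "E = {(j, snd (p \<tau>) j) | j \<tau>. \<tau> \<in> \<Theta> \<and> j \<in> fst (p \<tau>)}"
  have EE: "\<exists>\<tau>\<in>\<Theta>. fst e \<in> fst (p \<tau>) \<and> snd e = snd (p \<tau>) (fst e) \<and> fst e < M \<and> \<omega>' (fst e) = \<tau> \<and> snd e < M \<and> \<omega> (snd e) = \<tau>"
    if "e \<in> E" for e
    using that p unfolding E_def by fastforce
  have "partial_inj E"
    unfolding partial_inj_def
  proof (intro ballI)
    fix e e' assume "e \<in> E" "e' \<in> E"
    from EE[OF this(1)] EE[OF this(2)] obtain \<tau> \<tau>' where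
      e: "\<tau> \<in> \<Theta>" "fst e \<in> fst (p \<tau>)" "snd e = snd (p \<tau>) (fst e)" "\<omega>' (fst e) = \<tau>" "\<omega> (snd e) = \<tau>"
      and e': "\<tau>' \<in> \<Theta>" "fst e' \<in> fst (p \<tau>')" "snd e' = snd (p \<tau>') (fst e')" "\<omega>' (fst e') = \<tau>'" "\<omega> (snd e') = \<tau>'"
      by blast
    show "fst e = fst e' \<longleftrightarrow> snd e = snd e'"
    proof
      assume "fst e = fst e'"
      then show "snd e = snd e'" using e e' by metis
    next
      assume eq: "snd e = snd e'"
      then have "\<tau> = \<tau>'" using e e' by metis
      then have "snd (p \<tau>) (fst e) = snd (p \<tau>) (fst e')" "fst e' \<in> fst (p \<tau>)"
        using eq e(3) e'(2,3) by simp_all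
      moreover have "inj_on (snd (p \<tau>)) (fst (p \<tau>))" using p e(1) by blast
      ultimately show "fst e = fst e'" using e(2) by (simp only: inj_on_eq_iff)
    qed
  qed
  moreover have "E \<subseteq> {..<M} \<times> {..<M}" using EE by fastforce
  ultimately obtain \<pi> where \<pi>: "\<pi> permutes {..<M}" "\<And>e. e \<in> E \<Longrightarrow> \<pi> (fst e) = snd e"
    using partial_inj_extend[of "{..<M}" E] by auto
  have "{j \<in> {..<M}. \<omega> (\<pi> j) \<noteq> \<omega>' j} \<subseteq> (\<Union>\<tau>\<in>\<Theta>. ?A \<tau> - fst (p \<tau>))"
  proof
    fix j assume j: "j \<in> {j \<in> {..<M}. \<omega> (\<pi> j) \<noteq> \<omega>' j}"
    have "j \<notin> fst (p (\<omega>' j))"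
    proof
      assume a: "j \<in> fst (p (\<omega>' j))"
      let ?e = "(j, snd (p (\<omega>' j)) j)"
      have "?e \<in> E" using a j w by (auto simp: E_def)
      then have "\<omega> (\<pi> j) = \<omega>' j" using \<pi>(2)[of ?e] EE[of ?e] by auto
      then show False using j by simp
    qed
    then show "j \<in> (\<Union>\<tau>\<in>\<Theta>. ?A \<tau> - fst (p \<tau>))" using j w by auto
  qed
  then have "card {j \<in> {..<M}. \<omega> (\<pi> j) \<noteq> \<omega>' j} \<le> card (\<Union>\<tau>\<in>\<Theta>. ?A \<tau> - fst (p \<tau>))"
    using \<Theta> by (intro card_mono) auto
  also have "\<dots> \<le> (\<Sum>\<tau>\<in>\<Theta>. card (?A \<tau> - fst (p \<tau>)))" by (rule card_UN_le[OF \<Theta>])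
  also have "\<dots> \<le> (\<Sum>\<tau>\<in>\<Theta>. q)" by (rule sum_mono) (use p in auto)
  finally show ?thesis using \<pi>(1) by auto
qed

text \<open>Words are classified by their letter counts, rounded to multiples of \<open>M div J\<close>; the number of
  classes does not depend on the length \<open>M\<close>.\<close>

lemma few_words_up_to_rearrangement:
  fixes \<Theta> :: "'t set"
  assumes \<Theta>: "finite \<Theta>" and J: "J > 0"
  shows "\<exists>r. \<forall>M\<ge>J. \<exists>cl C. \<forall>\<omega>. (\<forall>j<M. \<omega> j \<in> \<Theta>) \<longrightarrow> cl \<omega> < r \<and> (\<forall>j<M. C (cl \<omega>) j \<in> \<Theta>) \<and>
    (\<exists>\<pi>. \<pi> permutes {..<M} \<and> card {j \<in> {..<M}. \<omega> (\<pi> j) \<noteq> C (cl \<omega> :: nat) j} \<le> card \<Theta> * (M div J))"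
proof -
  let ?V = "PiE \<Theta> (\<lambda>_. {..2 * J})"
  have fV: "finite ?V" using \<Theta> by (intro finite_PiE) auto
  obtain e where e: "bij_betw e ?V {..<card ?V}" using ex_bij_betw_finite_nat[OF fV] by (auto simp: lessThan_atLeast0)
  show ?thesis
  proof (intro exI[of _ "card ?V"] allI impI)
    fix M assume M: "J \<le> M"
    define q where "q = M div J"
    have q: "q > 0" using M J by (simp add: q_def div_greater_zero_iff)
    \<comment> \<open>Rounding \<open>M / J\<close> down to \<open>q \<ge> 1\<close> loses at most a
      factor 2, so a rounded count takes at most \<open>2 * J + 1\<close> values whatever
      \<open>M\<close> is.\<close>
    have Mq: "M \<le> q * (2 * J)"
    proof -
      have "M = q * J + M mod J" by (simp add: q_def)
      moreover have "M mod J \<le> J" using J by (simp add: less_imp_le)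
      moreover have "J \<le> q * J" using q by simp
      ultimately show ?thesis by linarith
    qed
    define n where "n \<omega> \<tau> = card {j \<in> {..<M}. \<omega> j = \<tau>}" for \<omega> and \<tau> :: 't
    have nM: "n \<omega> \<tau> \<le> M" for \<omega> \<tau>
      using card_mono[of "{..<M}" "{j \<in> {..<M}. \<omega> j = \<tau>}"] by (auto simp: n_def)
    define v where "v \<omega> = restrict (\<lambda>\<tau>. n \<omega> \<tau> div q) \<Theta>" for \<omega>
    have vV: "v \<omega> \<in> ?V" for \<omega>
    proof -
      have "n \<omega> \<tau> div q \<le> 2 * J" for \<tau>
      proof -
        have "n \<omega> \<tau> \<le> q * (2 * J)" using nM Mq le_trans by blast
        then have "n \<omega> \<tau> div q \<le> q * (2 * J) div q" by (rule div_le_mono)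
        then show ?thesis using q by simp
      qed
      then show ?thesis by (auto simp: v_def)
    qed
    define cl where "cl \<omega> = e (v \<omega>)" for \<omega>
    \<comment> \<open>Each class is represented by one of its own words, whose rounded counts agree
      with those of every other member.\<close>
    define C where "C i = (SOME \<omega>. (\<forall>j<M. \<omega> j \<in> \<Theta>) \<and> cl \<omega> = i)" for i
    show "\<exists>cl C. \<forall>\<omega>. (\<forall>j<M. \<omega> j \<in> \<Theta>) \<longrightarrow> cl \<omega> < card ?V \<and> (\<forall>j<M. C (cl \<omega>) j \<in> \<Theta>) \<and>
      (\<exists>\<pi>. \<pi> permutes {..<M} \<and> card {j \<in> {..<M}. \<omega> (\<pi> j) \<noteq> C (cl \<omega> :: nat) j} \<le> card \<Theta> * (M div J))"
    proof (rule exI[of _ cl], rule exI[of _ C], intro allI impI)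
      fix \<omega> :: "nat \<Rightarrow> 't" assume \<omega>: "\<forall>j<M. \<omega> j \<in> \<Theta>"
      have C: "(\<forall>j<M. C (cl \<omega>) j \<in> \<Theta>) \<and> cl (C (cl \<omega>)) = cl \<omega>"
        unfolding C_def by (rule someI[of _ \<omega>]) (use \<omega> in auto)
      have "v (C (cl \<omega>)) = v \<omega>"
        using C vV bij_betw_imp_inj_on[OF e] by (auto simp: cl_def inj_on_def)
      then have eq: "n (C (cl \<omega>)) \<tau> div q = n \<omega> \<tau> div q" if "\<tau> \<in> \<Theta>" for \<tau>
        using that by (auto simp: v_def fun_eq_iff restrict_def split: if_splits)
      have "n (C (cl \<omega>)) \<tau> \<le> n \<omega> \<tau> + q" if "\<tau> \<in> \<Theta>" for \<tau>
      proof -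
        have "n (C (cl \<omega>)) \<tau> = n \<omega> \<tau> div q * q + n (C (cl \<omega>)) \<tau> mod q"
          using eq[OF that] div_mult_mod_eq[of "n (C (cl \<omega>)) \<tau>" q] by simp
        moreover have "n \<omega> \<tau> div q * q \<le> n \<omega> \<tau>" by simp
        moreover have "n (C (cl \<omega>)) \<tau> mod q < q" using q by simp
        ultimately show ?thesis by linarith
      qed
      then have "\<exists>\<pi>. \<pi> permutes {..<M} \<and> card {j \<in> {..<M}. \<omega> (\<pi> j) \<noteq> C (cl \<omega>) j} \<le> card \<Theta> * q"
        using C by (intro rearrange[OF \<Theta>]) (auto simp: n_def)
      moreover have "cl \<omega> < card ?V" using bij_betw_apply[OF e vV[of \<omega>]] by (simp add: cl_def)
      ultimately show "cl \<omega> < card ?V \<and> (\<forall>j<M. C (cl \<omega>) j \<in> \<Theta>) \<and>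
        (\<exists>\<pi>. \<pi> permutes {..<M} \<and> card {j \<in> {..<M}. \<omega> (\<pi> j) \<noteq> C (cl \<omega>) j} \<le> card \<Theta> * (M div J))"
        using C by (simp add: q_def)
    qed
  qed
qed

section \<open>Commutators of permutations with small common support\<close>

lemma commutator_disjoint:
  fixes c c' :: "'a \<Rightarrow> 'a"
  assumes c: "bij c" "bij c'" and S: "\<And>k. c k = k \<or> c' k = k"
  shows "c \<circ> c' \<circ> inv_into UNIV c \<circ> inv_into UNIV c' = id"
proof -
  have inj: "c k = c l \<longleftrightarrow> k = l" "c' k = c' l \<longleftrightarrow> k = l" for k l
    using c by (auto dest: bij_is_inj injD)
  have "c (c' k) = c' (c k)" for k
  proof (cases "c k = k")
    case True
    then show ?thesis using S[of "c' k"] S[of k] inj(2)[of "c' k" k] by auto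
  next
    case False
    then show ?thesis using S[of "c k"] S[of k] inj(1)[of "c k" k] by auto
  qed
  then have "c \<circ> c' = c' \<circ> c" by (simp add: fun_eq_iff)
  then have "c \<circ> c' \<circ> inv_into UNIV c \<circ> inv_into UNIV c' = c' \<circ> (c \<circ> inv_into UNIV c) \<circ> inv_into UNIV c'"
    by (simp add: o_assoc)
  also have "\<dots> = id" using c by (simp add: bij_is_surj surj_iff[THEN iffD1])
  finally show ?thesis .
qed

text \<open>When the supports meet only in \<open>x\<close>, the point \<open>c x\<close> is fixed
  by \<open>c'\<close> and the point \<open>c' x\<close> by \<open>c\<close>; all other motions
  cancel and a three-cycle through these points remains.\<close>

lemma commutator_single:
  fixes c c' :: "'a \<Rightarrow> 'a"
  assumes c: "bij c" "bij c'" and x: "c x \<noteq> x" "c' x \<noteq> x" and S: "\<And>k. k \<noteq> x \<Longrightarrow> c k = k \<or> c' k = k"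
  shows "c \<circ> c' \<circ> inv_into UNIV c \<circ> inv_into UNIV c' =
    (\<lambda>k. if k = x then c x else if k = c x then c' x else if k = c' x then x else k)" (is "_ = ?g")
proof -
  have inj: "c k = c l \<longleftrightarrow> k = l" "c' k = c' l \<longleftrightarrow> k = l" for k l
    using c by (auto dest: bij_is_inj injD)
  have ne: "c x \<noteq> c' x" using S[of "c x"] inj x by metis
  have c'cx: "c' (c x) = c x" using S[of "c x"] inj x by metis
  have cc'x: "c (c' x) = c' x" using S[of "c' x"] inj x by metis
  \<comment> \<open>Moving the inverses to the other side leaves a case distinction without inverses.\<close>
  have key: "c (c' k) = ?g (c' (c k))" for k
  proof (cases "k = x")
    case True
    have "c' (c x) = c x" by (rule c'cx)
    then show ?thesis using True cc'x x by simp
  next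
    case kx: False
    show ?thesis
    proof (cases "c k = k")
      case True
      then have "c' (c k) = c' k" by simp
      moreover have "c' k \<noteq> c' x" using inj kx by simp
      moreover have "c' k \<noteq> c x" using c'cx inj(1)[of "c x" x] inj(2)[of k "c x"] True x(1) by auto
      moreover have "c (c' k) = c' k" if "c' k \<noteq> x" using S[OF that] inj True by metis
      ultimately show ?thesis by auto
    next
      case False
      then have c'k: "c' k = k" using S[OF kx] by blast
      show ?thesis
      proof (cases "c k = x")
        case True
        then show ?thesis using c'k x inj ne cc'x kx by auto
      next
        case False
        then have "c' (c k) = c k" using S[OF False] inj \<open>c k \<noteq> k\<close> by metis
        moreover have "c k \<noteq> c x" "c k \<noteq> c' x" using inj kx cc'x c'k by (metis)+
        ultimately show ?thesis using False c'k by simp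
      qed
    qed
  qed
  show ?thesis
  proof
    fix k
    define l where "l = inv_into UNIV c (inv_into UNIV c' k)"
    have "c l = inv_into UNIV c' k" unfolding l_def using c(1) by (simp add: bij_is_surj surj_f_inv_f)
    then have "c' (c l) = k" using c(2) by (simp add: bij_is_surj surj_f_inv_f)
    then show "(c \<circ> c' \<circ> inv_into UNIV c \<circ> inv_into UNIV c') k = ?g k" using key[of l] by (simp add: l_def)
  qed
qed

section \<open>Coding finitely many classes\<close>

text \<open>The cycles below have differences of support points chosen so that the shift by \<open>3 * i + 4\<close>
  makes the support of the \<open>i\<close>-th cycle meet itself, in a single point, and moves the supports of all
  the others off themselves.\<close>

lemma coding_cycles:
  fixes m r :: nat
  assumes m: "m \<ge> 3"
  shows "\<exists>W c K q. (\<forall>i<r. c i permutes {..<W :: nat} \<and> c i ^^ Suc m = id \<and> K i \<le> W \<and> q i + 2 < 2 * W) \<and>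
    (\<forall>i<r. \<forall>i'<r. c i' \<circ> shift_perm (K i) (c i') \<circ> inv_into UNIV (c i') \<circ> inv_into UNIV (shift_perm (K i) (c i'))
        = (if i = i' then three_cyc (q i) else id))"
proof -
  \<comment> \<open>\<open>Y\<close> exceeds every sum of a shift and a small support point, so the
    padding by multiples of \<open>Y\<close> cannot interfere with the small points.\<close>
  define Y where "Y = 6 * r + 8"
  define q where "q i = 3 * i + 3" for i :: nat
  define K where "K i = 3 * i + 4" for i :: nat
  \<comment> \<open>\<open>c i\<close> sends 0 to 1 and \<open>q i + 1\<close> to
    \<open>q i\<close>, and \<open>K i = q i + 1\<close>. The shifted cycle therefore sends
    \<open>q i + 1\<close> to \<open>q i + 2\<close>, so the two cycles move their common point to
    its two neighbours. Multiples of \<open>Y\<close> fill the length up to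
    \<open>m + 1\<close>.\<close>
  define cs where "cs i = [0, 1, q i + 1, q i] @ map (\<lambda>l. Suc l * Y) [0..<m - 3]" for i
  define c where "c i = cycle_of_list (cs i)" for i
  define W where "W = (m + 2) * Y"
  have Y: "Y > 0" "3 * r + 1 < Y" by (simp_all add: Y_def)
  have len: "length (cs i) = Suc m" for i using m by (simp add: cs_def)
  have cs_set: "a \<in> set (cs i) \<longleftrightarrow> a = 0 \<or> a = 1 \<or> a = q i + 1 \<or> a = q i \<or> (\<exists>l<m - 3. a = Suc l * Y)" for a i
    by (auto simp: cs_def)
  have dist: "distinct (cs i)" if "i < r" for i
  proof -
    have "q i + 1 < Suc l * Y" for l
    proof -
      have "q i + 1 < Y" using that by (simp add: q_def Y_def)
      also have "Y \<le> Suc l * Y" by simp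
      finally show ?thesis .
    qed
    then have "q i + 1 \<noteq> Suc l * Y" "q i \<noteq> Suc l * Y" "1 \<noteq> Suc l * Y" for l
      by (metis less_irrefl, metis add_lessD1 less_irrefl, simp add: Y_def)
    then show ?thesis using Y(1) by (auto simp: cs_def distinct_map inj_on_def q_def)
  qed
  have csW: "a < W" if "i < r" "a \<in> set (cs i)" for a i
  proof -
    have "Suc l * Y < W" if "l < m - 3" for l
      unfolding W_def using that Y(1) by (intro mult_strict_right_mono) auto
    moreover have "q i + 1 < Y" using \<open>i < r\<close> by (simp add: q_def Y_def)
    moreover have "Y \<le> W" by (simp add: W_def)
    ultimately show ?thesis using that(2) unfolding cs_set by auto
  qed
  have cp: "c i permutes set (cs i)" for i unfolding c_def by (rule cycle_permutes)
  have cpW: "c i permutes {..<W}" if "i < r" for i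
    by (rule permutes_subset[OF cp]) (use csW[OF that] in auto)
  have csupp: "a \<in> set (cs i)" if "c i a \<noteq> a" for a i
    using that id_outside_supp[of a "cs i"] by (auto simp: c_def)
  have cval: "c i 0 = 1" "c i (q i + 1) = q i" if "i < r" for i
  proof -
    have "map (c i) (cs i) = rotate 1 (cs i)"
      using cyclic_rotation[of "cs i" 1] dist[OF that] by (simp add: c_def)
    then have "map (c i) (cs i) ! j = rotate1 (cs i) ! j" for j by simp
    from this[of 0] this[of 2] show "c i 0 = 1" "c i (q i + 1) = q i"
      by (simp_all add: cs_def nth_append numeral_2_eq_2)
  qed
  have pow: "c i ^^ Suc m = id" if "i < r" for i
  proof
    fix k
    have "map (c i ^^ Suc m) (cs i) = rotate (length (cs i)) (cs i)"
      using cyclic_rotation[of "cs i" "Suc m"] dist[OF that] by (simp only: c_def len)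
    then have "map (c i ^^ Suc m) (cs i) = map id (cs i)" by simp
    then have in_cs: "(c i ^^ Suc m) k = k" if "k \<in> set (cs i)" using that unfolding map_eq_conv by simp
    have out_cs: "(c i ^^ n) k = k" if "k \<notin> set (cs i)" for n
      using that cp[of i] by (induction n) (auto simp: permutes_def)
    show "(c i ^^ Suc m) k = id k"
      using in_cs out_cs[of "Suc m"] unfolding id_apply by blast
  qed
  \<comment> \<open>The positive differences of small support points are 0 or 2 modulo 3, apart from
    1 and \<open>q i' + 1 = 3 * i' + 4\<close>; the shift \<open>K i\<close> is 1 modulo 3 and at
    least 4. Padding points are excluded by size.\<close>
  have diff: "i = i' \<and> b = 0 \<and> a = q i + 1"
    if i: "i < r" "i' < r" and ab: "a \<in> set (cs i')" "b \<in> set (cs i')" "a = b + K i" for i i' a b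
  proof -
    have K: "K i \<le> 3 * r + 1" "K i > 0" using i by (auto simp: K_def)
    have q': "q i' + 1 \<le> 3 * r + 1" using i by (simp add: q_def)
    have YS: "Y \<le> Suc l * Y" for l by simp
    have large_b: False if "b = Suc l * Y" for l
    proof -
      have "b \<ge> Y" using that by simp
      then have "a \<ge> Y" using ab(3) by simp
      then obtain l' where l': "a = Suc l' * Y" using ab(1) q' Y(2) by (auto simp: cs_set)
      then have "Suc l' * Y = Suc l * Y + K i" using that ab(3) by simp
      moreover have "Suc l' * Y \<ge> Suc l * Y + Y" if "l < l'"
        using mult_le_mono1[of "Suc (Suc l)" "Suc l'" Y] that by simp
      moreover have "Suc l' * Y \<le> Suc l * Y" if "l' \<le> l"
        using mult_le_mono1[of "Suc l'" "Suc l" Y] that by simp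
      ultimately show False using K Y(2) by (cases "l < l'") auto
    qed
    then have b: "b = 0 \<or> b = 1 \<or> b = q i' + 1 \<or> b = q i'" using ab(2) by (auto simp: cs_set)
    have "a \<noteq> Suc l * Y" for l
    proof
      assume "a = Suc l * Y"
      then have "a \<ge> Y" by simp
      moreover have "b + K i \<le> 6 * r + 2" using b q' K by auto
      ultimately show False using ab(3) by (simp add: Y_def)
    qed
    then have a: "a = 0 \<or> a = 1 \<or> a = q i' + 1 \<or> a = q i'" using ab(1) by (auto simp: cs_set)
    have "b = 0"
    proof (rule ccontr)
      assume b0: "b \<noteq> 0"
      show False
        using a unfolding q_def
      proof (elim disjE)
        assume "a = 3 * i' + 3 + 1"
        then show False using b ab(3) b0 unfolding K_def q_def by (elim disjE) (linarith | presburger)+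
      next
        assume "a = 3 * i' + 3"
        then show False using b ab(3) b0 unfolding K_def q_def by (elim disjE) (linarith | presburger)+
      qed (use ab(3) in \<open>unfold K_def, linarith\<close>)+
    qed
    then show ?thesis using a ab(3) unfolding K_def q_def by (elim disjE) (linarith | presburger)+
  qed
  have bij: "bij (c i)" for i using cp by (rule permutes_bij)
  have sbij: "bij (shift_perm (K i) (c i'))" if "i' < r" for i i'
    using shift_perm_permutes[OF cpW[OF that]] by (rule permutes_bij)
  have ssupp: "K i \<le> k \<and> k - K i \<in> set (cs i')" if "shift_perm (K i) (c i') k \<noteq> k" for i i' k
    using that csupp[of i' "k - K i"] by (auto simp: shift_perm_def split: if_splits)
  have both: "i = i' \<and> k = q i + 1" if "i < r" "i' < r" "c i' k \<noteq> k" "shift_perm (K i) (c i') k \<noteq> k" for i i' k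
    using diff[OF that(1,2) csupp[OF that(3)], of "k - K i"] ssupp[OF that(4)] by auto
  have com: "c i' \<circ> shift_perm (K i) (c i') \<circ> inv_into UNIV (c i') \<circ> inv_into UNIV (shift_perm (K i) (c i'))
        = (if i = i' then three_cyc (q i) else id)" if i: "i < r" "i' < r" for i i'
  proof (cases "i = i'")
    case False
    then show ?thesis using commutator_disjoint[OF bij[of i'] sbij[OF i(2), of i]] both[OF i] by auto
  next
    case True
    let ?c' = "shift_perm (K i) (c i)" and ?x = "q i + 1"
    have v: "?c' ?x = q i + 2" "c i ?x = q i"
      using cval[OF i(1)] by (auto simp: shift_perm_def K_def q_def)
    have "c i \<circ> ?c' \<circ> inv_into UNIV (c i) \<circ> inv_into UNIV ?c' =
      (\<lambda>k. if k = ?x then c i ?x else if k = c i ?x then ?c' ?x else if k = ?c' ?x then ?x else k)"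
    proof (rule commutator_single[OF bij sbij[OF i(1)]])
      show "c i k = k \<or> ?c' k = k" if "k \<noteq> ?x" for k using both[OF i(1) i(1), of k] that by auto
    qed (use v in auto)
    also have "\<dots> = three_cyc (q i)" unfolding v by (auto simp: three_cyc_def fun_eq_iff)
    finally show ?thesis using True by simp
  qed
  have "K i \<le> W" "q i + 2 < 2 * W" if "i < r" for i
  proof -
    have "2 * Y \<le> W" unfolding W_def by (rule mult_le_mono1) simp
    then show "K i \<le> W" "q i + 2 < 2 * W" using that by (auto simp: K_def q_def Y_def)
  qed
  then show ?thesis
    using cpW pow com by (intro exI[of _ W] exI[of _ c] exI[of _ K] exI[of _ q]) auto
qed

section \<open>Positions along a word\<close>

text \<open>A path that moves by one level for each letter of the first generator and jumps to an unvisited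
  region for each letter of the second; coordinates are the number of jumps and the offset.\<close>

fun word_pos :: "(bool \<times> bool) list \<Rightarrow> (nat \<times> int) list" where
  "word_pos [] = [(0, 0)]"
| "word_pos ((b, s) # w) = (let (u, t) = hd (word_pos w) in
     (if s then (u, if b then t + 1 else t - 1) else (Suc u, t)) # word_pos w)"

lemma length_word_pos: "length (word_pos w) = Suc (length w)"
  by (induction w rule: word_pos.induct) (auto simp: Let_def split: prod.split)

lemma word_pos_bound: "(u, t) \<in> set (word_pos w) \<Longrightarrow> \<bar>t\<bar> \<le> int (length w)"
proof (induction w arbitrary: u t rule: word_pos.induct)
  case (2 b s w)
  obtain u0 t0 where h: "hd (word_pos w) = (u0, t0)" by fastforce
  then have "(u0, t0) \<in> set (word_pos w)"
    using length_word_pos[of w] hd_in_set[of "word_pos w"] by (cases "word_pos w") auto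
  then have "\<bar>t0\<bar> \<le> int (length w)" by (rule 2)
  then show ?case using 2 h by (fastforce split: if_splits)
qed simp

lemma word_pos_step:
  assumes "i < length w" "word_pos w ! Suc i = (u, t)"
  shows "w ! i = (True, True) \<Longrightarrow> word_pos w ! i = (u, t + 1)"
    "w ! i = (False, True) \<Longrightarrow> word_pos w ! i = (u, t - 1)"
proof -
  have "(w ! i = (True, True) \<longrightarrow> word_pos w ! i = (u, t + 1)) \<and> (w ! i = (False, True) \<longrightarrow> word_pos w ! i = (u, t - 1))"
    using assms
  proof (induction w arbitrary: i rule: word_pos.induct)
    case (2 b s w)
    have ne: "word_pos w \<noteq> []" using length_word_pos[of w] by auto
    obtain u0 t0 where h: "hd (word_pos w) = (u0, t0)" by fastforce
    show ?case
    proof (cases i)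
      case 0
      then show ?thesis using 2 h ne by (auto simp: hd_conv_nth)
    next
      case (Suc j)
      then show ?thesis using 2 h by auto
    qed
  qed simp
  then show "w ! i = (True, True) \<Longrightarrow> word_pos w ! i = (u, t + 1)"
    "w ! i = (False, True) \<Longrightarrow> word_pos w ! i = (u, t - 1)" by auto
qed

text \<open>Every earlier position has made fewer jumps, or equally many and lies behind the current
  one in the direction of the last step. A reduced word cannot turn back, so this invariant
  survives. The list grows at its head, as words act from the right.\<close>

lemma word_pos_distinct:
  assumes "reduced w"
  shows "distinct (word_pos w)"
proof -
  have "distinct (word_pos w) \<and> (\<forall>p\<in>set (tl (word_pos w)). fst p < fst (hd (word_pos w)) \<or>
      fst p = fst (hd (word_pos w)) \<and> w \<noteq> [] \<and> snd (hd w) \<and>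
      (if fst (hd w) then snd p < snd (hd (word_pos w)) else snd p > snd (hd (word_pos w))))"
    using assms
  proof (induction w)
    case (Cons a w)
    obtain b s where a: "a = (b, s)" by fastforce
    obtain u0 t0 l where h: "word_pos w = (u0, t0) # l"
      using length_word_pos[of w] by (cases "word_pos w") auto
    have red: "reduced w" "w = [] \<or> hd w \<noteq> (\<not> b, s)"
      using Cons.prems by (auto simp: a reduced_Cons inv_letter_def)
    have IH: "distinct ((u0, t0) # l)" "\<And>u' t'. (u', t') \<in> set l \<Longrightarrow>
        u' < u0 \<or> u' = u0 \<and> w \<noteq> [] \<and> snd (hd w) \<and> (if fst (hd w) then t' < t0 else t' > t0)"
      using Cons.IH[OF red(1)] h by fastforce+
    define x where "x = (if s then (u0, if b then t0 + 1 else t0 - 1) else (Suc u0, t0))"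
    have wp: "word_pos ((b, s) # w) = x # (u0, t0) # l" using h by (simp add: x_def)
    have key: "u' < fst x \<or> u' = fst x \<and> s \<and> (if b then t' < snd x else t' > snd x)"
      if "(u', t') \<in> set ((u0, t0) # l)" for u' t'
    proof (cases "(u', t') = (u0, t0)")
      case True
      then show ?thesis by (auto simp: x_def)
    next
      case False
      then have "(u', t') \<in> set l" using that by auto
      from IH(2)[OF this] consider "u' < u0"
        | "u' = u0" "w \<noteq> []" "snd (hd w)" "if fst (hd w) then t' < t0 else t' > t0" by blast
      then show ?thesis
      proof cases
        case 2
        have "fst (hd w) = b" if s
          using red(2) 2 that by (cases "hd w") auto
        then show ?thesis using 2 by (auto simp: x_def split: if_splits)
      qed (auto simp: x_def)
    qed
    have "x \<notin> set ((u0, t0) # l)" using key[of "fst x" "snd x"] by (cases b) auto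
    moreover have "\<forall>p\<in>set ((u0, t0) # l). fst p < fst x \<or>
        fst p = fst x \<and> s \<and> (if b then snd p < snd x else snd p > snd x)"
      using key by (metis prod.collapse)
    moreover have "distinct ((u0, t0) # l)" by (rule IH(1))
    ultimately show ?case unfolding a wp by (cases b) simp_all
  qed simp
  then show ?thesis by blast
qed

text \<open>The letter \<open>True\<close> stands for the map that shifts the levels.\<close>

lemma word_positions:
  assumes w: "reduced w"
  shows "\<exists>v :: nat \<Rightarrow> nat. inj_on v {..length w} \<and> (\<forall>i<length w.
    (w ! i = (True, True) \<longrightarrow> v i = Suc (v (Suc i))) \<and> (w ! i = (False, True) \<longrightarrow> v (Suc i) = Suc (v i)))"
proof -
  let ?n = "length w"
  \<comment> \<open>Pairs are numbered in base \<open>2 * length w + 1\<close>, the offset being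
    moved into the range of digits; neighbouring offsets with the same number of jumps become
    neighbouring levels.\<close>
  define g where "g p = fst p * (2 * ?n + 1) + nat (snd p + int ?n)" for p :: "nat \<times> int"
  define v where "v i = g (word_pos w ! i)" for i
  have b: "\<bar>snd (word_pos w ! i)\<bar> \<le> int ?n" if "i \<le> ?n" for i
    using word_pos_bound[of "fst (word_pos w ! i)" "snd (word_pos w ! i)" w] that length_word_pos[of w] by simp
  have g_inj: "p = p'" if "\<bar>snd p\<bar> \<le> int ?n" "\<bar>snd p'\<bar> \<le> int ?n" "g p = g p'" for p p'
  proof -
    have lt: "nat (snd p + int ?n) < 2 * ?n + 1" "nat (snd p' + int ?n) < 2 * ?n + 1" using that by auto
    have "g p div (2 * ?n + 1) = fst p" "g p mod (2 * ?n + 1) = nat (snd p + int ?n)"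
      "g p' div (2 * ?n + 1) = fst p'" "g p' mod (2 * ?n + 1) = nat (snd p' + int ?n)"
      using lt unfolding g_def by (simp_all only: div_mult_self3 mod_mult_self3 div_less mod_less)
    then have "fst p = fst p'" "nat (snd p + int ?n) = nat (snd p' + int ?n)" using that(3) by auto
    then show ?thesis using that(1,2) by (intro prod_eqI) auto
  qed
  have "inj_on v {..?n}"
  proof (rule inj_onI)
    fix i j assume ij: "i \<in> {..?n}" "j \<in> {..?n}" "v i = v j"
    then have "word_pos w ! i = word_pos w ! j" using g_inj b by (simp add: v_def)
    then show "i = j"
      using word_pos_distinct[OF w] ij length_word_pos[of w] by (simp add: nth_eq_iff_index_eq)
  qed
  moreover have "(w ! i = (True, True) \<longrightarrow> v i = Suc (v (Suc i))) \<and> (w ! i = (False, True) \<longrightarrow> v (Suc i) = Suc (v i))"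
    if "i < ?n" for i
  proof -
    obtain u t where ut: "word_pos w ! Suc i = (u, t)" by fastforce
    show ?thesis
      using word_pos_step[OF that ut] b[of i] b[of "Suc i"] ut that by (auto simp: v_def g_def nat_add_distrib)
  qed
  ultimately show ?thesis by blast
qed

section \<open>Perturbation arguments on towers\<close>

section \<open>Approximation on towers\<close>

lemma card_blocks:
  fixes L M :: nat
  assumes L: "L > 0"
  shows "card {k \<in> {..<M * L}. B (k div L) \<and> A (k mod L)} \<le> card {j \<in> {..<M}. B j} * card {a \<in> {..<L}. A a}"
proof -
  let ?S = "{k \<in> {..<M * L}. B (k div L) \<and> A (k mod L)}"
  let ?T = "{j \<in> {..<M}. B j} \<times> {a \<in> {..<L}. A a}"
  have "card ?S \<le> card ?T"
  proof (rule card_inj_on_le)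
    show "inj_on (\<lambda>k. (k div L, k mod L)) ?S"
    proof (rule inj_onI)
      fix k k' assume "(k div L, k mod L) = (k' div L, k' mod L)"
      then have "k div L * L + k mod L = k' div L * L + k' mod L" by simp
      then show "k = k'" by (simp only: div_mult_mod_eq)
    qed
    show "(\<lambda>k. (k div L, k mod L)) ` ?S \<subseteq> ?T" using L by (auto simp: block_lt)
  qed auto
  then show ?thesis by (simp add: card_cartesian_product)
qed

lemma (in group) conj_generate:
  assumes x: "x \<in> generate G A" and A: "A \<subseteq> carrier G" and s: "s \<in> carrier G"
  shows "s \<otimes> x \<otimes> inv s \<in> generate G ((\<lambda>a. s \<otimes> a \<otimes> inv s) ` A)"
  using x
proof (induction rule: generate.induct)
  case one
  then show ?case using s by (simp add: generate.one)
next
  case (incl h)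
  then show ?case by (intro generate.incl) auto
next
  case (inv h)
  then have "inv (s \<otimes> h \<otimes> inv s) \<in> generate G ((\<lambda>a. s \<otimes> a \<otimes> inv s) ` A)" by (intro generate.inv) auto
  moreover have "inv (s \<otimes> h \<otimes> inv s) = s \<otimes> inv h \<otimes> inv s"
    using inv A s by (auto simp: inv_mult_group m_assoc subset_iff)
  ultimately show ?case by simp
next
  case (eng h1 h2)
  have h: "h1 \<in> carrier G" "h2 \<in> carrier G" using eng.hyps A generate_in_carrier by auto
  have "s \<otimes> (h1 \<otimes> h2) \<otimes> inv s = (s \<otimes> h1 \<otimes> inv s) \<otimes> (s \<otimes> h2 \<otimes> inv s)"
  proof -
    have "inv s \<otimes> (s \<otimes> (h2 \<otimes> inv s)) = h2 \<otimes> inv s" using h s by (simp flip: m_assoc)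
    then show ?thesis using h s by (simp add: m_assoc)
  qed
  then show ?case using eng.IH by (simp add: generate.eng)
qed

lemma (in group_hom) hom_generate:
  assumes x: "x \<in> generate G A" and A: "A \<subseteq> carrier G"
  shows "h x \<in> generate H (h ` A)"
  using x
proof (induction rule: generate.induct)
  case (inv a)
  then have "inv\<^bsub>H\<^esub> h a \<in> generate H (h ` A)" by (intro generate.inv) auto
  then show ?case using inv A by auto
next
  case (eng a b)
  have "a \<in> carrier G" "b \<in> carrier G" using eng.hyps A G.generate_in_carrier by auto
  then show ?case using eng.IH by (simp add: generate.eng)
qed (auto intro: generate.intros)

context mp_map
begin

text \<open>Almost every point is moved by some power of \<open>f\<close>, so the sets where no
  exponent up to \<open>K\<close> works decrease to a null set.\<close>

lemma full_bounded:
  assumes g: "g \<in> full_mp M f" and e: "\<epsilon> > 0"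
  shows "\<exists>K::nat. prob {x \<in> space M. \<forall>k\<in>{-int K..int K}. g x \<noteq> P k x} < \<epsilon>"
proof -
  have gm: "g \<in> mp_bijections M" "AE x in M. \<exists>k. g x = P k x" using g by (auto simp: full_mp_iff)
  define A where "A K = {x \<in> space M. \<forall>k\<in>{-int K..int K}. g x \<noteq> P k x}" for K
  have As: "A K \<in> sets M" for K
    unfolding A_def by (rule sets.sets_Collect_finite_All) (auto intro: mp_neq_sets gm(1))
  have "decseq A" unfolding decseq_def A_def by fastforce
  then have "(\<lambda>K. prob (A K)) \<longlonglongrightarrow> prob (\<Inter>K. A K)"
    using As by (intro finite_Lim_measure_decseq) auto
  moreover have "AE x in M. x \<notin> (\<Inter>K. A K)"
    using gm(2)
  proof eventually_elim
    case (elim x)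
    then obtain k where "g x = P k x" by blast
    then have "x \<notin> A (nat \<bar>k\<bar>)" by (auto simp: A_def intro!: bexI[of _ k])
    then show ?case by blast
  qed
  then have "prob (\<Inter>K. A K) = 0" using As by (intro prob_eq_0[THEN iffD2]) auto
  ultimately have "(\<lambda>K. prob (A K)) \<longlonglongrightarrow> 0" by simp
  then have "\<forall>\<^sub>F K in sequentially. prob (A K) < \<epsilon>" using e by (rule order_tendstoD)
  then show ?thesis by (auto simp: A_def eventually_sequentially)
qed

text \<open>The powers of the conjugate are \<open>s f^k s^-1\<close>, and \<open>s\<close> moves
  almost all points inside their orbits; so the conjugate has the orbits of \<open>f\<close> and is
  again a generator.\<close>

lemma conj_full:
  assumes s: "s \<in> full_mp M f"
  shows "f \<in> full_mp M (s \<otimes>\<^bsub>mp_group M\<^esub> f \<otimes>\<^bsub>mp_group M\<^esub> inv\<^bsub>mp_group M\<^esub> s)"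
    "s \<otimes>\<^bsub>mp_group M\<^esub> f \<otimes>\<^bsub>mp_group M\<^esub> inv\<^bsub>mp_group M\<^esub> s \<in> full_mp M f"
proof -
  let ?i = "inv\<^bsub>mp_group M\<^esub> s"
  let ?T = "s \<otimes>\<^bsub>mp_group M\<^esub> f \<otimes>\<^bsub>mp_group M\<^esub> ?i"
  have sm: "s \<in> mp_bijections M" by (rule full_mp_mp[OF s])
  have im: "?i \<in> mp_bijections M" using mp_closed(2)[OF sm] .
  have iF: "?i \<in> full_mp M f" by (rule subgroup.m_inv_closed[OF subgroup_full_mp s])
  have fF: "f \<in> full_mp M f" using P_full[of 1] by (simp add: P_1)
  show T: "?T \<in> full_mp M f"
    using subgroup.m_closed[OF subgroup_full_mp] s iF fF by blast
  have Tm: "?T \<in> mp_bijections M" by (rule full_mp_mp[OF T])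
  interpret T: mp_map M ?T by (rule mp_mapI[OF Tm])
  have TPn: "T.P (int n) x = s (P (int n) (?i x))" if x: "x \<in> space M" for n x
  proof (induction n)
    case 0
    then show ?case using x inv_mp_group(2)[OF sm x] mp_space[OF im] by simp
  next
    case (Suc n)
    have ix: "?i x \<in> space M" using mp_space[OF im x] .
    have "T.P (int (Suc n)) x = ?T (T.P (int n) x)"
      using T.P_add[OF x, of 1 "int n"] by (simp add: T.P_1)
    also have "\<dots> = s (f (?i (s (P (int n) (?i x)))))"
      using Suc sm im f_mp ix mp_space[OF sm P_space[OF ix]] mp_space[OF im] by (simp add: mp_mult mp_closed)
    also have "\<dots> = s (P (int (Suc n)) (?i x))"
      using inv_mp_group(1)[OF sm P_space[OF ix]] P_add[OF ix, of 1 "int n"] by (simp add: P_1)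
    finally show ?case .
  qed
  have TP: "T.P k x = s (P k (?i x))" if x: "x \<in> space M" for k x
  proof (cases "k \<ge> 0")
    case True
    then show ?thesis using TPn[OF x, of "nat k"] by simp
  next
    case False
    have ix: "?i x \<in> space M" using mp_space[OF im x] .
    let ?y = "s (P k (?i x))"
    have y: "?y \<in> space M" using mp_space[OF sm P_space[OF ix]] .
    have "T.P (- k) ?y = s (P (- k) (?i ?y))" using TPn[OF y, of "nat (- k)"] False by simp
    also have "?i ?y = P k (?i x)" using inv_mp_group(1)[OF sm P_space[OF ix]] by simp
    finally have "T.P (- k) ?y = x" using ix inv_mp_group(2)[OF sm x] by simp
    then show ?thesis using T.P_minus(2)[OF y, of k] by simp
  qed
  have "AE x in M. \<exists>k. ?i x = P k x" "AE x in M. \<exists>k. ?i (f x) = P k (f x)"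
    using iF AE_comp_mp[OF f_mp, of "\<lambda>x. \<exists>k. ?i x = P k x"] by (auto simp: full_mp_iff)
  then have "AE x in M. \<exists>k. f x = T.P k x"
    using AE_space
  proof eventually_elim
    case (elim x)
    then obtain a b where ab: "?i x = P a x" "?i (f x) = P b (f x)" by blast
    have "P (b + 1 - a) (?i x) = P (b + 1) x" unfolding ab(1) using elim(3) by (simp flip: P_add)
    also have "\<dots> = ?i (f x)" unfolding ab(2) using P_add[OF elim(3), of b 1] by (simp add: P_1)
    finally have "T.P (b + 1 - a) x = f x"
      using TP[OF elim(3)] inv_mp_group(2)[OF sm mp_space[OF f_mp elim(3)]] by simp
    then show ?case by metis
  qed
  then show "f \<in> full_mp M ?T" using f_mp by (simp add: T.full_mp_iff)
qed

text \<open>The pattern of \<open>g\<close> over the base point \<open>d\<close>. It takes finitely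
  many values and depends measurably on \<open>d\<close>, so whatever is chosen from the pattern
  alone is measurable.\<close>

definition tower_graph :: "nat \<Rightarrow> ('a \<Rightarrow> 'a) \<Rightarrow> 'a \<Rightarrow> (nat \<times> nat) set" where
  "tower_graph N g d = {(k, l). k < N \<and> l < N \<and> g (P (int k) d) = P (int l) d}"

lemma tower_graph_finite: "finite (tower_graph N g ` D)"
proof (rule finite_subset)
  show "tower_graph N g ` D \<subseteq> Pow ({..<N} \<times> {..<N})" by (auto simp: tower_graph_def)
qed simp

lemma tower_graph_sets:
  assumes t: "tower D N" and g: "g \<in> mp_bijections M"
  shows "{d \<in> D. tower_graph N g d = p} \<in> sets M"
proof (cases "p \<subseteq> {..<N} \<times> {..<N}")
  case True
  have Ds: "D \<in> sets M" by (rule tower_sets[OF t])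
  have kl: "{d \<in> D. g (P (int k) d) = P (int l) d \<longleftrightarrow> (k, l) \<in> p} \<in> sets M" for k l
  proof -
    have "g \<otimes>\<^bsub>mp_group M\<^esub> P (int k) \<in> mp_bijections M" using g by (simp add: mp_closed)
    from mp_eq_sets[OF this P_mp[of "int l"]] mp_neq_sets[OF this P_mp[of "int l"]]
    have s: "{x \<in> space M. g (P (int k) x) = P (int l) x} \<in> sets M" "{x \<in> space M. g (P (int k) x) \<noteq> P (int l) x} \<in> sets M"
      using g by (simp_all add: mp_mult cong: conj_cong)
    have "{d \<in> D. g (P (int k) d) = P (int l) d \<longleftrightarrow> (k, l) \<in> p} =
        D \<inter> (if (k, l) \<in> p then {x \<in> space M. g (P (int k) x) = P (int l) x} else {x \<in> space M. g (P (int k) x) \<noteq> P (int l) x})"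
      using tower_space[OF t] by auto
    then show ?thesis using s Ds by simp
  qed
  have "{d \<in> D. tower_graph N g d = p} = D \<inter>
      (\<Inter>(k, l)\<in>{..<N} \<times> {..<N}. {d \<in> D. g (P (int k) d) = P (int l) d \<longleftrightarrow> (k, l) \<in> p})"
    using True by (auto simp: tower_graph_def)
  also have "\<dots> \<in> sets M"
  proof (cases "N = 0")
    case False
    then show ?thesis using Ds kl by (intro sets.Int sets.finite_INT) auto
  qed (use Ds in simp)
  finally show ?thesis .
next
  case False
  then have "{d \<in> D. tower_graph N g d = p} = {}" by (auto simp: tower_graph_def)
  then show ?thesis by (simp only: sets.empty_sets)
qed

lemma partial_inj_tower_graph:
  assumes t: "tower D N" and g: "g \<in> mp_bijections M" and d: "d \<in> D"
  shows "partial_inj (tower_graph N g d)"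
proof -
  have "k = k' \<longleftrightarrow> l = l'" if "k < N" "k' < N" "l < N" "l' < N"
    "g (P (int k) d) = P (int l) d" "g (P (int k') d) = P (int l') d" for k k' l l'
    using tower_unique[OF t d d, of k k'] tower_unique[OF t d d, of l l'] that
      mp_inj[OF g, of "P (int k) d" "P (int k') d"] tower_space[OF t d] by auto
  then show ?thesis unfolding partial_inj_def tower_graph_def by (clarsimp; blast)
qed

text \<open>The column is cut into blocks of \<open>L\<close> consecutive levels; these are the
  points that \<open>g\<close> carries to no level of their own block in the same column. The power
  \<open>l - k\<close> moves level \<open>k\<close> to level \<open>l\<close>.\<close>

definition leaves_block :: "'a set \<Rightarrow> nat \<Rightarrow> nat \<Rightarrow> ('a \<Rightarrow> 'a) \<Rightarrow> 'a set" where
  "leaves_block D N L g = (\<Union>k<N. lev D (int k) - (\<Union>b<L. {x \<in> space M. g x = P (int (k div L * L + b) - int k) x}))"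

lemma leaves_block_sets:
  assumes "tower D N" "g \<in> mp_bijections M"
  shows "leaves_block D N L g \<in> sets M"
  unfolding leaves_block_def using assms
  by (intro sets.finite_UN sets.Diff lev_sets mp_eq_sets) (auto simp: tower_sets)

text \<open>A point leaves its block only if \<open>g\<close> moves it by more than \<open>K\<close>
  steps or if it lies within \<open>K\<close> levels of an end of the block, which concerns a
  proportion of at most \<open>2 * K / L\<close> of the levels.\<close>

lemma prob_leaves_block:
  assumes t: "tower D (M' * L)" and L: "L > 0" and M': "M' > 0" and g: "g \<in> mp_bijections M"
  shows "prob (leaves_block D (M' * L) L g) \<le> prob {x \<in> space M. \<forall>k\<in>{-int K..int K}. g x \<noteq> P k x} + 2 * real K / real L"
proof -
  let ?N = "M' * L"
  let ?A = "{x \<in> space M. \<forall>k\<in>{-int K..int K}. g x \<noteq> P k x}"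
  define Q where "Q k \<longleftrightarrow> k mod L < K \<or> L \<le> k mod L + K" for k
  let ?B = "\<Union>k<?N. lev {d \<in> D. Q k} (int k)"
  have As: "?A \<in> sets M"
    by (rule sets.sets_Collect_finite_All) (auto intro: mp_neq_sets g)
  have Qs: "{d \<in> D. Q k} \<in> sets M" for k
    using tower_sets[OF t] by (cases "Q k") auto
  have "card {k \<in> {..<?N}. Q k} \<le> card {k \<in> {..<?N}. True \<and> (k mod L < K \<or> L \<le> k mod L + K)}"
    by (simp add: Q_def)
  also have "\<dots> \<le> card {j \<in> {..<M'}. True} * card {a \<in> {..<L}. a < K \<or> L \<le> a + K}"
    by (rule card_blocks[OF L, where B = "\<lambda>_. True"])
  also have "card {a \<in> {..<L}. a < K \<or> L \<le> a + K} \<le> card ({..<K} \<union> {L - K..<L})"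
    by (intro card_mono) auto
  also have "\<dots> \<le> 2 * K" using card_Un_le[of "{..<K}" "{L - K..<L}"] by simp
  finally have "card {k \<in> {..<?N}. Q k} \<le> M' * (2 * K)" by simp
  then have "real (card {k \<in> {..<?N}. Q k}) \<le> real (M' * (2 * K))" by (simp only: of_nat_le_iff)
  then have c: "real (card {k \<in> {..<?N}. Q k}) \<le> real M' * (2 * real K)" by simp
  have "leaves_block D ?N L g \<subseteq> ?A \<union> ?B"
  proof
    fix x assume "x \<in> leaves_block D ?N L g"
    then obtain k where k: "k < ?N" "x \<in> lev D (int k)"
      "\<And>b. b < L \<Longrightarrow> g x \<noteq> P (int (k div L * L + b) - int k) x"
      by (auto simp: leaves_block_def lev_def)
    have xs: "x \<in> space M" using lev_space[OF k(2)] .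
    show "x \<in> ?A \<union> ?B"
    proof (rule ccontr)
      assume "x \<notin> ?A \<union> ?B"
      then obtain l where l: "- int K \<le> l" "l \<le> int K" "g x = P l x" and nQ: "\<not> Q k"
        using xs k by (auto simp: lev_def)
      define b where "b = nat (int (k mod L) + l)"
      have b: "int b = int (k mod L) + l" "b < L" using nQ l by (auto simp: Q_def b_def)
      have "int k = int (k div L * L) + int (k mod L)"
        by (simp only: of_nat_add[symmetric] div_mult_mod_eq)
      then have "int (k div L * L + b) - int k = l"
        using b(1) unfolding of_nat_add by linarith
      then show False using k(3)[OF b(2)] l(3) by simp
    qed
  qed
  then have "prob (leaves_block D ?N L g) \<le> prob (?A \<union> ?B)"
    using As prob_tower_count(1)[OF t Qs c] by (intro finite_measure_mono) auto
  also have "\<dots> \<le> prob ?A + prob ?B"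
    using As prob_tower_count(1)[OF t Qs c] by (intro measure_Un_le) auto
  also have "prob ?B \<le> real M' * (2 * real K) * prob D"
    by (rule prob_tower_count(2)[OF t Qs c])
  also have "\<dots> \<le> real M' * (2 * real K) * (1 / real ?N)"
    using prob_tower_le[OF t] L M' by (intro mult_left_mono) (auto simp: field_simps)
  also have "\<dots> = 2 * real K / real L" using L M' by (simp add: field_simps)
  finally show ?thesis by simp
qed

text \<open>In the application \<open>\<rho>\<close> depends only on a class, and
  \<open>\<pi>\<close> rearranges each column to fit it. Comparing \<open>S \<rho>\<close> with
  \<open>g S\<close> instead of \<open>S \<rho> S^-1\<close> with \<open>g\<close> avoids inverses
  at no cost, the metric being invariant. The two maps differ only off the tower, on the levels
  \<open>Q\<close>, and where \<open>g\<close> takes \<open>S x\<close> out of its block.\<close>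

lemma block_approx:
  assumes t: "tower D (M' * L)" and L: "L > 0" and g: "g \<in> mp_bijections M"
    and \<pi>: "\<And>d. d \<in> D \<Longrightarrow> \<pi> d permutes {..<M'}"
    and s: "tower_fun D (M' * L) (\<lambda>d. block_perm L (\<pi> d))" and \<rho>: "tower_fun D (M' * L) \<rho>"
    and Q: "\<And>k. k < M' * L \<Longrightarrow> {d \<in> D. Q d k} \<in> sets M"
      "\<And>d. d \<in> D \<Longrightarrow> real (card {k \<in> {..<M' * L}. Q d k}) \<le> c"
    and good: "\<And>d k b. \<lbrakk>d \<in> D; k < M' * L; \<not> Q d k; b < L;
        g (P (int (\<pi> d (k div L) * L + k mod L)) d) = P (int (\<pi> d (k div L) * L + b)) d\<rbrakk>
        \<Longrightarrow> \<rho> d k = k div L * L + b"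
  shows "du (act D (M' * L) (\<lambda>d. block_perm L (\<pi> d)) \<otimes>\<^bsub>mp_group M\<^esub> act D (M' * L) \<rho>)
      (g \<otimes>\<^bsub>mp_group M\<^esub> act D (M' * L) (\<lambda>d. block_perm L (\<pi> d)))
    \<le> prob (space M - tower_set D (M' * L)) + c * prob D + prob (leaves_block D (M' * L) L g)"
proof -
  let ?N = "M' * L"
  let ?S = "act D ?N (\<lambda>d. block_perm L (\<pi> d))" and ?R = "act D ?N \<rho>"
  let ?B = "\<Union>k<?N. lev {d \<in> D. Q d k} (int k)"
  \<comment> \<open>\<open>S\<close> preserves measure, so pulling the exceptional set of
    \<open>g\<close> back along \<open>S\<close> keeps its measure.\<close>
  let ?Z = "{x \<in> space M. ?S x \<in> leaves_block D ?N L g}"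
  have Sm: "?S \<in> mp_bijections M" "?R \<in> mp_bijections M" using act_mp[OF t] s \<rho> by auto
  have Bs: "?B \<in> sets M" by (rule prob_tower_count(1)[OF t Q])
  have Zs: "?Z \<in> sets M" by (rule mp_vimage_sets[OF Sm(1) leaves_block_sets[OF t g]])
  have Os: "space M - tower_set D ?N \<in> sets M" using tower_set_sets[OF tower_sets[OF t]] by blast
  have "x \<in> (space M - tower_set D ?N) \<union> ?B \<union> ?Z"
    if x: "x \<in> space M" and ne: "(?S \<otimes>\<^bsub>mp_group M\<^esub> ?R) x \<noteq> (g \<otimes>\<^bsub>mp_group M\<^esub> ?S) x" for x
    using x
  proof (cases rule: tower_cases[OF t, consumes 1, case_names off on])
    case (on d k)
    have ds: "d \<in> space M" using tower_space[OF t on(1)] .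
    let ?j = "k div L" and ?a = "k mod L"
    let ?l = "\<pi> d ?j * L + ?a"
    have a: "?a < L" using L by simp
    have j: "\<pi> d ?j < M'" using permutes_in_image[OF \<pi>[OF on(1)], of ?j] on(2) L by (simp add: block_lt)
    have lN: "?l < ?N" using j a L by (simp add: block_lt)
    have Sx: "?S x = P (int ?l) d" using act_on[OF t on(1,2)] on(3) by (simp add: block_perm_def)
    show ?thesis
    proof (rule ccontr)
      assume "x \<notin> (space M - tower_set D ?N) \<union> ?B \<union> ?Z"
      then have nB: "x \<notin> ?B" and nZ: "?S x \<notin> leaves_block D ?N L g" using x by auto
      have "x \<in> lev {d \<in> D. Q d k} (int k)" if "Q d k" using that on ds by (simp add: lev_def)
      then have nQ: "\<not> Q d k" using nB on(2) by blast
      have "?S x \<in> lev D (int ?l)"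
        unfolding Sx by (rule P_lev[OF on(1) sets.sets_into_space[OF tower_sets[OF t]]])
      then have "\<exists>b<L. g (?S x) = P (int (?l div L * L + b) - int ?l) (?S x)"
        using nZ lN mp_space[OF Sm(1) x] unfolding leaves_block_def by blast
      moreover have "?l div L = \<pi> d ?j" using L a by simp
      ultimately obtain b where b: "b < L" "g (?S x) = P (int (\<pi> d ?j * L + b) - int ?l) (?S x)"
        by metis
      have gS: "g (?S x) = P (int (\<pi> d ?j * L + b)) d"
        using b(2) P_add[OF ds, of "int (\<pi> d ?j * L + b) - int ?l" "int ?l"]
        unfolding Sx by (simp only: diff_add_cancel)
      have "\<rho> d k = ?j * L + b" using good[OF on(1,2) nQ b(1)] gS Sx by simp
      moreover have "?j * L + b < ?N" using on(2) b(1) L by (simp add: block_lt)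
      ultimately have "?S (?R x) = P (int (\<pi> d ?j * L + b)) d"
        using act_on[OF t on(1,2), of \<rho>] act_on[OF t on(1), of "?j * L + b" "\<lambda>d. block_perm L (\<pi> d)"] on(3) b(1) L
        by (simp add: block_perm_def)
      then show False using ne gS x Sm g by (simp add: mp_mult)
    qed
  qed (use x in auto)
  then have "du (?S \<otimes>\<^bsub>mp_group M\<^esub> ?R) (g \<otimes>\<^bsub>mp_group M\<^esub> ?S)
      \<le> prob ((space M - tower_set D ?N) \<union> ?B \<union> ?Z)"
    using Os Bs Zs by (intro du_le) blast+
  also have "\<dots> \<le> prob ((space M - tower_set D ?N) \<union> ?B) + prob ?Z"
    using Os Bs Zs by (intro measure_Un_le) auto
  also have "\<dots> \<le> prob (space M - tower_set D ?N) + prob ?B + prob ?Z"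
    using measure_Un_le[OF Os Bs] by simp
  also have "prob ?B \<le> c * prob D" by (rule prob_tower_count(2)[OF t Q])
  also have "prob ?Z = prob (leaves_block D ?N L g)"
    by (rule mp_measure(2)[OF Sm(1) leaves_block_sets[OF t g]])
  finally show ?thesis by simp
qed

end

section \<open>Generating the permutations of a tower\<close>

lemma funpow_comp_commute:
  assumes "f \<circ> g = g \<circ> f"
  shows "(f \<circ> g) ^^ n = (f ^^ n) \<circ> (g ^^ n)"
proof (induction n)
  case (Suc n)
  have "f ((g ^^ n) x) = (g ^^ n) (f x)" for x n
  proof (induction n)
    case (Suc n)
    then show ?case using assms by (metis comp_apply funpow.simps(2))
  qed simp
  then have "g ((f ^^ n) x) = (f ^^ n) (g x)" for x n
  proof (induction n)
    case (Suc n)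
    then show ?case using assms by (metis comp_apply funpow.simps(2))
  qed simp
  then show ?case using Suc by (simp add: fun_eq_iff)
qed simp

context mp_map
begin

text \<open>The order of \<open>c\<close> is coprime to that of \<open>u\<close>, so a power of the product is \<open>c\<close>. The commutator of \<open>c\<close>
  with its shift by \<open>K i\<close> then is a three-cycle on the \<open>i\<close>-th class and trivial on the others.\<close>

lemma coding_generates:
  fixes cl :: "'a \<Rightarrow> nat"
  assumes t: "tower D N"
    and cl: "\<And>i. {d \<in> D. cl d = i} \<in> sets M" "\<And>d. d \<in> D \<Longrightarrow> cl d < r"
    and W: "2 * W \<le> N" and m: "m \<ge> 1"
    and c: "\<And>i. i < r \<Longrightarrow> c i permutes {..<W}" "\<And>i. i < r \<Longrightarrow> c i ^^ Suc m = id"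
      "\<And>i. i < r \<Longrightarrow> K i \<le> W" "\<And>i. i < r \<Longrightarrow> q i + 2 < 2 * W"
    and com: "\<And>i i'. i < r \<Longrightarrow> i' < r \<Longrightarrow>
      c i' \<circ> shift_perm (K i) (c i') \<circ> inv_into UNIV (c i') \<circ> inv_into UNIV (shift_perm (K i) (c i'))
        = (if i = i' then three_cyc (q i) else id)"
    and u: "\<And>i. i < r \<Longrightarrow> u i permutes {W..<N}" "\<And>i. i < r \<Longrightarrow> u i ^^ m = id"
    and h: "\<And>i. i < r \<Longrightarrow> h i \<in> consec N"
    and H: "subgroup H (mp_group M)" "f \<in> H" "act D N (\<lambda>d. u (cl d) \<circ> c (cl d)) \<in> H"
  shows "act D N (\<lambda>d. h (cl d)) \<in> H"
proof -
  have tf: "tower_fun D N (\<lambda>d. F (cl d))" if "\<And>i. i < r \<Longrightarrow> F i permutes {..<N}" for F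
  proof (rule tower_fun_pattern[OF t cl(1)])
    show "finite (cl ` D)" by (rule finite_subset[of _ "{..<r}"]) (use cl(2) in auto)
  qed (use that cl(2) in auto)
  have cong: "act D N (\<lambda>d. F (cl d)) = act D N (\<lambda>d. F' (cl d))" if "\<And>i. i < r \<Longrightarrow> F i = F' i" for F F'
    by (rule act_cong[OF t]) (use that cl(2) in auto)
  have mulH: "act D N (\<lambda>d. F (cl d) \<circ> F' (cl d)) \<in> H"
    if "\<And>i. i < r \<Longrightarrow> F i permutes {..<N}" "\<And>i. i < r \<Longrightarrow> F' i permutes {..<N}"
      "act D N (\<lambda>d. F (cl d)) \<in> H" "act D N (\<lambda>d. F' (cl d)) \<in> H" for F F'
    using subgroup.m_closed[OF H(1) that(3,4)] act_mult[OF t tf[of F, OF that(1)] tf[of F', OF that(2)]] by simp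
  have idH: "act D N (\<lambda>d. id) \<in> H"
    using subgroup.one_closed[OF H(1)] act_one[OF t] by simp
  have invH: "act D N (\<lambda>d. inv_into UNIV (F (cl d))) \<in> H"
    if "\<And>i. i < r \<Longrightarrow> F i permutes {..<N}" "act D N (\<lambda>d. F (cl d)) \<in> H" for F
    using subgroup.m_inv_closed[OF H(1) that(2)] act_inv[OF t tf[of F, OF that(1)]] by simp
  have powp: "F ^^ n permutes {..<N}" if "F permutes {..<N}" for F :: "nat \<Rightarrow> nat" and n
  proof (induction n)
    case (Suc n)
    show ?case unfolding funpow.simps using permutes_compose[OF Suc that] .
  qed (simp only: funpow.simps permutes_id)
  have powH: "act D N (\<lambda>d. F (cl d) ^^ n) \<in> H"
    if F: "\<And>i. i < r \<Longrightarrow> F i permutes {..<N}" "act D N (\<lambda>d. F (cl d)) \<in> H" for F n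
  proof (induction n)
    case 0
    show ?case unfolding funpow.simps by (rule idH)
  next
    case (Suc n)
    show ?case unfolding funpow.simps
      by (rule mulH[of F "\<lambda>i. F i ^^ n"]) (use F powp Suc in auto)
  qed
  have cN: "c i permutes {..<N}" and uN: "u i permutes {..<N}" if "i < r" for i
    by (rule permutes_subset[OF c(1)[OF that]], use W in \<open>auto; fail\<close>)
      (rule permutes_subset[OF u(1)[OF that]], auto)
  have PH: "P j \<in> H" for j
    using G.subgroup_int_pow_closed[OF H(1,2)] by (simp add: P_def)
  have conjH: "P j \<otimes>\<^bsub>mp_group M\<^esub> x \<otimes>\<^bsub>mp_group M\<^esub> P (- j) \<in> H" if "x \<in> H" for j x
    using subgroup.m_closed[OF H(1)] PH that by blast

  have cH: "act D N (\<lambda>d. c (cl d)) \<in> H"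
  proof -
    \<comment> \<open>\<open>m * m\<close> is a multiple of \<open>m\<close> and equals 1 modulo
      \<open>m + 1\<close>, so this power kills \<open>u\<close> and keeps \<open>c\<close>.\<close>
    have "act D N (\<lambda>d. (u (cl d) \<circ> c (cl d)) ^^ (m * m)) \<in> H"
      by (rule powH[of "\<lambda>i. u i \<circ> c i"]) (use H(3) permutes_compose[OF cN uN] in auto)
    moreover have uc: "(u i \<circ> c i) ^^ (m * m) = c i" if i: "i < r" for i
    proof -
      have "(u i \<circ> c i) k = (c i \<circ> u i) k" for k
      proof (cases "k < W")
        case True
        then have "c i k < W" using permutes_in_image[OF c(1)[OF i], of k] by simp
        then show ?thesis using True u(1)[OF i] by (simp add: permutes_def)
      next
        case False
        have "\<not> u i k < W"
        proof (cases "k < N")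
          case True
          then show ?thesis using False permutes_in_image[OF u(1)[OF i], of k] by simp
        next
          case False
          then show ?thesis using \<open>\<not> k < W\<close> u(1)[OF i] by (simp add: permutes_def)
        qed
        then show ?thesis using False c(1)[OF i] by (simp add: permutes_def)
      qed
      then have "(u i \<circ> c i) ^^ (m * m) = (u i ^^ (m * m)) \<circ> (c i ^^ (m * m))"
        by (intro funpow_comp_commute) (simp add: fun_eq_iff)
      also have "u i ^^ (m * m) = id"
        using u(2)[OF i] by (simp add: funpow_mult[symmetric] funpow_id)
      also have "c i ^^ (m * m) = c i"
      proof -
        have "m * m = Suc m * (m - 1) + 1" using m by (cases m) auto
        then have "c i ^^ (m * m) = (c i ^^ (Suc m * (m - 1))) \<circ> c i"
          by (simp only: funpow_add One_nat_def funpow.simps o_id)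
        also have "c i ^^ (Suc m * (m - 1)) = id"
          unfolding funpow_mult[symmetric] c(2)[OF i] by (rule funpow_id)
        finally show ?thesis by (simp only: id_o)
      qed
      finally show ?thesis by (simp only: id_o)
    qed
    ultimately show ?thesis
      using cong[of "\<lambda>i. (u i \<circ> c i) ^^ (m * m)" c, OF uc] by (simp only:)
  qed

  have tcN: "three_cyc j permutes {..<j + 3}" for j
    by (rule permutes_subset[OF three_cyc_permutes]) auto
  \<comment> \<open>One commutator, formed in all classes at once, singles out class
    \<open>i\<close>: only there does the shift by \<open>K i\<close> make the supports
    meet.\<close>
  have sel: "act D N (\<lambda>d. if cl d = i then three_cyc (q i) else id) \<in> H" if i: "i < r" for i
  proof -
    let ?s = "\<lambda>i'. shift_perm (K i) (c i')"
    have sN: "?s i' permutes {..<N}" if "i' < r" for i'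
      by (rule permutes_subset[OF shift_perm_permutes[OF c(1)[OF that]]]) (use W c(3)[OF i] in auto)
    have "P (int (K i)) \<otimes>\<^bsub>mp_group M\<^esub> act D N (\<lambda>d. c (cl d)) \<otimes>\<^bsub>mp_group M\<^esub> P (- int (K i)) = act D N (\<lambda>d. ?s (cl d))"
      by (rule act_shift(2)[OF t tf[of c, OF cN], of W]) (use c(1) cl(2) c(3)[OF i] W in auto)
    then have sH: "act D N (\<lambda>d. ?s (cl d)) \<in> H" using conjH[OF cH, of "int (K i)"] by simp
    have "act D N (\<lambda>d. (c (cl d) \<circ> ?s (cl d)) \<circ> (inv_into UNIV (c (cl d)) \<circ> inv_into UNIV (?s (cl d)))) \<in> H"
    proof (rule mulH[of "\<lambda>i'. c i' \<circ> ?s i'" "\<lambda>i'. inv_into UNIV (c i') \<circ> inv_into UNIV (?s i')"])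
      show "act D N (\<lambda>d. c (cl d) \<circ> ?s (cl d)) \<in> H"
        by (rule mulH[of c ?s]) (use cN sN cH sH in auto)
      show "act D N (\<lambda>d. inv_into UNIV (c (cl d)) \<circ> inv_into UNIV (?s (cl d))) \<in> H"
        by (rule mulH[of "\<lambda>i'. inv_into UNIV (c i')" "\<lambda>i'. inv_into UNIV (?s i')"])
          (use permutes_inv[OF cN] permutes_inv[OF sN] invH[of c, OF cN cH] invH[of ?s, OF sN sH] in auto)
    qed (use permutes_compose[OF sN cN] permutes_compose[OF permutes_inv[OF sN] permutes_inv[OF cN]] in auto)
    moreover have "(c i' \<circ> ?s i') \<circ> (inv_into UNIV (c i') \<circ> inv_into UNIV (?s i'))
        = (if i' = i then three_cyc (q i) else id)" if "i' < r" for i'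
      using com[OF i that] unfolding o_assoc eq_commute[of i i'] .
    ultimately show ?thesis
      using cong[of "\<lambda>i'. (c i' \<circ> ?s i') \<circ> (inv_into UNIV (c i') \<circ> inv_into UNIV (?s i'))"
          "\<lambda>i'. if i' = i then three_cyc (q i) else id"] by (simp only:)
  qed

  have shift_tc: "shift_perm a (three_cyc j) = three_cyc (j + a)" for a j
    by (auto simp: shift_perm_def three_cyc_def fun_eq_iff)
  have shift_id: "shift_perm a id = id" for a by (auto simp: shift_perm_def fun_eq_iff)
  define X where "X i j = act D N (\<lambda>d. if cl d = i then three_cyc j else id)" for i j
  have Xtf: "tower_fun D N (\<lambda>d. if cl d = i then three_cyc j else id)" if "j + 2 < N" for i j
    by (rule tf[of "\<lambda>i'. if i' = i then three_cyc j else id"])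
      (use that permutes_subset[OF tcN, of j "{..<N}"] permutes_id in auto)
  have Xshift: "P (int a) \<otimes>\<^bsub>mp_group M\<^esub> X i j \<otimes>\<^bsub>mp_group M\<^esub> P (- int a) = X i (j + a)" if "j + a + 2 < N" for i j a
  proof -
    have "P (int a) \<otimes>\<^bsub>mp_group M\<^esub> X i j \<otimes>\<^bsub>mp_group M\<^esub> P (- int a) =
        act D N (\<lambda>d. shift_perm a (if cl d = i then three_cyc j else id))"
      unfolding X_def by (rule act_shift(2)[OF t Xtf, of j i "j + 3"]) (use that tcN permutes_id in auto)
    also have "\<dots> = X i (j + a)"
      unfolding X_def by (rule act_cong[OF t]) (simp add: shift_tc shift_id)
    finally show ?thesis .
  qed
  have Xm: "X i j \<in> mp_bijections M" if "j + 2 < N" for i j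
    unfolding X_def by (rule act_mp[OF t Xtf[OF that]])
  have XH: "X i j \<in> H" if i: "i < r" and j: "j + 2 < N" for i j
  proof (cases "q i \<le> j")
    case True
    then show ?thesis
      using Xshift[of "q i" "j - q i" i] conjH[OF sel[OF i], of "int (j - q i)"] j by (simp add: X_def)
  next
    case False
    \<comment> \<open>\<open>act_shift\<close> moves levels up. To reach a lower \<open>j\<close>,
      the known element is recognised as an upward shift of the wanted one, and that shift is
      undone.\<close>
    let ?a = "int (q i - j)"
    have qN: "q i + 2 < N" using c(4)[OF i] W by simp
    then have "X i (q i) = P ?a \<otimes>\<^bsub>mp_group M\<^esub> X i j \<otimes>\<^bsub>mp_group M\<^esub> P (- ?a)"
      using Xshift[of j "q i - j" i] False by simp
    then have "P (- ?a) \<otimes>\<^bsub>mp_group M\<^esub> X i (q i) \<otimes>\<^bsub>mp_group M\<^esub> P (- (- ?a)) \<in> H"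
      and eq: "X i (q i) = P ?a \<otimes>\<^bsub>mp_group M\<^esub> X i j \<otimes>\<^bsub>mp_group M\<^esub> P (- ?a)"
      using conjH[OF sel[OF i], of "- ?a"] by (simp_all add: X_def)
    moreover have "P (- ?a) \<otimes>\<^bsub>mp_group M\<^esub> X i (q i) \<otimes>\<^bsub>mp_group M\<^esub> P (- (- ?a)) = X i j"
    proof (rule mp_eqI[where M = M])
      fix x assume x: "x \<in> space M"
      then show "(P (- ?a) \<otimes>\<^bsub>mp_group M\<^esub> X i (q i) \<otimes>\<^bsub>mp_group M\<^esub> P (- (- ?a))) x = X i j x"
        unfolding eq using Xm[OF j, of i] mp_space[OF Xm[OF j, of i] x] by (simp add: mp_mult mp_closed)
    qed (use Xm[OF j, of i] Xm[OF qN, of i] in \<open>auto simp: mp_closed\<close>)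
    ultimately show ?thesis by simp
  qed

  have one: "act D N (\<lambda>d. if cl d = i then g else id) \<in> H" if i: "i < r" and g: "g \<in> consec N" for i g
    using g
  proof (induction rule: consec.induct)
    case id
    then show ?case using idH by (simp only: if_cancel)
  next
    case (step g j)
    have "act D N (\<lambda>d. (if cl d = i then three_cyc j else id) \<circ> (if cl d = i then g else id)) \<in> H"
      by (rule mulH[of "\<lambda>i'. if i' = i then three_cyc j else id" "\<lambda>i'. if i' = i then g else id"])
        (use XH[OF i step(2)] step permutes_subset[OF tcN, of j "{..<N}"] permutes_id consec_permutes[OF step(1)]
          in \<open>auto simp: X_def\<close>)
    moreover have "(if b then three_cyc j else id) \<circ> (if b then g else id) = (if b then three_cyc j \<circ> g else id)" for b
      by auto
    ultimately show ?case by (simp only:)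
  qed
  \<comment> \<open>Elements that act on single classes are now composed; \<open>n\<close> counts
    the classes already treated.\<close>
  have "act D N (\<lambda>d. if cl d < n then h (cl d) else id) \<in> H" if "n \<le> r" for n
    using that
  proof (induction n)
    case 0
    show ?case using idH by (simp only: not_less0 if_False)
  next
    case (Suc n)
    have n: "n < r" using Suc.prems by simp
    have "act D N (\<lambda>d. (if cl d = n then h n else id) \<circ> (if cl d < n then h (cl d) else id)) \<in> H"
      by (rule mulH[of "\<lambda>i'. if i' = n then h n else id" "\<lambda>i'. if i' < n then h i' else id"])
        (use Suc one[OF n h[OF n]] consec_permutes[OF h] permutes_id in auto)
    moreover have "(if i = n then h n else id) \<circ> (if i < n then h i else id) = (if i < Suc n then h i else id)" for i
      by (auto simp: less_Suc_eq)
    ultimately show ?case by (simp only:)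
  qed
  from this[of r] have "act D N (\<lambda>d. if cl d < r then h (cl d) else id) \<in> H" by simp
  moreover have "act D N (\<lambda>d. if cl d < r then h (cl d) else id) = act D N (\<lambda>d. h (cl d))"
    by (rule cong[of "\<lambda>i. if i < r then h i else id"]) simp
  ultimately show ?thesis by (simp only:)
qed

end

section \<open>Density\<close>

text \<open>The letters of the words to be rearranged. Levels are counted from the bottom of the
  block, so that equal letters can occur in different blocks.\<close>

definition block_graph :: "nat \<Rightarrow> (nat \<times> nat) set \<Rightarrow> nat \<Rightarrow> (nat \<times> nat) set" where
  "block_graph L p j = {(a, b). a < L \<and> b < L \<and> (j * L + a, j * L + b) \<in> p}"

lemma partial_inj_block_graph: "partial_inj p \<Longrightarrow> partial_inj (block_graph L p j)"
  unfolding partial_inj_def block_graph_def by fastforce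

lemma block_graph_Pow: "block_graph L p j \<in> Pow ({..<L} \<times> {..<L})"
  by (auto simp: block_graph_def)

text \<open>One permutation is fixed for each \<open>p\<close>, so that the pattern determines it.
  For a \<open>p\<close> that cannot be extended the choice is an arbitrary permutation of the
  block, which makes the permutation property unconditional.\<close>

definition extension :: "nat \<Rightarrow> (nat \<times> nat) set \<Rightarrow> nat \<Rightarrow> nat" where
  "extension L p = (SOME \<sigma>. \<sigma> permutes {..<L} \<and>
     (partial_inj p \<and> p \<subseteq> {..<L} \<times> {..<L} \<longrightarrow> (\<forall>e\<in>p. \<sigma> (fst e) = snd e)))"

lemma extension: "extension L p permutes {..<L}"
  "\<lbrakk>partial_inj p; p \<subseteq> {..<L} \<times> {..<L}; (a, b) \<in> p\<rbrakk> \<Longrightarrow> extension L p a = b"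
proof -
  have "\<exists>\<sigma>. \<sigma> permutes {..<L} \<and> (partial_inj p \<and> p \<subseteq> {..<L} \<times> {..<L} \<longrightarrow> (\<forall>e\<in>p. \<sigma> (fst e) = snd e))"
  proof (cases "partial_inj p \<and> p \<subseteq> {..<L} \<times> {..<L}")
    case True
    then show ?thesis using partial_inj_extend[of "{..<L}" p] by blast
  next
    case False
    then show ?thesis using permutes_id by blast
  qed
  from someI_ex[OF this] have "extension L p permutes {..<L} \<and>
      (partial_inj p \<and> p \<subseteq> {..<L} \<times> {..<L} \<longrightarrow> (\<forall>e\<in>p. extension L p (fst e) = snd e))"
    unfolding extension_def .
  then show "extension L p permutes {..<L}"
    "\<lbrakk>partial_inj p; p \<subseteq> {..<L} \<times> {..<L}; (a, b) \<in> p\<rbrakk> \<Longrightarrow> extension L p a = b"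
    by fastforce+
qed

lemma real_div_small:
  assumes "(\<delta> :: real) > 0"
  shows "\<exists>n0. \<forall>n\<ge>n0. n > 0 \<and> c / real n < \<delta>"
proof -
  obtain n0 :: nat where n0: "real n0 > \<bar>c\<bar> / \<delta>" using reals_Archimedean2 by blast
  have "n > 0 \<and> c / real n < \<delta>" if "n \<ge> Suc n0" for n
  proof -
    have "real n > \<bar>c\<bar> / \<delta>" using n0 that by linarith
    then have "\<bar>c\<bar> < \<delta> * real n" using assms by (simp add: field_simps)
    then show ?thesis using that by (simp add: field_simps)
  qed
  then show ?thesis by blast
qed

lemma (in mp_map) pattern_sets:
  assumes "\<And>p. {d \<in> D. pat d = p} \<in> sets M" "finite (pat ` D)"
  shows "{d \<in> D. R (pat d)} \<in> sets M"
proof -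
  have "{d \<in> D. R (pat d)} = (\<Union>p\<in>{p \<in> pat ` D. R p}. {d \<in> D. pat d = p})" by auto
  also have "\<dots> \<in> sets M" using assms by (intro sets.finite_UN) auto
  finally show ?thesis .
qed

context aper_map
begin

text \<open>Transitions of \<open>g\<close> are given up only where they touch a level below
  \<open>W\<close>, at most \<open>2 * W\<close> levels in each column. Over every base point the
  word carries level \<open>v (length w)\<close> to a different level, and the tower is not
  null.\<close>

lemma dense_nontrivial:
  assumes w: "reduced w" "w \<noteq> []" and g: "g \<in> full_mp M f" and e: "\<epsilon> > 0"
  shows "\<exists>u\<in>full_mp M f. du u g < \<epsilon> \<and>
    \<not> (AE x in M. word_val (mp_group M) (\<lambda>s. if s then f else u) w x = x)"
proof -
  have gm: "g \<in> mp_bijections M" by (rule full_mp_mp[OF g])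
  let ?n = "length w"
  obtain v :: "nat \<Rightarrow> nat" where v: "inj_on v {..?n}"
    "\<And>i. i < ?n \<Longrightarrow> w ! i = (True, True) \<Longrightarrow> v i = Suc (v (Suc i))"
    "\<And>i. i < ?n \<Longrightarrow> w ! i = (False, True) \<Longrightarrow> v (Suc i) = Suc (v i)"
    using word_positions[OF w(1)] by blast
  define W where "W = Suc (Max (v ` {..?n}))"
  have vW: "v i < W" if "i \<le> ?n" for i
    using that by (auto simp: W_def less_Suc_eq_le intro!: Max_ge)
  \<comment> \<open>The errors are one \<open>\<delta>\<close> outside the tower, one for the
    redefined levels and two for leaving the column; the bound 1/2 keeps the tower from being
    null.\<close>
  define \<delta> where "\<delta> = min (\<epsilon> / 4) (1 / 2)"
  have \<delta>: "\<delta> > 0" "4 * \<delta> \<le> \<epsilon>" "\<delta> \<le> 1 / 2" using e by (auto simp: \<delta>_def)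
  obtain K where K: "prob {x \<in> space M. \<forall>k\<in>{-int K..int K}. g x \<noteq> P k x} < \<delta>"
    using full_bounded[OF g \<delta>(1)] by blast
  obtain n1 n2 where n1: "\<And>n. n \<ge> n1 \<Longrightarrow> n > 0 \<and> 2 * real K / real n < \<delta>"
    and n2: "\<And>n. n \<ge> n2 \<Longrightarrow> n > 0 \<and> 2 * real W / real n < \<delta>"
    using real_div_small[OF \<delta>(1), of "2 * real K"] real_div_small[OF \<delta>(1), of "2 * real W"] by meson
  define N where "N = max W (max n1 n2)"
  have N: "N > 0" "2 * real K / real N < \<delta>" "2 * real W / real N < \<delta>" "W \<le> N"
    using n1[of N] n2[of N] by (auto simp: N_def)
  obtain D where t: "tower D N" and D: "prob (space M - tower_set D N) < \<delta>"
    using Rokhlin[OF N(1) \<delta>(1)] by blast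
  have Ds: "D \<in> sets M" by (rule tower_sets[OF t])
  define pat where "pat = tower_graph N g"
  have pat: "\<And>p. {d \<in> D. pat d = p} \<in> sets M" "finite (pat ` D)"
    using tower_graph_sets[OF t gm] tower_graph_finite by (auto simp: pat_def)
  have pinj: "partial_inj (pat d)" if "d \<in> D" for d
    unfolding pat_def by (rule partial_inj_tower_graph[OF t gm that])
  have psub: "pat d \<subseteq> {..<N} \<times> {..<N}" for d by (auto simp: pat_def tower_graph_def)
  let ?E = "path_edges w v False"
  define q where "q p = {e \<in> p. W \<le> fst e \<and> W \<le> snd e} \<union> ?E" for p
  define \<rho> where "\<rho> d = extension N (q (pat d))" for d
  have Esub: "?E \<subseteq> {..<W} \<times> {..<W}"
    using path_edges_subset[of w v False] vW by fastforce
  have qsub: "q (pat d) \<subseteq> {..<N} \<times> {..<N}" for d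
    using psub[of d] Esub N(4) by (fastforce simp: q_def)
  have qinj: "partial_inj (q (pat d))" if "d \<in> D" for d
  proof -
    have E: "partial_inj ?E" by (rule partial_inj_path_edges[OF w(1) v(1)])
    have EW: "fst a < W \<and> snd a < W" if "a \<in> ?E" for a using Esub that by auto
    show ?thesis
      unfolding partial_inj_def
    proof (intro ballI)
      fix a b assume "a \<in> q (pat d)" "b \<in> q (pat d)"
      then consider "a \<in> ?E" "b \<in> ?E" | "a \<in> pat d" "b \<in> pat d"
        | "a \<in> ?E" "W \<le> fst b" "W \<le> snd b" | "b \<in> ?E" "W \<le> fst a" "W \<le> snd a"
        unfolding q_def by blast
      then show "fst a = fst b \<longleftrightarrow> snd a = snd b"
      proof cases
        case 1
        then show ?thesis using E by (simp add: partial_inj_def)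
      next
        case 2
        then show ?thesis using pinj[OF that] by (simp add: partial_inj_def)
      next
        case 3
        then show ?thesis using EW[of a] by auto
      next
        case 4
        then show ?thesis using EW[of b] by auto
      qed
    qed
  qed
  have \<rho>: "tower_fun D N \<rho>"
    unfolding \<rho>_def by (rule tower_fun_pattern[OF t pat, of "\<lambda>p. extension N (q p)"]) (rule extension)
  define Q where "Q d k \<longleftrightarrow> k < W \<or> (\<exists>l<W. (k, l) \<in> pat d)" for d k
  have Qs: "{d \<in> D. Q d k} \<in> sets M" for k
    unfolding Q_def by (rule pattern_sets[OF pat])
  have Qc: "real (card {k \<in> {..<N}. Q d k}) \<le> 2 * real W" if d: "d \<in> D" for d
  proof -
    let ?B = "{k. \<exists>l<W. (k, l) \<in> pat d}"
    have fB: "finite ?B" by (rule finite_subset[of _ "{..<N}"]) (use psub[of d] in auto)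
    define l where "l k = (SOME l. l < W \<and> (k, l) \<in> pat d)" for k
    have l: "l k < W \<and> (k, l k) \<in> pat d" if "k \<in> ?B" for k
      unfolding l_def by (rule someI_ex) (use that in auto)
    have "inj_on l ?B"
    proof (rule inj_onI)
      fix k k' assume "k \<in> ?B" "k' \<in> ?B" "l k = l k'"
      then have "(k, l k) \<in> pat d" "(k', l k) \<in> pat d" using l[of k] l[of k'] by simp_all
      then show "k = k'" using pinj[OF d] unfolding partial_inj_def by (metis fst_conv snd_conv)
    qed
    moreover have "l ` ?B \<subseteq> {..<W}" using l by auto
    ultimately have "card ?B \<le> card {..<W}" by (rule card_inj_on_le) simp
    moreover have "card {k \<in> {..<N}. Q d k} \<le> card ({..<W} \<union> ?B)"
      using fB by (intro card_mono) (auto simp: Q_def)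
    moreover have "card ({..<W} \<union> ?B) \<le> card {..<W} + card ?B" by (rule card_Un_le)
    ultimately have "card {k \<in> {..<N}. Q d k} \<le> 2 * W" by simp
    then show ?thesis by linarith
  qed
  let ?u = "act D N \<rho>"
  have um: "?u \<in> mp_bijections M" by (rule act_mp[OF t \<rho>])
  have bp: "block_perm N id = id" by (auto simp: block_perm_def fun_eq_iff)
  \<comment> \<open>The whole column serves as a single block, with trivial rearrangement.\<close>
  have "du (act D N (\<lambda>d. block_perm N id) \<otimes>\<^bsub>mp_group M\<^esub> ?u) (g \<otimes>\<^bsub>mp_group M\<^esub> act D N (\<lambda>d. block_perm N id))
      \<le> prob (space M - tower_set D N) + 2 * real W * prob D + prob (leaves_block D N N g)"
  proof (rule block_approx[where M' = 1 and L = N and D = D and \<pi> = "\<lambda>d. id" and Q = Q, unfolded mult_1])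
    show "tower_fun D N (\<lambda>d. block_perm N id)" unfolding bp by (rule tower_fun_id[OF t])
    fix d k b assume d: "d \<in> D" "k < N" "\<not> Q d k" "b < N"
      and eq: "g (P (int (id (k div N) * N + k mod N)) d) = P (int (id (k div N) * N + b)) d"
    have "(k, b) \<in> pat d" using eq d by (simp add: pat_def tower_graph_def)
    then have "(k, b) \<in> q (pat d)" using d(3) by (auto simp: Q_def q_def not_less)
    then show "\<rho> d k = k div N * N + b"
      using extension(2)[OF qinj[OF d(1)] qsub] d(2) by (simp add: \<rho>_def)
  qed (use t N(1) gm permutes_id \<rho> Qs Qc in auto)
  then have "du ?u g \<le> prob (space M - tower_set D N) + 2 * real W * prob D + prob (leaves_block D N N g)"
    using um gm unfolding bp act_one[OF t] by simp
  moreover have "2 * real W * prob D \<le> 2 * real W * (1 / real N)"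
    using prob_tower_le[OF t] N(1) by (intro mult_left_mono) (auto simp: field_simps)
  moreover have "prob (leaves_block D N N g) < 2 * \<delta>"
    using prob_leaves_block[of D 1 N g K] t N gm K by simp
  ultimately have "du ?u g < \<epsilon>" using D N(3) \<delta>(2) by simp
  moreover have "\<not> (AE x in M. word_val (mp_group M) (\<lambda>s. if s then f else ?u) w x = x)"
  proof
    let ?F = "\<lambda>s. if s then f else ?u"
    interpret F: group_family "mp_group M" ?F
      by (rule G.group_family) (use um f_mp in auto)
    assume ae: "AE x in M. word_val (mp_group M) ?F w x = x"
    have path: "word_val (mp_group M) ?F w (P (int (v ?n)) d) = P (int (v 0)) d" if d: "d \<in> D" for d
    proof (rule F.word_val_path[where \<phi> = "\<lambda>h. h" and X = "space M" and v = "\<lambda>i. P (int (v i)) d"])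
      have ds: "d \<in> space M" by (rule tower_space[OF t d])
      show "P (int (v i)) d \<in> space M" for i using ds by simp
      have fP: "f (P (int k) d) = P (int (Suc k)) d" for k
        using P_add[OF ds, of 1 "int k"] by (simp add: P_1)
      have uP: "?u (P (int a) d) = P (int b) d" if "(a, b) \<in> ?E" for a b
      proof -
        have "a < N" using that Esub N(4) by auto
        moreover have "\<rho> d a = b"
          unfolding \<rho>_def by (rule extension(2)[OF qinj[OF d] qsub]) (use that in \<open>simp add: q_def\<close>)
        ultimately show ?thesis using act_on[OF t d] by simp
      qed
      show "?F s (P (int (v (Suc i))) d) = P (int (v i)) d" if "i < ?n" "w ! i = (True, s)" for i s
      proof (cases s)
        case True
        then show ?thesis using fP[of "v (Suc i)"] v(2)[of i] that by simp
      next
        case False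
        then show ?thesis using that by (auto simp: path_edges_def intro!: uP)
      qed
      show "?F s (P (int (v i)) d) = P (int (v (Suc i))) d" if "i < ?n" "w ! i = (False, s)" for i s
      proof (cases s)
        case True
        then show ?thesis using fP[of "v i"] v(3)[of i] that by simp
      next
        case False
        then show ?thesis using that by (auto simp: path_edges_def intro!: uP)
      qed
    qed (auto simp: mp_mult one_mp_group)
    have "AE x in M. x \<notin> lev D (int (v ?n))"
      using ae
    proof eventually_elim
      case (elim x)
      show ?case
      proof
        assume "x \<in> lev D (int (v ?n))"
        then obtain d where d: "d \<in> D" "x = P (int (v ?n)) d" using lev_E by blast
        then have "P (int (v 0)) d = P (int (v ?n)) d" using path elim by simp
        moreover have "v 0 < N" "v ?n < N" using vW[of 0] vW[of ?n] N(4) by auto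
        ultimately have "v 0 = v ?n" using tower_unique[OF t d(1) d(1)] by blast
        then show False using inj_onD[OF v(1), of 0 ?n] w(2) by simp
      qed
    qed
    then have "prob (lev D (int (v ?n))) = 0" using lev_sets[OF Ds] prob_eq_0 by blast
    then have "prob (tower_set D N) = 0" using prob_tower[OF t] prob_lev[OF Ds] by simp
    moreover have "prob (space M - tower_set D N) = 1 - prob (tower_set D N)"
      by (rule prob_compl[OF tower_set_sets[OF Ds]])
    ultimately show False using D \<delta>(3) by simp
  qed
  ultimately show ?thesis using act_full[OF t \<rho>] by blast
qed

text \<open>A tower of \<open>f\<close> carries far too many patterns of \<open>u0\<close> and \<open>v0\<close> for a small set to code them.
  Conjugating by a permutation \<open>S\<close> of blocks moves \<open>f\<close> only at the ends of blocks, and it brings all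
  patterns close to one of boundedly many.\<close>

lemma dense_generation:
  assumes u0: "u0 \<in> full_mp M f" and v0: "v0 \<in> full_mp M f" and e: "\<epsilon> > 0"
  shows "\<exists>T u y. T \<in> full_mp M f \<and> f \<in> full_mp M T \<and> u \<in> full_mp M f \<and> y \<in> generate (mp_group M) {T, u} \<and>
    du T f < \<epsilon> \<and> du u u0 < \<epsilon> \<and> du y v0 < \<epsilon>"
proof -
  have um: "u0 \<in> mp_bijections M" and vm: "v0 \<in> mp_bijections M" using full_mp_mp u0 v0 by auto
  \<comment> \<open>Approximating \<open>u0\<close> or \<open>v0\<close> costs less than five
    \<open>\<delta>\<close>: one off the tower, two for bad levels and two for leaving
    blocks.\<close>
  define \<delta> where "\<delta> = \<epsilon> / 6"
  have \<delta>: "\<delta> > 0" using e by (simp add: \<delta>_def)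
  obtain Ku Kv where Ku: "prob {x \<in> space M. \<forall>k\<in>{-int Ku..int Ku}. u0 x \<noteq> P k x} < \<delta>"
    and Kv: "prob {x \<in> space M. \<forall>k\<in>{-int Kv..int Kv}. v0 x \<noteq> P k x} < \<delta>"
    using full_bounded[OF u0 \<delta>] full_bounded[OF v0 \<delta>] by blast
  \<comment> \<open>The lower bound 1 for \<open>K\<close> also makes \<open>1 / L\<close> small,
    the proportion of block ends.\<close>
  define K where "K = max 1 (max Ku Kv)"
  obtain L where L: "L > 0" "2 * real K / real L < \<delta>"
    using real_div_small[OF \<delta>, of "2 * real K"] by blast
  have K': "2 * real Ku / real L < \<delta>" "2 * real Kv / real L < \<delta>" "1 / real L < \<delta>"
    using L by (auto intro!: order.strict_trans1[OF divide_right_mono L(2)] simp: K_def)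
  define \<Theta> where "\<Theta> = Pow ({..<L} \<times> {..<L}) \<times> Pow ({..<L} \<times> {..<L})"
  have \<Theta>: "finite \<Theta>" by (simp add: \<Theta>_def)
  obtain J where J: "J > 0" "real (card \<Theta>) / real J < \<delta>"
    using real_div_small[OF \<delta>, of "real (card \<Theta>)"] by blast
  obtain r where r: "\<forall>M\<ge>J. \<exists>cl C. \<forall>\<omega>. (\<forall>j<M. \<omega> j \<in> \<Theta>) \<longrightarrow> cl \<omega> < r \<and> (\<forall>j<M. C (cl \<omega>) j \<in> \<Theta>) \<and>
    (\<exists>\<pi>. \<pi> permutes {..<M} \<and> card {j \<in> {..<M}. \<omega> (\<pi> j) \<noteq> C (cl \<omega> :: nat) j} \<le> card \<Theta> * (M div J))"
    using few_words_up_to_rearrangement[OF \<Theta> J(1)] by blast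
  obtain m where m: "m \<ge> 3" "\<And>\<sigma>. \<sigma> permutes {..<L} \<Longrightarrow> \<sigma> ^^ m = id"
    using common_exponent by blast
  obtain W c Ks q where c: "\<forall>i<r. c i permutes {..<W :: nat} \<and> c i ^^ Suc m = id \<and> Ks i \<le> W \<and> q i + 2 < 2 * W"
    and com: "\<forall>i<r. \<forall>i'<r. c i' \<circ> shift_perm (Ks i) (c i') \<circ> inv_into UNIV (c i') \<circ> inv_into UNIV (shift_perm (Ks i) (c i'))
        = (if i = i' then three_cyc (q i) else id)"
    using coding_cycles[OF m(1), of r] by blast
  obtain n1 where n1: "\<And>n. n \<ge> n1 \<Longrightarrow> n > 0 \<and> real (2 * W + 2) / real n < \<delta>"
    using real_div_small[OF \<delta>, of "real (2 * W + 2)"] by blast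
  \<comment> \<open>\<open>W\<close> depends on \<open>r\<close> and \<open>m\<close> but not on the
    height, so \<open>B\<close> can be taken large enough to make the lowest
    \<open>2 * W + 2\<close> blocks negligible.\<close>
  define B where "B = max J (max n1 (2 * W + 2))"
  have B: "B > 0" "real (2 * W + 2) / real B < \<delta>" "J \<le> B" "2 * W + 2 \<le> B"
    using n1[of B] by (auto simp: B_def)
  define N where "N = B * L"
  have N: "N > 0" using B L by (simp add: N_def)
  have WN: "2 * W \<le> N"
  proof -
    have "B \<le> B * L" using L(1) by simp
    then show ?thesis using B(4) unfolding N_def by linarith
  qed
  obtain D where t: "tower D N" and Dp: "prob (space M - tower_set D N) < \<delta>"
    using Rokhlin[OF N \<delta>] by blast
  have pD: "prob D \<le> 1 / real N" using prob_tower_le[OF t] N by (simp add: field_simps)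
  from mp[OF spec[OF r] B(3)] obtain clw C where
    clw0: "\<forall>\<omega>. (\<forall>j<B. \<omega> j \<in> \<Theta>) \<longrightarrow> clw \<omega> < r \<and> (\<forall>j<B. C (clw \<omega>) j \<in> \<Theta>) \<and>
    (\<exists>\<pi>. \<pi> permutes {..<B} \<and> card {j \<in> {..<B}. \<omega> (\<pi> j) \<noteq> C (clw \<omega> :: nat) j} \<le> card \<Theta> * (B div J))"
    by (elim exE)
  have clw: "clw \<omega> < r \<and> (\<forall>j<B. C (clw \<omega>) j \<in> \<Theta>) \<and>
    (\<exists>\<pi>. \<pi> permutes {..<B} \<and> card {j \<in> {..<B}. \<omega> (\<pi> j) \<noteq> C (clw \<omega> :: nat) j} \<le> card \<Theta> * (B div J))"
    if "\<forall>j<B. \<omega> j \<in> \<Theta>" for \<omega>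
    using spec[OF clw0] that by (rule mp)
  define pat where "pat d = (tower_graph N u0 d, tower_graph N v0 d)" for d
  have pats: "{d \<in> D. pat d = p} \<in> sets M" for p
  proof -
    have "{d \<in> D. pat d = p} = {d \<in> D. tower_graph N u0 d = fst p} \<inter> {d \<in> D. tower_graph N v0 d = snd p}"
      by (auto simp: pat_def)
    then show ?thesis using tower_graph_sets[OF t um] tower_graph_sets[OF t vm] by simp
  qed
  have patf: "finite (pat ` D)"
    by (rule finite_subset[of _ "tower_graph N u0 ` D \<times> tower_graph N v0 ` D"])
      (auto simp: pat_def tower_graph_finite)
  define \<omega> where "\<omega> p j = (block_graph L (fst p) j, block_graph L (snd p) j)" for p j
  have \<omega>: "\<omega> p j \<in> \<Theta>" for p j using block_graph_Pow by (simp add: \<omega>_def \<Theta>_def)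
  define ok where "ok p \<pi> \<longleftrightarrow> \<pi> permutes {..<B} \<and>
    card {j \<in> {..<B}. \<omega> p (\<pi> j) \<noteq> C (clw (\<omega> p)) j} \<le> card \<Theta> * (B div J)" for p \<pi>
  \<comment> \<open>The rearrangement is chosen from the pattern alone, which makes it measurable in
    the base point.\<close>
  define \<pi>p where "\<pi>p p = (SOME \<pi>. ok p \<pi>)" for p
  have "\<exists>\<pi>. ok p \<pi>" for p using clw[of "\<omega> p"] \<omega> unfolding ok_def by simp
  then have "ok p (\<pi>p p)" for p unfolding \<pi>p_def by (rule someI_ex)
  then have \<pi>p: "\<pi>p p permutes {..<B}" "card {j \<in> {..<B}. \<omega> p (\<pi>p p j) \<noteq> C (clw (\<omega> p)) j} \<le> card \<Theta> * (B div J)" for p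
    by (simp_all add: ok_def)
  define cl where "cl d = clw (\<omega> (pat d))" for d
  define \<pi> where "\<pi> d = \<pi>p (pat d)" for d
  have clr: "cl d < r" for d using clw[of "\<omega> (pat d)"] \<omega> by (auto simp: cl_def)
  have cls: "{d \<in> D. cl d = i} \<in> sets M" for i
    unfolding cl_def by (rule pattern_sets[OF pats patf])

  \<comment> \<open>Both \<open>u\<close> and \<open>v\<close> read their block permutations off the
    representative word of the class. The lowest \<open>2 * W\<close> blocks of \<open>u\<close>
    stay trivial, which frees the levels below \<open>W\<close> for the cycle.\<close>
  define u where "u i = block_diag L (\<lambda>j. if 2 * W \<le> j \<and> j < B then extension L (fst (C i j)) else id)" for i
  define v where "v i = block_diag L (\<lambda>j. if j < B then extension L (snd (C i j)) else id)" for i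
  have vN: "v i permutes {..<N}" for i
    unfolding v_def N_def by (rule block_diag_permutes[OF L(1)]) (auto simp: extension permutes_id)
  have "u i permutes {..<N}" for i
    unfolding u_def N_def by (rule block_diag_permutes[OF L(1)]) (auto simp: extension permutes_id)
  moreover have "u i k = k" if "k < W" for i k
  proof -
    have "k div L \<le> k" by simp
    then have "k div L < 2 * W" using that by linarith
    then show ?thesis by (simp add: u_def block_diag_def)
  qed
  ultimately have uN: "u i permutes {W..<N}" for i
    by (rule permutes_superset) (auto simp: not_le)
  have um': "u i ^^ m = id" for i
  proof -
    have "u i ^^ m = block_diag L (\<lambda>j. (if 2 * W \<le> j \<and> j < B then extension L (fst (C i j)) else id) ^^ m)"
      unfolding u_def by (rule block_diag_pow[OF L(1)]) (simp add: extension permutes_id)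
    also have "(\<lambda>j. (if 2 * W \<le> j \<and> j < B then extension L (fst (C i j)) else id) ^^ m) = (\<lambda>j. id)"
      by (rule ext) (simp add: m(2) extension funpow_id del: id_apply)
    also have "block_diag L (\<lambda>j. id) = id" by (simp add: block_diag_def fun_eq_iff)
    finally show ?thesis .
  qed
  \<comment> \<open>Only even permutations can be generated; \<open>h i\<close> agrees with the
    wanted \<open>v i\<close> from level 2 on.\<close>
  have "\<forall>i. \<exists>h. h \<in> consec N \<and> (\<forall>k\<ge>2. h k = v i k)" using consec_approx[OF vN] by blast
  from choice[OF this] obtain h where h: "\<And>i. h i \<in> consec N" "\<And>i k. k \<ge> 2 \<Longrightarrow> h i k = v i k" by blast

  have s: "tower_fun D N (\<lambda>d. block_perm L (\<pi> d))"
    unfolding \<pi>_def N_def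
    by (rule tower_fun_pattern[OF t[unfolded N_def] pats patf]) (rule block_perm_permutes[OF L(1) \<pi>p(1)])
  have ctf: "tower_fun D N (\<lambda>d. F (cl d))" if "\<And>i. i < r \<Longrightarrow> F i permutes {..<N}" for F
  proof (rule tower_fun_pattern[OF t cls])
    show "finite (cl ` D)" by (rule finite_subset[of _ "{..<r}"]) (use clr in auto)
  qed (use that clr in auto)
  have \<rho>: "tower_fun D N (\<lambda>d. u (cl d) \<circ> c (cl d))"
  proof (rule ctf[of "\<lambda>i. u i \<circ> c i"])
    fix i assume i: "i < r"
    have "c i permutes {..<N}" by (rule permutes_subset[of _ "{..<W}"]) (use c i WN in auto)
    moreover have "u i permutes {..<N}" by (rule permutes_subset[OF uN]) auto
    ultimately show "u i \<circ> c i permutes {..<N}" by (rule permutes_compose)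
  qed
  have hF: "tower_fun D N (\<lambda>d. h (cl d))" by (rule ctf[of h]) (rule consec_permutes[OF h(1)])

  let ?S = "act D N (\<lambda>d. block_perm L (\<pi> d))"
  let ?U = "act D N (\<lambda>d. u (cl d) \<circ> c (cl d))"
  let ?V = "act D N (\<lambda>d. h (cl d))"
  have SF: "?S \<in> full_mp M f" and UF: "?U \<in> full_mp M f" and VF: "?V \<in> full_mp M f"
    using act_full[OF t] s \<rho> hF by auto
  have Sm: "?S \<in> mp_bijections M" and Um: "?U \<in> mp_bijections M" and Vm: "?V \<in> mp_bijections M"
    using full_mp_mp SF UF VF by auto
  let ?conj = "\<lambda>x. ?S \<otimes>\<^bsub>mp_group M\<^esub> x \<otimes>\<^bsub>mp_group M\<^esub> inv\<^bsub>mp_group M\<^esub> ?S"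
  have gen: "?V \<in> generate (mp_group M) {f, ?U}"
  proof (rule coding_generates[OF t cls clr WN, where m = m and K = Ks and q = q])
    show "m \<ge> 1" using m(1) by simp
    show "c i permutes {..<W}" "c i ^^ Suc m = id" "Ks i \<le> W" "q i + 2 < 2 * W" if "i < r" for i
      using spec[OF c, of i] that by simp_all
    show "c i' \<circ> shift_perm (Ks i) (c i') \<circ> inv_into UNIV (c i') \<circ> inv_into UNIV (shift_perm (Ks i) (c i'))
        = (if i = i' then three_cyc (q i) else id)" if "i < r" "i' < r" for i i'
      using com that by blast
    show "subgroup (generate (mp_group M) {f, ?U}) (mp_group M)"
      by (rule G.generate_is_subgroup) (use f_mp Um in auto)
    show "f \<in> generate (mp_group M) {f, ?U}" "?U \<in> generate (mp_group M) {f, ?U}"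
      by (simp_all add: generate.incl)
  qed (rule uN um' h(1))+
  \<comment> \<open>Generation is established for \<open>f\<close> and \<open>?U\<close>, but only
    after conjugation by \<open>?S\<close> are the three maps close to \<open>f\<close>,
    \<open>u0\<close> and \<open>v0\<close>.\<close>
  then have "?conj ?V \<in> generate (mp_group M) (?conj ` {f, ?U})"
    by (rule G.conj_generate) (use f_mp Um Sm in auto)
  then have gen': "?conj ?V \<in> generate (mp_group M) {?conj f, ?conj ?U}" by simp

  \<comment> \<open>Bad levels are the lowest blocks, where the cycle acts, \<open>u\<close> is
    trivial or \<open>h\<close> may differ from \<open>v\<close>, and the blocks whose letter after
    rearrangement is not that of the class word.\<close>
  define Q where "Q d k \<longleftrightarrow> k < (2 * W + 2) * L \<or> \<omega> (pat d) (\<pi> d (k div L)) \<noteq> C (cl d) (k div L)" for d k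
  define cQ where "cQ = real ((2 * W + 2) * L + card \<Theta> * (B div J) * L)"
  have Qs: "{d \<in> D. Q d k} \<in> sets M" for k
    unfolding Q_def cl_def \<pi>_def by (rule pattern_sets[OF pats patf])
  have Qc: "real (card {k \<in> {..<N}. Q d k}) \<le> cQ" for d
  proof -
    let ?X = "{k \<in> {..<N}. \<omega> (pat d) (\<pi> d (k div L)) \<noteq> C (cl d) (k div L)}"
    have "card {k \<in> {..<N}. Q d k} \<le> card ({..<(2 * W + 2) * L} \<union> ?X)"
      by (intro card_mono) (auto simp: Q_def)
    also have "\<dots> \<le> (2 * W + 2) * L + card ?X" using card_Un_le[of "{..<(2 * W + 2) * L}" ?X] by simp
    also have "card ?X \<le> card {j \<in> {..<B}. \<omega> (pat d) (\<pi> d j) \<noteq> C (cl d) j} * card {a \<in> {..<L}. True}"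
      using card_blocks[OF L(1), of B "\<lambda>j. \<omega> (pat d) (\<pi> d j) \<noteq> C (cl d) j" "\<lambda>_. True"] by (simp add: N_def)
    also have "\<dots> \<le> card \<Theta> * (B div J) * L"
      using \<pi>p(2)[of "pat d"] by (simp add: \<pi>_def cl_def)
    finally show ?thesis by (simp only: cQ_def of_nat_le_iff add_le_cancel_left)
  qed
  \<comment> \<open>Relative to the height \<open>B * L\<close> the two kinds of bad levels make up
    \<open>(2 * W + 2) / B\<close> and at most \<open>card \<Theta> / J\<close>.\<close>
  have cQ: "cQ * prob D < 2 * \<delta>"
  proof -
    have "cQ * prob D \<le> cQ * (1 / real N)" using pD by (intro mult_left_mono) (auto simp: cQ_def)
    also have "\<dots> = real (2 * W + 2) / real B + real (card \<Theta>) * (real (B div J) / real B)"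
      using L(1) B(1) by (simp add: cQ_def N_def field_simps)
    also have "real (B div J) / real B \<le> 1 / real J"
    proof -
      have "B div J * J \<le> B" by simp
      then have "real (B div J) * real J \<le> real B" by (simp only: of_nat_mult[symmetric] of_nat_le_iff)
      then show ?thesis using J(1) B(1) by (simp add: field_simps)
    qed
    then have "real (card \<Theta>) * (real (B div J) / real B) \<le> real (card \<Theta>) / real J"
      using mult_left_mono[of "real (B div J) / real B" "1 / real J" "real (card \<Theta>)"] by simp
    finally show ?thesis using B(2) J(2) by linarith
  qed
  \<comment> \<open>If the letter read at block \<open>\<pi> d j\<close> is \<open>\<tau>\<close>,
    the permutation chosen for \<open>\<tau>\<close> reproduces the transitions of \<open>g\<close>
    inside that block.\<close>
  have agree: "block_graph L p (\<pi> d j) = \<tau> \<Longrightarrow> extension L \<tau> a = b"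
    if "d \<in> D" "p = tower_graph N g d" "g \<in> mp_bijections M" "a < L" "b < L" "j < B"
      "g (P (int (\<pi> d j * L + a)) d) = P (int (\<pi> d j * L + b)) d" for p d j \<tau> a b g
  proof -
    assume \<tau>: "block_graph L p (\<pi> d j) = \<tau>"
    have "\<pi> d j < B" using permutes_in_image[OF \<pi>p(1), of "pat d" j] that(6) by (simp add: \<pi>_def)
    then have "\<pi> d j * L + a < N" "\<pi> d j * L + b < N" using that(4,5) by (simp_all add: N_def block_lt)
    then have "(a, b) \<in> \<tau>" using that \<tau> by (auto simp: block_graph_def tower_graph_def)
    moreover have "partial_inj \<tau>"
      using partial_inj_block_graph[OF partial_inj_tower_graph[OF t that(3,1)]] \<tau> that(2) by blast
    ultimately show "extension L \<tau> a = b"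
      using extension(2)[of \<tau> L a b] block_graph_Pow[of L p "\<pi> d j"] \<tau> by blast
  qed
  have jB: "k div L < B" if "k < N" for k using that L(1) by (simp add: N_def block_lt)
  have nQ: "2 * W + 2 \<le> k div L" "\<omega> (pat d) (\<pi> d (k div L)) = C (cl d) (k div L)" if "\<not> Q d k" for d k
    using that L(1) by (auto simp: Q_def not_less less_eq_div_iff_mult_less_eq)
  have app_u: "du (?S \<otimes>\<^bsub>mp_group M\<^esub> ?U) (u0 \<otimes>\<^bsub>mp_group M\<^esub> ?S)
      \<le> prob (space M - tower_set D N) + cQ * prob D + prob (leaves_block D N L u0)"
    unfolding N_def
  proof (rule block_approx[OF t[unfolded N_def] L(1) um])
    fix d k b assume d: "d \<in> D" "k < B * L" "\<not> Q d k" "b < L"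
      and eq: "u0 (P (int (\<pi> d (k div L) * L + k mod L)) d) = P (int (\<pi> d (k div L) * L + b)) d"
    have "block_graph L (tower_graph N u0 d) (\<pi> d (k div L)) = fst (C (cl d) (k div L))"
      using arg_cong[OF nQ(2)[OF d(3)], of fst] by (simp add: \<omega>_def pat_def)
    then have "extension L (fst (C (cl d) (k div L))) (k mod L) = b"
      using agree[OF d(1) refl um _ d(4) _ eq] jB d(2) L(1) by (simp add: N_def)
    then have "u (cl d) k = k div L * L + b"
      using nQ(1)[OF d(3)] jB[of k] d(2) by (simp add: u_def block_diag_def N_def)
    moreover have "W \<le> k" using nQ(1)[OF d(3)] div_le_dividend[of k L] by linarith
    then have "c (cl d) k = k" using c clr[of d] by (auto simp: permutes_def)
    ultimately show "(u (cl d) \<circ> c (cl d)) k = k div L * L + b" by simp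
  qed (use s \<rho> Qs Qc \<pi>p(1) in \<open>auto simp: N_def \<pi>_def\<close>)
  have app_v: "du (?S \<otimes>\<^bsub>mp_group M\<^esub> ?V) (v0 \<otimes>\<^bsub>mp_group M\<^esub> ?S)
      \<le> prob (space M - tower_set D N) + cQ * prob D + prob (leaves_block D N L v0)"
    unfolding N_def
  proof (rule block_approx[OF t[unfolded N_def] L(1) vm])
    fix d k b assume d: "d \<in> D" "k < B * L" "\<not> Q d k" "b < L"
      and eq: "v0 (P (int (\<pi> d (k div L) * L + k mod L)) d) = P (int (\<pi> d (k div L) * L + b)) d"
    have "block_graph L (tower_graph N v0 d) (\<pi> d (k div L)) = snd (C (cl d) (k div L))"
      using arg_cong[OF nQ(2)[OF d(3)], of snd] by (simp add: \<omega>_def pat_def)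
    then have "extension L (snd (C (cl d) (k div L))) (k mod L) = b"
      using agree[OF d(1) refl vm _ d(4) _ eq] jB d(2) L(1) by (simp add: N_def)
    then have "v (cl d) k = k div L * L + b"
      using jB[of k] d(2) by (simp add: v_def block_diag_def N_def)
    moreover have "2 \<le> k" using nQ(1)[OF d(3)] div_le_dividend[of k L] by linarith
    ultimately show "h (cl d) k = k div L * L + b" using h(2) by simp
  qed (use s hF Qs Qc \<pi>p(1) in \<open>auto simp: N_def \<pi>_def\<close>)
  have lv: "prob (leaves_block D N L u0) < 2 * \<delta>" "prob (leaves_block D N L v0) < 2 * \<delta>"
    using prob_leaves_block[OF t[unfolded N_def] L(1) B(1) um, of Ku] prob_leaves_block[OF t[unfolded N_def] L(1) B(1) vm, of Kv]
      Ku Kv K' by (simp_all add: N_def)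
  have conj_du: "du (?conj x) z = du (?S \<otimes>\<^bsub>mp_group M\<^esub> x) (z \<otimes>\<^bsub>mp_group M\<^esub> ?S)"
    if "x \<in> mp_bijections M" "z \<in> mp_bijections M" for x z
  proof -
    have "du (?conj x) z = du (?conj x \<otimes>\<^bsub>mp_group M\<^esub> ?S) (z \<otimes>\<^bsub>mp_group M\<^esub> ?S)"
      using du_mult_right[of "?conj x" z ?S] that Sm by (simp add: mp_closed)
    also have "?conj x \<otimes>\<^bsub>mp_group M\<^esub> ?S = ?S \<otimes>\<^bsub>mp_group M\<^esub> x"
      using that Sm by (simp add: G.m_assoc mp_closed)
    finally show ?thesis .
  qed
  have "du (?conj ?U) u0 < \<epsilon>" "du (?conj ?V) v0 < \<epsilon>"
    using conj_du[OF Um um] conj_du[OF Vm vm] app_u app_v lv cQ Dp \<delta> \<delta>_def by linarith+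
  moreover have "du (?conj f) f < \<epsilon>"
  proof -
    \<comment> \<open>Moving whole blocks commutes with raising the level by one except at the last
      level of a block.\<close>
    define R where "R k \<longleftrightarrow> Suc k mod L = 0" for k
    have Rs: "{d \<in> D. R k} \<in> sets M" for k using tower_sets[OF t] by (cases "R k") auto
    have "card {k \<in> {..<N}. R k} \<le> card {k \<in> {..<B * L}. True \<and> k mod L = L - 1}"
      by (intro card_mono) (auto simp: R_def N_def mod_Suc split: if_splits)
    also have "\<dots> \<le> card {j \<in> {..<B}. True} * card {a \<in> {..<L}. a = L - 1}"
      by (rule card_blocks[OF L(1), where B = "\<lambda>_. True"])
    also have "{a \<in> {..<L}. a = L - 1} = {L - 1}" using L(1) by auto
    finally have Rc: "real (card {k \<in> {..<N}. R k}) \<le> real B" by simp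
    let ?Z = "\<Union>k<N. lev {d \<in> D. R k} (int k)"
    have Zs: "?Z \<in> sets M" and Zp: "prob ?Z \<le> real B * prob D"
      using prob_tower_count[OF t Rs Rc] by auto
    have Os: "space M - tower_set D N \<in> sets M" using tower_set_sets[OF tower_sets[OF t]] by blast
    have "x \<in> (space M - tower_set D N) \<union> ?Z"
      if x: "x \<in> space M" and ne: "(?S \<otimes>\<^bsub>mp_group M\<^esub> f) x \<noteq> (f \<otimes>\<^bsub>mp_group M\<^esub> ?S) x" for x
      using x
    proof (cases rule: tower_cases[OF t, consumes 1, case_names off on])
      case (on d k)
      have ds: "d \<in> space M" by (rule tower_space[OF t on(1)])
      show ?thesis
      proof (cases "R k")
        case True
        then have "x \<in> lev {d \<in> D. R k} (int k)" using on ds by (simp add: lev_def)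
        then show ?thesis using on(2) by blast
      next
        case False
        have "Suc k \<noteq> N" using False by (auto simp: R_def N_def)
        then have k: "Suc k < N" using on(2) by simp
        have fP: "f (P (int k) d) = P (int (Suc k)) d" for k
          using P_add[OF ds, of 1 "int k"] by (simp add: P_1)
        have "block_perm L (\<pi> d) (Suc k) = Suc (block_perm L (\<pi> d) k)"
          using False by (auto simp: block_perm_def R_def mod_Suc div_Suc split: if_splits)
        then have "?S (f x) = f (?S x)"
          using act_on[OF t on(1,2)] act_on[OF t on(1) k] on(3) fP by simp
        then show ?thesis using ne x Sm f_mp by (simp add: mp_mult)
      qed
    qed (use x in auto)
    then have "du (?S \<otimes>\<^bsub>mp_group M\<^esub> f) (f \<otimes>\<^bsub>mp_group M\<^esub> ?S) \<le> prob ((space M - tower_set D N) \<union> ?Z)"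
      using Os Zs by (intro du_le) blast+
    also have "\<dots> \<le> prob (space M - tower_set D N) + prob ?Z" by (rule measure_Un_le[OF Os Zs])
    also have "prob ?Z \<le> real B * (1 / real N)"
      using Zp pD mult_left_mono[of "prob D" "1 / real N" "real B"] by simp
    also have "\<dots> = 1 / real L" using B(1) L(1) by (simp add: N_def)
    finally show ?thesis using conj_du[OF f_mp f_mp] Dp K'(3) \<delta> \<delta>_def by linarith
  qed
  moreover have "?conj ?U \<in> full_mp M f"
    using subgroup.m_closed[OF subgroup_full_mp] subgroup.m_inv_closed[OF subgroup_full_mp] SF UF by blast
  ultimately show ?thesis using conj_full[OF SF] gen' by blast
qed

end

section \<open>Completeness, separability and Baire category\<close>

section \<open>Topology of the full group\<close>

context std_prob
begin

lemma du_self [simp]: "du g g = 0"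
  by (simp add: du_def)

lemma du_nonneg [simp]: "0 \<le> du g h"
  by (simp add: du_def)

lemma du_mult_le:
  assumes "a \<in> mp_bijections M" "a' \<in> mp_bijections M" "b \<in> mp_bijections M" "b' \<in> mp_bijections M"
  shows "du (a \<otimes>\<^bsub>mp_group M\<^esub> b) (a' \<otimes>\<^bsub>mp_group M\<^esub> b') \<le> du a a' + du b b'"
  using du_triangle[of "a \<otimes>\<^bsub>mp_group M\<^esub> b" "a' \<otimes>\<^bsub>mp_group M\<^esub> b" "a' \<otimes>\<^bsub>mp_group M\<^esub> b'"]
    du_mult_left[of b b' a'] du_mult_right[of a a' b] assms by (simp add: mp_closed)

lemma du_inv:
  assumes a: "a \<in> mp_bijections M" and b: "b \<in> mp_bijections M"
  shows "du (inv\<^bsub>mp_group M\<^esub> a) (inv\<^bsub>mp_group M\<^esub> b) = du a b"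
proof -
  interpret group "mp_group M" by (rule group_mp_group)
  let ?i = "inv\<^bsub>mp_group M\<^esub> a" and ?j = "inv\<^bsub>mp_group M\<^esub> b"
  have m: "?i \<in> mp_bijections M" "?j \<in> mp_bijections M" by (rule mp_closed(2)[OF a], rule mp_closed(2)[OF b])
  have "du ?i ?j = du (a \<otimes>\<^bsub>mp_group M\<^esub> ?i) (a \<otimes>\<^bsub>mp_group M\<^esub> ?j)"
    using du_mult_left[OF m a] by simp
  also have "\<dots> = du (a \<otimes>\<^bsub>mp_group M\<^esub> ?i \<otimes>\<^bsub>mp_group M\<^esub> b) (a \<otimes>\<^bsub>mp_group M\<^esub> ?j \<otimes>\<^bsub>mp_group M\<^esub> b)"
    by (rule du_mult_right[symmetric]) (use a b m in \<open>auto simp: mp_closed\<close>)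
  also have "a \<otimes>\<^bsub>mp_group M\<^esub> ?i \<otimes>\<^bsub>mp_group M\<^esub> b = b" using a b r_inv[of a] l_one[of b] by simp
  also have "a \<otimes>\<^bsub>mp_group M\<^esub> ?j \<otimes>\<^bsub>mp_group M\<^esub> b = a" using a b m by (simp add: m_assoc)
  finally show ?thesis by (simp add: du_commute)
qed

text \<open>The metric is invariant under both translations and under inversion, so the errors of
  the letters add up along the word.\<close>

lemma du_word_val:
  fixes F F' :: "bool \<Rightarrow> 'a \<Rightarrow> 'a"
  assumes F: "\<And>s. F s \<in> mp_bijections M" and F': "\<And>s. F' s \<in> mp_bijections M"
    and d: "\<And>s. du (F s) (F' s) \<le> \<delta>"
  shows "du (word_val (mp_group M) F w) (word_val (mp_group M) F' w) \<le> real (length w) * \<delta>"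
proof -
  interpret F: group_family "mp_group M" F by (rule group.group_family[OF group_mp_group]) (simp add: F)
  interpret F': group_family "mp_group M" F' by (rule group.group_family[OF group_mp_group]) (simp add: F')
  have l: "du (letter_val (mp_group M) F a) (letter_val (mp_group M) F' a) \<le> \<delta>" for a
    using d[of "snd a"] du_inv[OF F F'] by (simp add: letter_val_def)
  show ?thesis
  proof (induction w)
    case (Cons a w)
    have "du (word_val (mp_group M) F (a # w)) (word_val (mp_group M) F' (a # w)) \<le>
        du (letter_val (mp_group M) F a) (letter_val (mp_group M) F' a) +
        du (word_val (mp_group M) F w) (word_val (mp_group M) F' w)"
      using F.letter_val_closed[of a] F'.letter_val_closed[of a] F.word_val_closed[of w] F'.word_val_closed[of w]
      unfolding word_val_simps carrier_mp_group by (rule du_mult_le)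
    also have "\<dots> \<le> \<delta> + real (length w) * \<delta>" using l Cons by (rule add_mono)
    finally show ?case by (simp add: algebra_simps)
  qed simp
qed

lemma du_int_pow:
  assumes g: "g \<in> mp_bijections M" and h: "h \<in> mp_bijections M"
  shows "du (mp_map.P M g k) (mp_map.P M h k) \<le> real_of_int \<bar>k\<bar> * du g h"
proof -
  interpret g: mp_map M g by (rule mp_mapI[OF g])
  interpret h: mp_map M h by (rule mp_mapI[OF h])
  have nat: "du (g.P (int n)) (h.P (int n)) \<le> real n * du g h" for n
  proof (induction n)
    case 0
    then show ?case by (simp add: g.P_def h.P_def)
  next
    case (Suc n)
    have "g.P (int (Suc n)) = g \<otimes>\<^bsub>mp_group M\<^esub> g.P (int n)"
      by (rule mp_eqI[OF g.P_mp]) (use g g.P_add[of _ 1 "int n"] g.P_1 in \<open>auto simp: mp_closed mp_mult\<close>)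
    moreover have "h.P (int (Suc n)) = h \<otimes>\<^bsub>mp_group M\<^esub> h.P (int n)"
      by (rule mp_eqI[OF h.P_mp]) (use h h.P_add[of _ 1 "int n"] h.P_1 in \<open>auto simp: mp_closed mp_mult\<close>)
    ultimately have "du (g.P (int (Suc n))) (h.P (int (Suc n))) \<le> du g h + du (g.P (int n)) (h.P (int n))"
      using du_mult_le[OF g h g.P_mp h.P_mp, of "int n" "int n"] by simp
    then show ?case using Suc by (simp add: algebra_simps)
  qed
  show ?thesis
  proof (cases "k \<ge> 0")
    case True
    then show ?thesis using nat[of "nat k"] by simp
  next
    case False
    have "g.P k = inv\<^bsub>mp_group M\<^esub> g.P (- k)" "h.P k = inv\<^bsub>mp_group M\<^esub> h.P (- k)"
      using g.G.int_pow_neg[of g "- k"] g.G.int_pow_neg[of h "- k"] g h by (simp_all add: g.P_def h.P_def)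
    then show ?thesis using nat[of "nat (- k)"] du_inv[OF g.P_mp h.P_mp] False by simp
  qed
qed

text \<open>Along a subsequence with summable distances the images of almost every point stabilise,
  by Borel-Cantelli. The limit is injective and pieced together from countably many elements of the
  full group, hence agrees almost everywhere with a genuine bijection.\<close>

lemma mcomplete_full_group:
  assumes f: "f \<in> mp_bijections M" and R: "full_group M R = cls M ` full_mp M f"
  shows "Metric_space.mcomplete (full_group M R) (d_u M)"
proof -
  interpret f: mp_map M f by (rule mp_mapI[OF f])
  interpret F: Metric_space "full_group M R" "d_u M" by (rule Metric_space_full_group[OF std])
  show ?thesis
    unfolding F.mcomplete_def
  proof (intro allI impI)
    fix \<sigma> assume cau: "F.MCauchy \<sigma>"
    have "\<sigma> n \<in> full_group M R" for n using cau by (auto simp: F.MCauchy_def)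
    then have "\<forall>n. \<exists>h. h \<in> full_mp M f \<and> \<sigma> n = cls M h" unfolding R by blast
    from choice[OF this] obtain h where h: "\<And>n. h n \<in> full_mp M f" "\<And>n. \<sigma> n = cls M (h n)" by blast
    have hm: "h n \<in> mp_bijections M" for n by (rule f.full_mp_mp[OF h(1)])
    have "\<forall>k. \<exists>N. \<forall>n n'. N \<le> n \<longrightarrow> N \<le> n' \<longrightarrow> d_u M (\<sigma> n) (\<sigma> n') < (1/2) ^ k"
      using cau by (simp add: F.MCauchy_def)
    from choice[OF this] obtain N where N: "\<And>k n n'. N k \<le> n \<Longrightarrow> N k \<le> n' \<Longrightarrow> d_u M (\<sigma> n) (\<sigma> n') < (1/2) ^ k"
      by blast
    \<comment> \<open>Summing the \<open>Suc (N i)\<close> makes the subsequence strictly increasing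
      and keeps it beyond \<open>N k\<close>.\<close>
    define r where "r k = (\<Sum>i\<le>k. Suc (N i))" for k
    have rmono: "strict_mono r" by (rule strict_monoI_Suc) (simp add: r_def)
    have rN: "N k \<le> r k" for k
      using member_le_sum[of k "{..k}" "\<lambda>i. Suc (N i)"] by (simp add: r_def)
    define g where "g n = h (r n)" for n
    have gm: "g n \<in> mp_bijections M" and gF: "g n \<in> full_mp M f" for n using hm h(1) by (auto simp: g_def)
    define A where "A n = {x \<in> space M. g n x \<noteq> g (Suc n) x}" for n
    have As: "A n \<in> sets M" for n unfolding A_def by (rule mp_neq_sets[OF gm gm])
    have "prob (A n) \<le> (1/2) ^ n" for n
    proof -
      have "N n \<le> r (Suc n)" using rN[of n] strict_monoD[OF rmono, of n "Suc n"] by simp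
      then have "d_u M (\<sigma> (r n)) (\<sigma> (r (Suc n))) < (1/2) ^ n" using N rN by blast
      then show ?thesis using d_u_cls[OF gm gm, of n "Suc n"] by (simp add: h(2) g_def A_def du_def)
    qed
    then have "summable (\<lambda>n. prob (A n))"
      by (intro summable_comparison_test[OF _ summable_geometric[of "1/2 :: real"]]) auto
    then have ae: "AE x in M. eventually (\<lambda>n. x \<in> space M - A n) sequentially"
      using As by (intro borel_cantelli_AE1) (auto simp: emeasure_eq_measure)
    define B where "B i = (\<Inter>n. space M - A (i + n))" for i
    have Bs: "B i \<in> sets M" for i unfolding B_def using As by (intro sets.countable_INT) auto
    have B: "x \<in> B i \<longleftrightarrow> x \<in> space M \<and> (\<forall>n\<ge>i. g n x = g (Suc n) x)" for x i
    proof -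
      have "(\<forall>n. P (i + n)) \<longleftrightarrow> (\<forall>n\<ge>i. P n)" for P by (metis le_add1 le_iff_add)
      from this[of "\<lambda>n. g n x = g (Suc n) x"] show ?thesis by (auto simp: B_def A_def)
    qed
    have Bg: "g n x = g i x" if "x \<in> B i" "n \<ge> i" for x i n
      using that(2)
    proof (induction n rule: dec_induct)
      case (step n)
      have "g n x = g (Suc n) x" using that(1) step.hyps(1) unfolding B by blast
      then show ?case using step.IH by simp
    qed simp
    have Binc: "incseq B" unfolding incseq_def subset_iff B by (meson order_trans)
    define X where "X = (\<Union>i. B i)"
    have Xs: "X \<in> sets M" unfolding X_def using Bs by blast
    have XA: "AE x in M. x \<in> X"
      using ae AE_space
    proof eventually_elim
      case (elim x)
      then obtain i where "\<And>n. n \<ge> i \<Longrightarrow> x \<in> space M - A n" by (auto simp: eventually_sequentially)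
      then have "x \<in> B i" using elim(2) by (simp add: B_def)
      then show ?case by (auto simp: X_def)
    qed
    define hh where "hh x = g (LEAST i. x \<in> B i) x" for x
    have hh: "hh x = g i x" if "x \<in> B i" for x i
    proof -
      have "x \<in> B (LEAST i. x \<in> B i)" using that by (rule LeastI)
      then show ?thesis using Bg[of x "LEAST i. x \<in> B i" i] Least_le[of "\<lambda>i. x \<in> B i" i] that by (simp add: hh_def)
    qed
    \<comment> \<open>Two points are both stable from a common index on, and there \<open>hh\<close>
      agrees with a single injective map.\<close>
    have inj: "inj_on hh X"
    proof (rule inj_onI)
      fix x y assume "x \<in> X" "y \<in> X" and eq: "hh x = hh y"
      then obtain i j where "x \<in> B i" "y \<in> B j" by (auto simp: X_def)
      then have "x \<in> B (max i j)" "y \<in> B (max i j)"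
        using subsetD[OF incseqD[OF Binc, of i "max i j"]] subsetD[OF incseqD[OF Binc, of j "max i j"]] by auto
      then have "g (max i j) x = g (max i j) y" "x \<in> space M" "y \<in> space M"
        using eq hh[of x "max i j"] hh[of y "max i j"] unfolding B by metis+
      then show "x = y" using mp_inj[OF gm] by blast
    qed
    have "\<exists>l\<in>mp_bijections M. AE x in M. l x = hh x"
    proof (rule mp_piecewise_AE[of g B hh X])
      show "\<forall>x\<in>B i. hh x = g i x" for i using hh by blast
    qed (use gm Bs Xs XA inj in \<open>auto simp: X_def\<close>)
    then obtain l where l: "l \<in> mp_bijections M" "AE x in M. l x = hh x" by blast
    have "AE x in M. \<forall>i. \<exists>k. g i x = f.P k x" using gF by (simp add: AE_all_countable f.full_mp_iff)
    then have "AE x in M. \<exists>k. l x = f.P k x"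
      using l(2) XA by eventually_elim (use hh in \<open>force simp: X_def\<close>)
    then have lF: "l \<in> full_mp M f" using l(1) by (simp add: f.full_mp_iff)
    have "(\<lambda>n. prob (B n)) \<longlonglongrightarrow> prob X"
      unfolding X_def using Bs Binc by (intro finite_Lim_measure_incseq) auto
    moreover have "prob X = 1" using XA prob_eq_1[OF Xs] by blast
    ultimately have lim: "(\<lambda>n. prob (B n)) \<longlonglongrightarrow> 1" by simp
    have dl: "d_u M (\<sigma> (r n)) (cls M l) \<le> 1 - prob (B n)" for n
    proof -
      have "d_u M (\<sigma> (r n)) (cls M l) = prob {x \<in> space M. g n x \<noteq> l x}"
        using d_u_cls[OF gm l(1)] by (simp add: h(2) g_def du_def)
      also have "\<dots> \<le> prob (space M - B n)"
      proof (rule finite_measure_mono_AE)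
        show "AE x in M. x \<in> {x \<in> space M. g n x \<noteq> l x} \<longrightarrow> x \<in> space M - B n"
          using l(2) by eventually_elim (use hh in auto)
      qed (use Bs in auto)
      finally show ?thesis using prob_compl[OF Bs] by simp
    qed
    have "limitin F.mtopology (\<sigma> \<circ> r) (cls M l) sequentially"
      unfolding F.limitin_metric
    proof (intro conjI allI impI)
      show "cls M l \<in> full_group M R" using lF R by blast
      fix \<epsilon> :: real assume "\<epsilon> > 0"
      then have "\<forall>\<^sub>F n in sequentially. 1 - \<epsilon> < prob (B n)" using order_tendstoD(1)[OF lim] by simp
      then show "\<forall>\<^sub>F n in sequentially. (\<sigma> \<circ> r) n \<in> full_group M R \<and> d_u M ((\<sigma> \<circ> r) n) (cls M l) < \<epsilon>"
      proof eventually_elim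
        case (elim n)
        have "(\<sigma> \<circ> r) n \<in> full_group M R" using h R by auto
        then show ?case using dl[of n] elim by simp
      qed
    qed
    then show "\<exists>x. limitin F.mtopology \<sigma> x sequentially"
      using F.MCauchy_convergent_subsequence[OF cau rmono] by blast
  qed
qed

text \<open>An element \<open>g\<close> of the full group generates iff \<open>f\<close> lies in its
  full group, that is, iff for each \<open>n\<close> some bound \<open>K\<close> on the exponents
  fails only on a set of measure below \<open>1 / Suc n\<close>. For fixed \<open>K\<close> and
  \<open>n\<close> this is an open condition, because each power depends on \<open>g\<close> in a
  Lipschitz way.\<close>

lemma gdelta_GEN:
  assumes f: "f \<in> mp_bijections M" and R: "full_group M R = cls M ` full_mp M f"
    and GR: "GEN M R = cls M ` {g \<in> full_mp M f. f \<in> full_mp M g}"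
  shows "gdelta_in (full_topology M R) (GEN M R)"
proof -
  interpret f: mp_map M f by (rule mp_mapI[OF f])
  interpret F: Metric_space "full_group M R" "d_u M" by (rule Metric_space_full_group[OF std])
  define E where "E g K = {x \<in> space M. \<forall>k\<in>{-int K..int K}. f x \<noteq> mp_map.P M g k x}" for g K
  have Es: "E g K \<in> sets M" if "g \<in> mp_bijections M" for g K
  proof -
    interpret g: mp_map M g by (rule mp_mapI[OF that])
    show ?thesis unfolding E_def
      by (rule sets.sets_Collect_finite_All) (auto intro: mp_neq_sets f)
  qed
  define U where "U n = cls M ` {g \<in> full_mp M f. \<exists>K. prob (E g K) < 1 / real (Suc n)}" for n
  have op: "openin F.mtopology (U n)" for n
    unfolding F.openin_mtopology
  proof (intro conjI allI impI)
    show "U n \<subseteq> full_group M R" using R by (auto simp: U_def)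
    fix T assume "T \<in> U n"
    then obtain g K where g: "g \<in> full_mp M f" "T = cls M g" and K: "prob (E g K) < 1 / real (Suc n)"
      by (auto simp: U_def)
    have gm: "g \<in> mp_bijections M" by (rule f.full_mp_mp[OF g(1)])
    interpret g: mp_map M g by (rule mp_mapI[OF gm])
    \<comment> \<open>A Lipschitz constant for all exponents up to \<open>K\<close> together; adding
      1 makes it positive also for \<open>K = 0\<close>.\<close>
    define c where "c = (\<Sum>k\<in>{-int K..int K}. real_of_int \<bar>k\<bar>) + 1"
    have c: "c > 0" by (auto simp: c_def intro!: add_nonneg_pos sum_nonneg)
    define \<rho> where "\<rho> = (1 / real (Suc n) - prob (E g K)) / c"
    have \<rho>: "\<rho> > 0" using K c by (simp add: \<rho>_def)
    have "F.mball T \<rho> \<subseteq> U n"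
    proof
      fix T' assume "T' \<in> F.mball T \<rho>"
      then have T': "T' \<in> full_group M R" "d_u M T T' < \<rho>" by auto
      then obtain h where h: "h \<in> full_mp M f" "T' = cls M h" using R by blast
      have hm: "h \<in> mp_bijections M" by (rule f.full_mp_mp[OF h(1)])
      interpret h: mp_map M h by (rule mp_mapI[OF hm])
      have d: "du g h < \<rho>" using T'(2) d_u_cls[OF gm hm] g h by simp
      let ?N = "\<lambda>k. {x \<in> space M. g.P k x \<noteq> h.P k x}"
      have Ns: "?N k \<in> sets M" for k by (rule mp_neq_sets) auto
      have "prob (E h K) \<le> prob (E g K \<union> (\<Union>k\<in>{-int K..int K}. ?N k))"
        using Es[OF gm] Ns by (intro finite_measure_mono) (auto simp: E_def)
      also have "\<dots> \<le> prob (E g K) + prob (\<Union>k\<in>{-int K..int K}. ?N k)"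
        using Es[OF gm] Ns by (intro measure_Un_le) auto
      also have "prob (\<Union>k\<in>{-int K..int K}. ?N k) \<le> (\<Sum>k\<in>{-int K..int K}. prob (?N k))"
        using Ns by (intro finite_measure_subadditive_finite) auto
      also have "\<dots> \<le> (\<Sum>k\<in>{-int K..int K}. real_of_int \<bar>k\<bar> * du g h)"
        using du_int_pow[OF gm hm] by (intro sum_mono) (simp add: du_def)
      also have "\<dots> = (\<Sum>k\<in>{-int K..int K}. real_of_int \<bar>k\<bar>) * du g h" by (rule sum_distrib_right[symmetric])
      also have "\<dots> \<le> c * du g h" by (rule mult_right_mono) (auto simp: c_def)
      also have "\<dots> < c * \<rho>" using d c by simp
      finally have "prob (E h K) < 1 / real (Suc n)" using c by (simp add: \<rho>_def)
      then show "T' \<in> U n" using h by (auto simp: U_def)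
    qed
    then show "\<exists>r>0. F.mball T r \<subseteq> U n" using \<rho> by blast
  qed
  have "GEN M R = (\<Inter>n. U n)"
  proof (intro equalityI subsetI)
    fix T assume "T \<in> GEN M R"
    then obtain g where g: "g \<in> full_mp M f" "f \<in> full_mp M g" "T = cls M g" using GR by blast
    interpret g: mp_map M g by (rule mp_mapI[OF f.full_mp_mp[OF g(1)]])
    have "\<exists>K. prob (E g K) < 1 / real (Suc n)" for n
      unfolding E_def by (rule g.full_bounded[OF g(2)]) simp
    then show "T \<in> (\<Inter>n. U n)" using g by (auto simp: U_def)
  next
    fix T assume T: "T \<in> (\<Inter>n. U n)"
    have "\<forall>n. \<exists>g. g \<in> full_mp M f \<and> (\<exists>K. prob (E g K) < 1 / real (Suc n)) \<and> T = cls M g"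
      using T unfolding U_def by blast
    from choice[OF this] obtain g where g: "\<And>n. g n \<in> full_mp M f" "\<And>n. \<exists>K. prob (E (g n) K) < 1 / real (Suc n)"
      "\<And>n. T = cls M (g n)" by blast
    have gm: "g n \<in> mp_bijections M" for n by (rule f.full_mp_mp[OF g(1)])
    interpret g0: mp_map M "g 0" by (rule mp_mapI[OF gm])
    let ?Z = "{x \<in> space M. \<forall>k. f x \<noteq> g0.P k x}"
    have Zs: "?Z \<in> sets M"
      by (rule sets.sets_Collect_countable_All) (auto intro: mp_neq_sets f)
    have "prob ?Z \<le> 1 / real (Suc n)" for n
    proof -
      interpret gn: mp_map M "g n" by (rule mp_mapI[OF gm])
      obtain K where K: "prob (E (g n) K) < 1 / real (Suc n)" using g(2) by blast
      \<comment> \<open>The representatives chosen for different \<open>n\<close> agree almost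
        everywhere, so they have almost everywhere the same orbits and can be compared with
        \<open>g 0\<close>.\<close>
      have "cls M (g 0) = cls M (g n)" using g(3)[of 0] g(3)[of n] by simp
      then have ae: "AE x in M. g 0 x = g n x" using cls_eq_iff[OF gm gm] by blast
      have "g 0 \<in> full_mp M (g 0)" using g0.P_full[of 1] by (simp add: g0.P_1)
      then have "g n \<in> full_mp M (g 0)" using ae by (rule g0.full_mp_cong[OF _ gm])
      from full_mp_orbits[OF gm this]
      have "AE x in M. x \<in> ?Z \<longrightarrow> x \<in> E (g n) K"
      proof eventually_elim
        case (elim x)
        show ?case
        proof
          assume x: "x \<in> ?Z"
          have "f x \<noteq> gn.P k x" for k
          proof -
            obtain l where "gn.P k x = g0.P l x" using elim by blast
            then show ?thesis using x by simp
          qed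
          then show "x \<in> E (g n) K" using x by (simp add: E_def)
        qed
      qed
      then have "prob ?Z \<le> prob (E (g n) K)" using Es[OF gm] by (rule finite_measure_mono_AE)
      then show ?thesis using K by simp
    qed
    then have "prob ?Z \<le> 0"
      using LIMSEQ_inverse_real_of_nat by (intro LIMSEQ_le_const) (auto simp: inverse_eq_divide)
    then have "prob ?Z = 0" by (simp add: measure_le_0_iff)
    then have "AE x in M. x \<notin> ?Z" using prob_eq_0[OF Zs] by blast
    then have "AE x in M. \<exists>k. f x = g0.P k x" using AE_space by eventually_elim auto
    then have "f \<in> full_mp M (g 0)" using f by (simp add: g0.full_mp_iff)
    then show "T \<in> GEN M R" using g GR by blast
  qed
  moreover have "gdelta_in F.mtopology (\<Inter>n. U n)"
    by (rule gdelta_in_Inter) (auto intro: open_imp_gdelta_in op)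
  ultimately show ?thesis by (simp add: full_topology_def)
qed

text \<open>An element is determined by the sets \<open>S v k\<close> on which it equals the power
  \<open>k\<close>; up to small measure finitely many of them matter, and these are approximated in
  a countable algebra. One element is kept for every code that occurs.\<close>

lemma separable_full_group:
  assumes f: "f \<in> mp_bijections M" and R: "full_group M R = cls M ` full_mp M f"
  shows "\<exists>\<V>. countable \<V> \<and> \<V> \<subseteq> full_group M R \<and> (\<forall>V\<in>full_group M R. \<forall>\<epsilon>>0. \<exists>V'\<in>\<V>. d_u M V V' < \<epsilon>)"
proof -
  interpret f: mp_map M f by (rule mp_mapI[OF f])
  from countable_dense_algebra obtain \<A> where
    "countable \<A> \<and> \<A> \<subseteq> sets M \<and> (\<forall>B\<in>sets M. \<forall>\<epsilon>>0. \<exists>A\<in>\<A>. prob ((A - B) \<union> (B - A)) < \<epsilon>)"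
    by (elim exE)
  then have \<A>: "countable \<A>" "\<A> \<subseteq> sets M" and
    dense: "\<And>B \<epsilon>. B \<in> sets M \<Longrightarrow> \<epsilon> > 0 \<Longrightarrow> \<exists>A\<in>\<A>. prob ((A - B) \<union> (B - A)) < \<epsilon>"
    by auto
  define S where "S v k = {x \<in> space M. v x = f.P k x}" for v k
  have Ss: "S v k \<in> sets M" if "v \<in> full_mp M f" for v k
    unfolding S_def by (rule mp_eq_sets[OF f.full_mp_mp[OF that] f.P_mp])
  \<comment> \<open>A code consists of the bound on the exponents, the list of approximating sets
    and the precision; the set for the exponent \<open>k\<close> has index
    \<open>k + fst i\<close>.\<close>
  define good where "good i v \<longleftrightarrow> v \<in> full_mp M f \<and> (\<forall>k\<in>{-int (fst i)..int (fst i)}.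
      prob ((fst (snd i) ! nat (k + int (fst i)) - S v k) \<union> (S v k - fst (snd i) ! nat (k + int (fst i))))
        < 1 / (real (2 * fst i + 1) * real (Suc (snd (snd i)))))" for i :: "nat \<times> 'a set list \<times> nat" and v
  define I where "I = (UNIV :: nat set) \<times> lists \<A> \<times> (UNIV :: nat set)"
  have I: "countable I" unfolding I_def using \<A>(1) by (intro countable_SIGMA countable_lists) auto
  define \<V> where "\<V> = (\<lambda>i. cls M (SOME v. good i v)) ` {i \<in> I. \<exists>v. good i v}"
  have gs: "good i (SOME v. good i v)" if "\<exists>v. good i v" for i using that by (rule someI_ex)
  have "\<exists>V'\<in>\<V>. d_u M V V' < \<epsilon>" if "V \<in> full_group M R" "\<epsilon> > 0" for V \<epsilon>
  proof -
    obtain v where v: "v \<in> full_mp M f" "V = cls M v" using \<open>V \<in> _\<close> R by blast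
    have vm: "v \<in> mp_bijections M" by (rule f.full_mp_mp[OF v(1)])
    have "\<epsilon> / 2 > 0" using \<open>\<epsilon> > 0\<close> by simp
    from f.full_bounded[OF v(1) this] obtain K where
      K: "prob {x \<in> space M. \<forall>k\<in>{-int K..int K}. v x \<noteq> f.P k x} < \<epsilon> / 2" by blast
    obtain j :: nat where j: "real j > 4 / \<epsilon>" using reals_Archimedean2 by blast
    \<comment> \<open>\<open>2 * K + 1\<close> exponents with two approximations each give a total
      error of at most \<open>2 / Suc j\<close>.\<close>
    define \<eta> where "\<eta> = 1 / (real (2 * K + 1) * real (Suc j))"
    have \<eta>: "\<eta> > 0" by (simp add: \<eta>_def)
    have "\<forall>k. \<exists>A. A \<in> \<A> \<and> prob ((A - S v k) \<union> (S v k - A)) < \<eta>"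
      using dense[OF Ss[OF v(1)] \<eta>] by blast
    from choice[OF this] obtain A where A: "\<And>k. A k \<in> \<A>" "\<And>k. prob ((A k - S v k) \<union> (S v k - A k)) < \<eta>" by blast
    define i where "i = (K, map (\<lambda>l. A (int l - int K)) [0..<2 * K + 1], j)"
    have iA: "fst (snd i) ! nat (k + int K) = A k" if "k \<in> {-int K..int K}" for k
    proof -
      have "nat (k + int K) < 2 * K + 1" using that by auto
      then show ?thesis using that by (simp add: i_def del: upt_Suc)
    qed
    have "good i v" using v(1) A(2) iA by (simp add: good_def i_def \<eta>_def del: upt_Suc)
    then have ex: "\<exists>v. good i v" by blast
    have "i \<in> I" using A(1) by (auto simp: I_def i_def)
    define v' where "v' = (SOME v. good i v)"
    have v': "good i v'" unfolding v'_def by (rule gs[OF ex])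
    have V': "cls M v' \<in> \<V>" using ex \<open>i \<in> I\<close> by (auto simp: \<V>_def v'_def)
    have v'F: "v' \<in> full_mp M f" using v' by (simp add: good_def)
    have A': "prob ((A k - S v' k) \<union> (S v' k - A k)) < \<eta>" if "k \<in> {-int K..int K}" for k
    proof -
      have "\<forall>k\<in>{-int K..int K}. prob ((fst (snd i) ! nat (k + int K) - S v' k) \<union>
          (S v' k - fst (snd i) ! nat (k + int K))) < \<eta>"
        using v' unfolding good_def by (simp add: i_def \<eta>_def del: upt_Suc)
      from bspec[OF this that] show ?thesis unfolding iA[OF that] .
    qed
    let ?B = "{x \<in> space M. \<forall>k\<in>{-int K..int K}. v x \<noteq> f.P k x}"
    let ?D = "\<lambda>k. ((A k - S v k) \<union> (S v k - A k)) \<union> ((A k - S v' k) \<union> (S v' k - A k))"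
    have Bs: "?B \<in> sets M" by (rule sets.sets_Collect_finite_All) (auto intro: mp_neq_sets vm)
    have As: "A k \<in> sets M" for k using A(1) \<A>(2) by blast
    have Ds: "?D k \<in> sets M" for k using As Ss[OF v(1)] Ss[OF v'F] by blast
    have UDs: "(\<Union>k\<in>{-int K..int K}. ?D k) \<in> sets M" by (rule sets.finite_UN[OF _ Ds]) simp
    have "x \<in> ?B \<union> (\<Union>k\<in>{-int K..int K}. ?D k)" if x: "x \<in> space M" "v x \<noteq> v' x" for x
    proof (cases "x \<in> ?B")
      case False
      then obtain k where k: "k \<in> {-int K..int K}" "v x = f.P k x" using x(1) by blast
      then have "x \<in> S v k" "x \<notin> S v' k" using x by (simp_all add: S_def)
      then have "x \<in> ?D k" by blast
      then show ?thesis using k(1) by blast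
    qed blast
    then have "du v v' \<le> prob (?B \<union> (\<Union>k\<in>{-int K..int K}. ?D k))"
      using sets.Un[OF Bs UDs] by (rule du_le)
    also have "\<dots> \<le> prob ?B + prob (\<Union>k\<in>{-int K..int K}. ?D k)"
      by (rule measure_Un_le[OF Bs UDs])
    also have "prob (\<Union>k\<in>{-int K..int K}. ?D k) \<le> (\<Sum>k\<in>{-int K..int K}. prob (?D k))"
      by (rule finite_measure_subadditive_finite) (use Ds in blast)+
    also have "\<dots> \<le> (\<Sum>k\<in>{-int K..int K}. 2 * \<eta>)"
    proof (rule sum_mono)
      fix k assume k: "k \<in> {-int K..int K}"
      have "prob (?D k) \<le> prob ((A k - S v k) \<union> (S v k - A k)) + prob ((A k - S v' k) \<union> (S v' k - A k))"
        by (intro measure_Un_le sets.Un sets.Diff As Ss[OF v(1)] Ss[OF v'F])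
      then show "prob (?D k) \<le> 2 * \<eta>" using A(2)[of k] A'[OF k] by simp
    qed
    also have "\<dots> = real (2 * K + 1) * (2 * (1 / (real (2 * K + 1) * real (Suc j))))"
      unfolding \<eta>_def sum_constant by (rule arg_cong2[where f = "(*)"]) (auto simp: nat_add_distrib)
    also have "\<dots> = 2 / real (Suc j)"
    proof -
      have "a \<noteq> 0 \<Longrightarrow> a * (2 * (1 / (a * b))) = 2 / b" for a b :: real by (simp add: field_simps)
      then show ?thesis by (simp del: of_nat_Suc of_nat_add of_nat_mult)
    qed
    also have "2 / real (Suc j) < \<epsilon> / 2"
    proof -
      have "4 / \<epsilon> < real (Suc j)" using j by simp
      then show ?thesis using \<open>\<epsilon> > 0\<close> by (simp add: field_simps)
    qed
    finally have "du v v' < \<epsilon>" using K by simp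
    then have "d_u M V (cls M v') < \<epsilon>" using d_u_cls[OF vm f.full_mp_mp[OF v'F]] v(2) by simp
    then show ?thesis using V' by (rule bexI)
  qed
  moreover have "\<V> \<subseteq> full_group M R"
  proof
    fix V assume "V \<in> \<V>"
    then obtain i where "V = cls M (SOME v. good i v)" "\<exists>v. good i v" unfolding \<V>_def by blast
    then show "V \<in> full_group M R" using gs[of i] unfolding R good_def by blast
  qed
  moreover have "countable \<V>" unfolding \<V>_def by (intro countable_image countable_Collect I)
  ultimately show ?thesis by blast
qed

lemma openin_prod_full:
  assumes S: "S \<subseteq> GEN M R \<times> full_group M R"
    and loc: "\<And>T U. (T, U) \<in> S \<Longrightarrow> \<exists>\<delta>>0. \<forall>T'\<in>GEN M R. \<forall>U'\<in>full_group M R.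
      d_u M T T' < \<delta> \<longrightarrow> d_u M U U' < \<delta> \<longrightarrow> (T', U') \<in> S"
  shows "openin (prod_topology (GEN_topology M R) (full_topology M R)) S"
proof -
  interpret F: Metric_space "full_group M R" "d_u M" by (rule Metric_space_full_group[OF std])
  show ?thesis
    unfolding openin_prod_topology_alt
  proof (intro allI impI)
    fix T U assume TU: "(T, U) \<in> S"
    then obtain \<delta> where \<delta>: "\<delta> > 0" "\<And>T' U'. \<lbrakk>T' \<in> GEN M R; U' \<in> full_group M R; d_u M T T' < \<delta>; d_u M U U' < \<delta>\<rbrakk> \<Longrightarrow> (T', U') \<in> S"
      using loc by meson
    have in_F: "T \<in> GEN M R" "T \<in> full_group M R" "U \<in> full_group M R"
      using TU S GEN_subset_full_group[of M R] by auto
    show "\<exists>A B. openin (GEN_topology M R) A \<and> openin (full_topology M R) B \<and> T \<in> A \<and> U \<in> B \<and> A \<times> B \<subseteq> S"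
    proof (intro exI conjI)
      show "openin (GEN_topology M R) (F.mball T \<delta> \<inter> GEN M R)"
        unfolding GEN_topology_def full_topology_def by (rule openin_subtopology_Int) (rule F.openin_mball)
      show "openin (full_topology M R) (F.mball U \<delta>)"
        unfolding full_topology_def by (rule F.openin_mball)
      show "T \<in> F.mball T \<delta> \<inter> GEN M R" "U \<in> F.mball U \<delta>" using in_F \<delta>(1) by auto
      show "(F.mball T \<delta> \<inter> GEN M R) \<times> F.mball U \<delta> \<subseteq> S" using \<delta>(2) by auto
    qed
  qed
qed

lemma dense_prod_full:
  assumes S: "S \<subseteq> GEN M R \<times> full_group M R"
    and app: "\<And>T U \<epsilon>. \<lbrakk>T \<in> GEN M R; U \<in> full_group M R; \<epsilon> > 0\<rbrakk> \<Longrightarrow>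
      \<exists>(T', U')\<in>S. d_u M T T' < \<epsilon> \<and> d_u M U U' < \<epsilon>"
  shows "prod_topology (GEN_topology M R) (full_topology M R) closure_of S = GEN M R \<times> full_group M R"
proof -
  interpret F: Metric_space "full_group M R" "d_u M" by (rule Metric_space_full_group[OF std])
  let ?Y = "prod_topology (GEN_topology M R) (full_topology M R)"
  have top: "topspace ?Y = GEN M R \<times> full_group M R"
    using topspace_GEN_topology[OF std] topspace_full_topology[OF std] by simp
  have "p \<in> ?Y closure_of S" if p: "p \<in> GEN M R \<times> full_group M R" for p
    unfolding in_closure_of
  proof (intro conjI allI impI)
    show "p \<in> topspace ?Y" using p top by blast
    fix O' assume O: "p \<in> O' \<and> openin ?Y O'"
    obtain T U where pTU: "p = (T, U)" by fastforce
    then have TU: "T \<in> GEN M R" "T \<in> full_group M R" "U \<in> full_group M R"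
      using p GEN_subset_full_group[of M R] by auto
    obtain A B where AB: "openin (GEN_topology M R) A" "openin (full_topology M R) B" "T \<in> A" "U \<in> B" "A \<times> B \<subseteq> O'"
      using O pTU unfolding openin_prod_topology_alt by meson
    obtain A' where A': "openin F.mtopology A'" "A = A' \<inter> GEN M R"
      using AB(1) by (auto simp: GEN_topology_def full_topology_def openin_subtopology)
    obtain r1 where r1: "r1 > 0" "F.mball T r1 \<subseteq> A'"
      using A' AB(3) unfolding F.openin_mtopology by blast
    obtain r2 where r2: "r2 > 0" "F.mball U r2 \<subseteq> B"
      using AB(2,4) unfolding full_topology_def F.openin_mtopology by blast
    obtain T' U' where S': "(T', U') \<in> S" "d_u M T T' < min r1 r2" "d_u M U U' < min r1 r2"
      using app[OF TU(1,3), of "min r1 r2"] r1(1) r2(1) by auto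
    then have m: "T' \<in> GEN M R" "T' \<in> full_group M R" "U' \<in> full_group M R"
      using S GEN_subset_full_group[of M R] by auto
    have "T' \<in> A" "U' \<in> B" using r1(2) r2(2) S' m TU A'(2) by auto
    then show "\<exists>y. y \<in> S \<and> y \<in> O'" using S'(1) AB(5) by blast
  qed
  then show ?thesis using closure_of_subset_topspace[of ?Y S] top by blast
qed

lemma generators_dense_gdelta:
  assumes R: "pmp_equiv_rel M R" "aperiodic M R" "singly_generated M R"
  defines "Y \<equiv> prod_topology (GEN_topology M R) (full_topology M R)"
  defines "S \<equiv> {(T, U) \<in> GEN M R \<times> full_group M R.
      full_topology M R closure_of generate (Aut M) {T, U} = full_group M R \<and>
      Aut M \<lparr>carrier := generate (Aut M) {T, U}\<rparr> \<cong> F\<^sub>2}"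
  shows "gdelta_in Y S \<and> Y closure_of S = GEN M R \<times> full_group M R"
proof -
  interpret F: Metric_space "full_group M R" "d_u M" by (rule Metric_space_full_group[OF std])
  let ?G = "GEN M R" and ?F = "full_group M R"
  \<comment> \<open>Any generator may take the place of the base map, so the tower arguments apply
    around every \<open>T\<close> and not only around a fixed \<open>f\<close>.\<close>
  have rep: "\<exists>g. aper_map M g \<and> T = cls M g \<and> ?F = cls M ` full_mp M g \<and>
      ?G = cls M ` {h \<in> full_mp M g. g \<in> full_mp M h}" if TG: "T \<in> ?G" for T
  proof -
    obtain g where g: "T \<in> carrier (Aut M)" "g \<in> T" "rel_eq_mod_null M R (orbit_rel (space M) g)"
      using TG by (auto simp: GEN_def)
    have gm: "g \<in> mp_bijections M" "T = cls M g" using Aut_cls'[OF g(1,2)] by auto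
    interpret g: mp_map M g by (rule mp_mapI[OF gm(1)])
    have "aper_map M g"
      by unfold_locales (rule aperiodic_orbit_rel[OF gm(1) R(1,2) g(3)])
    then show ?thesis
      using gm full_group_rel_cong[OF g(3)] g.full_group_orbit_rel GEN_rel_cong[OF g(3)] GEN_orbit_rel[OF gm(1)]
      by blast
  qed
  obtain f where f: "aper_map M f" "?F = cls M ` full_mp M f" "?G = cls M ` {h \<in> full_mp M f. f \<in> full_mp M h}"
    using R(3) rep unfolding singly_generated_def by blast
  interpret f: aper_map M f by (rule f(1))
  have GF: "?G \<subseteq> ?F" by (rule GEN_subset_full_group)
  have FA: "?F \<subseteq> carrier (Aut M)" by (auto simp: full_group_def)
  have Frep: "\<exists>h\<in>mp_bijections M. T = cls M h" if "T \<in> ?F" for T using that Aut_cls FA by blast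

  \<comment> \<open>The letters \<open>True\<close> and \<open>False\<close> of
    \<open>F\<^sub>2\<close> stand for \<open>T\<close> and \<open>U\<close>.\<close>
  define pair where "pair T U = (\<lambda>s. if s then T else U)" for T U :: "('a \<Rightarrow> 'a) set"
  let ?w = "\<lambda>T U w. word_val (Aut M) (pair T U) w"
  have fam: "group_family (Aut M) (pair T U)" if "T \<in> ?F" "U \<in> ?F" for T U
    by (rule group.group_family[OF group_Aut]) (use that FA in \<open>auto simp: pair_def\<close>)
  have gen: "generate (Aut M) {T, U} = range (?w T U)" if "T \<in> ?F" "U \<in> ?F" for T U
  proof -
    have "range (pair T U) = {T, U}" by (auto simp: pair_def UNIV_bool)
    then show ?thesis using group_family.generate_word_val[OF fam[OF that]] by simp
  qed
  have genF: "generate (Aut M) {T, U} \<subseteq> ?F" if TU: "T \<in> ?F" "U \<in> ?F" for T U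
  proof -
    obtain t u where tu: "t \<in> full_mp M f" "u \<in> full_mp M f" "T = cls M t" "U = cls M u"
      using TU f(2) by auto
    have m: "t \<in> mp_bijections M" "u \<in> mp_bijections M" using tu f.full_mp_mp by auto
    have "?w T U w = cls M (word_val (mp_group M) (\<lambda>s. if s then t else u) w)" for w
    proof -
      have "pair T U = (\<lambda>s. cls M (if s then t else u))" by (auto simp: pair_def tu fun_eq_iff)
      then show ?thesis using cls_word_val[of "\<lambda>s. if s then t else u" M w] m by simp
    qed
    moreover have "word_val (mp_group M) (\<lambda>s. if s then t else u) w \<in> full_mp M f" for w
    proof -
      interpret F: group_family "mp_group M" "\<lambda>s. if s then t else u"
        by (rule f.G.group_family) (use m in auto)
      have "range (\<lambda>s. if s then t else u) \<subseteq> full_mp M f" using tu by auto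
      then have "generate (mp_group M) (range (\<lambda>s. if s then t else u)) \<subseteq> full_mp M f"
        by (rule f.G.generate_subgroup_incl[OF _ f.subgroup_full_mp])
      then show ?thesis unfolding F.generate_word_val by blast
    qed
    ultimately show ?thesis using gen[OF TU] f(2) by auto
  qed
  have cont: "\<exists>\<delta>>0. \<forall>T'\<in>?F. \<forall>U'\<in>?F. d_u M T T' < \<delta> \<longrightarrow> d_u M U U' < \<delta> \<longrightarrow> d_u M (?w T U w) (?w T' U' w) < \<epsilon>"
    if TU: "T \<in> ?F" "U \<in> ?F" and e: "\<epsilon> > 0" for T U w and \<epsilon> :: real
  proof -
    obtain t u where tu: "t \<in> mp_bijections M" "u \<in> mp_bijections M" "T = cls M t" "U = cls M u"
      using Frep TU by blast
    have pr: "?w (cls M t) (cls M u) w = cls M (word_val (mp_group M) (\<lambda>s. if s then t else u) w)"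
      if "t \<in> mp_bijections M" "u \<in> mp_bijections M" for t u
    proof -
      have "pair (cls M t) (cls M u) = (\<lambda>s. cls M (if s then t else u))" by (auto simp: pair_def fun_eq_iff)
      then show ?thesis using cls_word_val[of "\<lambda>s. if s then t else u" M w] that by simp
    qed
    have wm: "word_val (mp_group M) (\<lambda>s. if s then t else u) w \<in> mp_bijections M"
      if "t \<in> mp_bijections M" "u \<in> mp_bijections M" for t u
    proof -
      interpret F: group_family "mp_group M" "\<lambda>s. if s then t else u"
        by (rule f.G.group_family) (use that in auto)
      show ?thesis using F.word_val_closed[of w] by simp
    qed
    define \<delta> where "\<delta> = \<epsilon> / (real (length w) + 1)"
    have \<delta>: "\<delta> > 0" "real (length w) * \<delta> < \<epsilon>" using e by (auto simp: \<delta>_def field_simps)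
    have "d_u M (?w T U w) (?w T' U' w) < \<epsilon>"
      if T'U': "T' \<in> ?F" "U' \<in> ?F" and d: "d_u M T T' < \<delta>" "d_u M U U' < \<delta>" for T' U'
    proof -
      obtain t' u' where tu': "t' \<in> mp_bijections M" "u' \<in> mp_bijections M" "T' = cls M t'" "U' = cls M u'"
        using Frep T'U' by blast
      have "du t t' < \<delta>" "du u u' < \<delta>" using d tu tu' d_u_cls by auto
      then have "du (word_val (mp_group M) (\<lambda>s. if s then t else u) w) (word_val (mp_group M) (\<lambda>s. if s then t' else u') w)
          \<le> real (length w) * \<delta>"
        using tu tu' by (intro du_word_val) auto
      then show ?thesis using \<delta>(2) tu tu' pr wm d_u_cls by simp
    qed
    then show ?thesis using \<delta>(1) by blast
  qed
  obtain \<V> where V: "countable \<V>" "\<V> \<subseteq> ?F" "\<And>V \<epsilon>. V \<in> ?F \<Longrightarrow> \<epsilon> > 0 \<Longrightarrow> \<exists>V'\<in>\<V>. d_u M V V' < \<epsilon>"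
    using separable_full_group[OF f.f_mp f(2)] by blast
  \<comment> \<open>\<open>O1\<close> is indexed by a target with a precision, \<open>O2\<close> by
    a word. Both amount to strict inequalities between quantities continuous in the pair, which
    makes them open.\<close>
  define O1 where "O1 i = {(T, U) \<in> ?G \<times> ?F. \<exists>w. d_u M (?w T U w) (fst i) < 1 / real (Suc (snd i))}" for i :: "('a \<Rightarrow> 'a) set \<times> nat"
  define O2 where "O2 w = {(T, U) \<in> ?G \<times> ?F. ?w T U w \<noteq> \<one>\<^bsub>Aut M\<^esub>}" for w
  let ?I = "\<V> \<times> (UNIV :: nat set)" and ?W = "{w. reduced w \<and> w \<noteq> []}"
  define \<O> where "\<O> = O1 ` ?I \<union> O2 ` ?W"
  have wF: "?w T U w \<in> ?F" if "T \<in> ?F" "U \<in> ?F" for T U w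
    using genF[OF that] gen[OF that] by blast
  have oneF: "\<one>\<^bsub>Aut M\<^esub> \<in> ?F"
    using wF[of _ _ "[]"] f(2) f.P_full by force
  have op1: "openin Y (O1 i)" if i: "i \<in> ?I" for i
    unfolding Y_def
  proof (rule openin_prod_full)
    fix T U assume "(T, U) \<in> O1 i"
    then obtain w where TU: "T \<in> ?F" "U \<in> ?F" and w: "d_u M (?w T U w) (fst i) < 1 / real (Suc (snd i))"
      using GF by (auto simp: O1_def)
    define \<epsilon> where "\<epsilon> = 1 / real (Suc (snd i)) - d_u M (?w T U w) (fst i)"
    have "\<epsilon> > 0" using w by (simp add: \<epsilon>_def)
    then obtain \<delta> where \<delta>: "\<delta> > 0" "\<forall>T'\<in>?F. \<forall>U'\<in>?F. d_u M T T' < \<delta> \<longrightarrow> d_u M U U' < \<delta> \<longrightarrow> d_u M (?w T U w) (?w T' U' w) < \<epsilon>"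
      using cont[OF TU, of \<epsilon> w] by blast
    have "(T', U') \<in> O1 i" if T'U': "T' \<in> ?G" "U' \<in> ?F" "d_u M T T' < \<delta>" "d_u M U U' < \<delta>" for T' U'
    proof -
      have T'F: "T' \<in> ?F" using T'U' GF by blast
      have iF: "fst i \<in> ?F" using i V(2) by auto
      have "d_u M (?w T' U' w) (fst i) \<le> d_u M (?w T' U' w) (?w T U w) + d_u M (?w T U w) (fst i)"
        by (rule F.triangle[OF wF[OF T'F T'U'(2)] wF[OF TU] iF])
      also have "d_u M (?w T' U' w) (?w T U w) < \<epsilon>"
        using \<delta>(2) T'F T'U' by (simp add: F.commute)
      finally have "d_u M (?w T' U' w) (fst i) < 1 / real (Suc (snd i))" by (simp add: \<epsilon>_def)
      then show ?thesis using T'U' unfolding O1_def by blast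
    qed
    then show "\<exists>\<delta>>0. \<forall>T'\<in>?G. \<forall>U'\<in>?F. d_u M T T' < \<delta> \<longrightarrow> d_u M U U' < \<delta> \<longrightarrow> (T', U') \<in> O1 i"
      using \<delta>(1) by blast
  qed (auto simp: O1_def)
  have op2: "openin Y (O2 w)" for w
    unfolding Y_def
  proof (rule openin_prod_full)
    fix T U assume "(T, U) \<in> O2 w"
    then have TU: "T \<in> ?F" "U \<in> ?F" and ne: "?w T U w \<noteq> \<one>\<^bsub>Aut M\<^esub>"
      using GF by (auto simp: O2_def)
    have "d_u M (?w T U w) \<one>\<^bsub>Aut M\<^esub> > 0" using ne F.mdist_pos_less wF[OF TU] oneF by blast
    then obtain \<delta> where \<delta>: "\<delta> > 0" "\<forall>T'\<in>?F. \<forall>U'\<in>?F. d_u M T T' < \<delta> \<longrightarrow> d_u M U U' < \<delta> \<longrightarrow>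
        d_u M (?w T U w) (?w T' U' w) < d_u M (?w T U w) \<one>\<^bsub>Aut M\<^esub>"
      using cont[OF TU, of "d_u M (?w T U w) \<one>\<^bsub>Aut M\<^esub>" w] by blast
    have "(T', U') \<in> O2 w" if "T' \<in> ?G" "U' \<in> ?F" "d_u M T T' < \<delta>" "d_u M U U' < \<delta>" for T' U'
      using \<delta>(2) that GF unfolding O2_def by fastforce
    then show "\<exists>\<delta>>0. \<forall>T'\<in>?G. \<forall>U'\<in>?F. d_u M T T' < \<delta> \<longrightarrow> d_u M U U' < \<delta> \<longrightarrow> (T', U') \<in> O2 w"
      using \<delta>(1) by blast
  qed (auto simp: O2_def)
  have de1: "Y closure_of (O1 i) = ?G \<times> ?F" if i: "i \<in> ?I" for i
    unfolding Y_def
  proof (rule dense_prod_full)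
    fix T U and \<epsilon> :: real assume TU: "T \<in> ?G" "U \<in> ?F" and e: "\<epsilon> > 0"
    obtain g where g: "aper_map M g" "T = cls M g" "?F = cls M ` full_mp M g"
      "?G = cls M ` {h \<in> full_mp M g. g \<in> full_mp M h}" using rep[OF TU(1)] by blast
    interpret g: aper_map M g by (rule g(1))
    obtain u where u: "u \<in> full_mp M g" "U = cls M u" using TU(2) g(3) by blast
    have "fst i \<in> ?F" using i V(2) by auto
    then obtain v where v: "v \<in> full_mp M g" "fst i = cls M v" using g(3) by blast
    define \<delta> where "\<delta> = min \<epsilon> (1 / real (Suc (snd i)))"
    have \<delta>: "\<delta> > 0" using e by (simp add: \<delta>_def)
    obtain t' u' y where t': "t' \<in> full_mp M g" "g \<in> full_mp M t'" and u': "u' \<in> full_mp M g"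
      and y: "y \<in> generate (mp_group M) {t', u'}" and d: "du t' g < \<delta>" "du u' u < \<delta>" "du y v < \<delta>"
      using g.dense_generation[OF u(1) v(1) \<delta>] by blast
    have m: "t' \<in> mp_bijections M" "u' \<in> mp_bijections M" "u \<in> mp_bijections M" "v \<in> mp_bijections M"
      using g.full_mp_mp t' u' u v by auto
    have T': "cls M t' \<in> ?G" "cls M t' \<in> ?F" and U': "cls M u' \<in> ?F" using t' u' g(3,4) by auto
    have ym: "y \<in> mp_bijections M"
      using f.G.generate_in_carrier[OF _ y] m by auto
    have "cls M y \<in> generate (Aut M) (cls M ` {t', u'})"
      by (rule group_hom.hom_generate[OF group_hom_cls y]) (use m in auto)
    then obtain w where w: "cls M y = ?w (cls M t') (cls M u') w" using gen[OF T'(2) U'] by auto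
    have "d_u M (cls M y) (fst i) < 1 / real (Suc (snd i))"
      using d(3) d_u_cls[OF ym m(4)] v(2) by (simp add: \<delta>_def)
    then have "(cls M t', cls M u') \<in> O1 i" using T' U' w unfolding O1_def by auto
    moreover have "d_u M T (cls M t') < \<epsilon>" "d_u M U (cls M u') < \<epsilon>"
      using d d_u_cls m g.f_mp g(2) u(2) by (simp_all add: \<delta>_def du_commute)
    ultimately show "\<exists>(T', U')\<in>O1 i. d_u M T T' < \<epsilon> \<and> d_u M U U' < \<epsilon>" by blast
  qed (auto simp: O1_def)
  \<comment> \<open>Here \<open>T\<close> itself is kept and only \<open>U\<close> moves, whereas
    \<open>O1\<close> required a perturbation of both.\<close>
  have de2: "Y closure_of (O2 w) = ?G \<times> ?F" if w: "w \<in> ?W" for w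
    unfolding Y_def
  proof (rule dense_prod_full)
    fix T U and \<epsilon> :: real assume TU: "T \<in> ?G" "U \<in> ?F" and e: "\<epsilon> > 0"
    obtain g where g: "aper_map M g" "T = cls M g" "?F = cls M ` full_mp M g" using rep[OF TU(1)] by blast
    interpret g: aper_map M g by (rule g(1))
    obtain u where u: "u \<in> full_mp M g" "U = cls M u" using TU(2) g(3) by blast
    obtain u' where u': "u' \<in> full_mp M g" "du u' u < \<epsilon>"
      "\<not> (AE x in M. word_val (mp_group M) (\<lambda>s. if s then g else u') w x = x)"
      using g.dense_nontrivial[of w u \<epsilon>] w u(1) e by blast
    have m: "u \<in> mp_bijections M" "u' \<in> mp_bijections M" using g.full_mp_mp u u' by auto
    interpret F: group_family "mp_group M" "\<lambda>s. if s then g else u'"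
      by (rule f.G.group_family) (use m g.f_mp in auto)
    let ?x = "word_val (mp_group M) (\<lambda>s. if s then g else u') w"
    have xm: "?x \<in> mp_bijections M" using F.word_val_closed[of w] by simp
    have "pair T (cls M u') = (\<lambda>s. cls M (if s then g else u'))" by (auto simp: pair_def g(2) fun_eq_iff)
    then have wx: "?w T (cls M u') w = cls M ?x"
      using cls_word_val[of "\<lambda>s. if s then g else u'" M w] m g.f_mp by simp
    have "cls M ?x \<noteq> \<one>\<^bsub>Aut M\<^esub>"
    proof
      assume "cls M ?x = \<one>\<^bsub>Aut M\<^esub>"
      then have "AE x in M. ?x x = \<one>\<^bsub>mp_group M\<^esub> x"
        using cls_eq_iff[OF xm mp_closed(3)] by (simp add: cls_one)
      then have "AE x in M. ?x x = x" using AE_space by eventually_elim (simp add: one_mp_group)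
      then show False using u'(3) by blast
    qed
    then have "(T, cls M u') \<in> O2 w" using TU(1) u'(1) g(3) wx unfolding O2_def by auto
    moreover have "d_u M T T < \<epsilon>" using TU(1) GF e by (auto simp: F.mdist_zero)
    moreover have "d_u M U (cls M u') < \<epsilon>" using u'(2) d_u_cls[OF m] u(2) by (simp add: du_commute)
    ultimately show "\<exists>(T', U')\<in>O2 w. d_u M T T' < \<epsilon> \<and> d_u M U U' < \<epsilon>" by blast
  qed (auto simp: O2_def)

  have cO: "countable \<O>"
    unfolding \<O>_def using V(1) by (intro countable_Un countable_image countable_SIGMA) auto
  have topY: "topspace Y = ?G \<times> ?F"
    using topspace_GEN_topology[OF std] topspace_full_topology[OF std] by (simp add: Y_def)
  have open_O: "openin Y A \<and> Y closure_of A = topspace Y" if "A \<in> \<O>" for A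
    using that op1 op2 de1 de2 topY unfolding \<O>_def by auto
  have neO: "\<O> \<noteq> {}"
  proof -
    have "[(True, True)] \<in> ?W" by simp
    then show ?thesis unfolding \<O>_def by blast
  qed
  have "S = \<Inter>\<O>"
  proof (intro equalityI subsetI)
    fix p assume "p \<in> S"
    then obtain T U where p: "p = (T, U)" and TU: "T \<in> ?G" "U \<in> ?F"
      and cl: "full_topology M R closure_of generate (Aut M) {T, U} = ?F"
      and iso: "Aut M \<lparr>carrier := generate (Aut M) {T, U}\<rparr> \<cong> F\<^sub>2"
      by (auto simp: S_def)
    have TF: "T \<in> ?F" using TU GF by blast
    have "p \<in> O1 i" if "i \<in> ?I" for i
    proof -
      have "fst i \<in> F.mtopology closure_of generate (Aut M) {T, U}"
        using that V(2) cl by (auto simp: full_topology_def)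
      then have "\<forall>r>0. \<exists>y\<in>generate (Aut M) {T, U}. y \<in> F.mball (fst i) r"
        by (auto simp: F.metric_closure_of)
      then obtain y where "y \<in> generate (Aut M) {T, U}" "y \<in> F.mball (fst i) (1 / real (Suc (snd i)))"
        by (metis divide_pos_pos of_nat_0_less_iff zero_less_Suc zero_less_one)
      then show ?thesis using p TU gen[OF TF TU(2)] by (auto simp: O1_def F.commute)
    qed
    moreover have "p \<in> O2 w" if "w \<in> ?W" for w
    proof -
      have "range (pair T U) = {T, U}" by (auto simp: pair_def UNIV_bool)
      then have "?w T U w \<noteq> \<one>\<^bsub>Aut M\<^esub>"
        using generate_iso_free_group_iff[OF fam[OF TF TU(2)]] iso that by (simp add: F\<^sub>2_def)
      then show ?thesis using p TU by (simp add: O2_def)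
    qed
    ultimately show "p \<in> \<Inter>\<O>" by (auto simp: \<O>_def)
  next
    fix p assume p: "p \<in> \<Inter>\<O>"
    then have "p \<in> ?G \<times> ?F" using neO open_O openin_subset topY by blast
    then obtain T U where pTU: "p = (T, U)" and TU: "T \<in> ?G" "U \<in> ?F" by blast
    have TF: "T \<in> ?F" using TU GF by blast
    have "\<exists>y\<in>generate (Aut M) {T, U}. y \<in> F.mball V r" if V': "V \<in> ?F" "r > 0" for V r
    proof -
      obtain V' where V2: "V' \<in> \<V>" "d_u M V V' < r / 2" using V(3)[of V "r / 2"] V' by auto
      obtain n where n: "1 / real (Suc n) < r / 2" using nat_approx_posE[of "r / 2"] V'(2) by auto
      have "p \<in> O1 (V', n)" using p V2(1) by (auto simp: \<O>_def)
      then obtain w where w: "d_u M (?w T U w) V' < 1 / real (Suc n)" by (auto simp: O1_def pTU)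
      have wS: "?w T U w \<in> generate (Aut M) {T, U}" "?w T U w \<in> ?F" "V' \<in> ?F"
        using gen[OF TF TU(2)] wF[OF TF TU(2)] V2(1) V(2) by auto
      have "d_u M V (?w T U w) \<le> d_u M V V' + d_u M V' (?w T U w)"
        by (rule F.triangle[OF V'(1) wS(3,2)])
      also have "\<dots> < r" using V2(2) w n F.commute[of V' "?w T U w"] by simp
      finally show ?thesis using wS V'(1) by auto
    qed
    then have "full_topology M R closure_of generate (Aut M) {T, U} = ?F"
      unfolding full_topology_def F.metric_closure_of by auto
    moreover have "Aut M \<lparr>carrier := generate (Aut M) {T, U}\<rparr> \<cong> F\<^sub>2"
    proof -
      have r: "range (pair T U) = {T, U}" by (auto simp: pair_def UNIV_bool)
      have "?w T U w \<noteq> \<one>\<^bsub>Aut M\<^esub>" if "reduced w" "w \<noteq> []" for w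
      proof -
        have "p \<in> O2 w" using p that by (auto simp: \<O>_def)
        then show ?thesis by (simp add: O2_def pTU)
      qed
      then show ?thesis
        using generate_iso_free_group_iff[OF fam[OF TF TU(2)]] r by (simp add: F\<^sub>2_def)
    qed
    ultimately show "p \<in> S" using TU by (simp add: S_def pTU)
  qed
  moreover have "gdelta_in Y (\<Inter>\<O>)"
    by (rule gdelta_in_Inter[OF cO neO]) (use open_O open_imp_gdelta_in in blast)
  moreover have "Y closure_of (\<Inter>\<O>) = topspace Y"
  proof (rule Baire_category[OF _ cO open_O])
    have "completely_metrizable_space (full_topology M R)"
      unfolding full_topology_def
      by (rule F.completely_metrizable_space_mtopology[OF mcomplete_full_group[OF f.f_mp f(2)]])
    moreover have "completely_metrizable_space (GEN_topology M R)"
      unfolding GEN_topology_def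
      by (rule completely_metrizable_space_gdelta_in[OF calculation gdelta_GEN[OF f.f_mp f(2,3)]])
    ultimately have "completely_metrizable_space Y"
      by (simp add: Y_def completely_metrizable_space_prod_topology)
    then show "completely_metrizable_space Y \<or> locally_compact_space Y \<and> regular_space Y" ..
  qed
  ultimately show ?thesis using topY by simp
qed

end

theorem corollary1p8:
  fixes M :: "'a measure" and R :: "'a rel"
  assumes "standard_prob_space M"
    and "pmp_equiv_rel M R"
    and "aperiodic M R"
    and "singly_generated M R"
  shows "let Y = prod_topology (GEN_topology M R) (full_topology M R);
             S = {(T, U) \<in> GEN M R \<times> full_group M R.
                    full_topology M R closure_of generate (Aut M) {T, U} = full_group M R \<and>
                    Aut M \<lparr>carrier := generate (Aut M) {T, U}\<rparr> \<cong> F\<^sub>2}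
         in gdelta_in Y S \<and> Y closure_of S = GEN M R \<times> full_group M R"
  unfolding Let_def
  using std_prob.generators_dense_gdelta[OF std_prob.intro[OF assms(1)] assms(2-4)] .

end
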